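(* Let $\Sigma\subseteq N_{\mathbb{R}}$ be a smooth complete fan with $N\simeq\mathbb{Z}^2$, and let $\boldsymbol{D}$ be a toric $b$-divisor on the toric surface $X_\Sigma$, with associated conical function $\tilde\phi\colon N_{\mathbb{Q}}\to\mathbb{Q}$. Then $\boldsymbol{D}$ is integrable if and only if the infinite sum \[ \sum_{v\in N^{\mathrm{prim}}}\mu_{\boldsymbol{D}}(v)^2 \] is finite, where $\mu_{\boldsymbol{D}}(v)=0$ if $v$ spans a ray of $\Sigma$ and $\mu_{\boldsymbol{D}}(v)=\tilde\phi(v)-\tilde\phi(v_\alpha)-\tilde\phi(v_\beta)$ otherwise. Moreover, if this is the case and $\mu$ denotes the value of the series, then \[ \boldsymbol{D}^2=D_\Sigma^2-\mu . \]
   Context: Setting: $k$ is an algebraically closed field, $N$ a lattice of rank $2$, $\Sigma$ a complete smooth rational polyhedral fan in $N_{\mathbb{R}}$, $X_\Sigma$ the corresponding smooth complete toric surface over $k$. $N^{\mathrm{prim}}\subset N$ is the set of primitive vectors. For a ray $\tau$, $v_\tau$ is its primitive generator and $D_\tau$ the corresponding prime toric divisor. $R(\Sigma)$ is the set of smooth fans subdividing $\Sigma$, directed by $\Sigma''\ge\Sigma'$ iff $\Sigma''$ is a smooth subdivision of $\Sigma'$. A toric $b$-divisor $\boldsymbol{D}=(D_{\Sigma'})_{\Sigma'\in R(\Sigma)}$ is a family of torus-invariant $\mathbb{Q}$-divisors $D_{\Sigma'}$ on $X_{\Sigma'}$, compatible under push-forward along the toric morphisms $X_{\Sigma''}\to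 X_{\Sigma'}$, $\Sigma''\ge\Sigma'$; it corresponds to a conical function $\tilde\phi\colon N_{\mathbb{Q}}\to\mathbb{Q}$ by $D_{\Sigma'}=\sum_{\tau\in\Sigma'(1)}-\tilde\phi(v_\tau)D_\tau$. The degree is $\boldsymbol{D}^2:=\lim_{\Sigma'\in R(\Sigma)}D_{\Sigma'}^2$ (limit of a net), if it exists and is finite, in which case $\boldsymbol{D}$ is called integrable. The vectors $v_\alpha,v_\beta$: if $v\in N^{\mathrm{prim}}$ does not span a ray of $\Sigma$, it lies in the interior of a unique two-dimensional cone $\sigma=\operatorname{cone}(e_1,e_2)\in\Sigma$ with $\{e_1,e_2\}$ a basis of $N$; write $v=v_1e_1+v_2e_2$ with $v_1,v_2\ge1$ coprime. Let $x,y$ be the unique integers with $xv_1+yv_2=1$ and $0\le-y<v_1$ (then $1\le x\le v_2$). Put $v_\alpha=-y\,e_1+x\,e_2$ and $v_\beta=(v_1+y)e_1+(v_2-x)e_2$. Then $v=v_\alpha+v_\beta$ and $v_\alpha,v_\beta$ form a basis of $N$. *)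

theory Defs
  imports "HOL-Analysis.Analysis" "HOL-Computational_Algebra.Computational_Algebra"
begin

text \<open>
  Throughout, \<open>N\<close> is a lattice of rank two inside the plane \<open>N\<^sub>\<real> = real^2\<close>, not necessarily the
  standard one.  The dual lattice \<open>M = Hom(N, \<int>)\<close> is realised inside \<open>real^2\<close> through the inner
  product, so that the inner product of \<open>m \<in> M\<close> and \<open>v \<in> N\<close> is the canonical pairing.
\<close>

type_synonym cone = "(real^2) set"
type_synonym fan = "cone set"
type_synonym divisor = "cone \<Rightarrow> rat"

definition lattice_basis :: "(real^2) set \<Rightarrow> real^2 \<Rightarrow> real^2 \<Rightarrow> bool" where
  "lattice_basis N e1 e2 \<longleftrightarrow> e1 \<noteq> e2 \<and> independent {e1, e2} \<and>
     N = {of_int i *\<^sub>R e1 + of_int j *\<^sub>R e2 | i j. True}"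

definition rank2_lattice :: "(real^2) set \<Rightarrow> bool" where
  "rank2_lattice N \<longleftrightarrow> (\<exists>e1 e2. lattice_basis N e1 e2)"

definition dual_lattice :: "(real^2) set \<Rightarrow> (real^2) set" where
  "dual_lattice N = {m. \<forall>v\<in>N. m \<bullet> v \<in> \<int>}"

text \<open>The rational span \<open>N\<^sub>\<rat>\<close> of the lattice.\<close>

definition rational_points :: "(real^2) set \<Rightarrow> (real^2) set" where
  "rational_points N = {of_rat q *\<^sub>R v | q v. v \<in> N}"

definition primitive_vectors :: "(real^2) set \<Rightarrow> (real^2) set" where
  "primitive_vectors N = {v \<in> N. \<forall>w\<in>N. \<forall>n::int. v = of_int n *\<^sub>R w \<longrightarrow> \<bar>n\<bar> = 1}"


section \<open>Fans\<close>

definition rational_cone :: "(real^2) set \<Rightarrow> cone \<Rightarrow> bool" where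
  "rational_cone N \<sigma> \<longleftrightarrow> (\<exists>S. finite S \<and> S \<subseteq> N \<and> \<sigma> = convex_cone hull S)"

definition strongly_convex :: "cone \<Rightarrow> bool" where
  "strongly_convex \<sigma> \<longleftrightarrow> \<sigma> \<inter> uminus ` \<sigma> = {0}"

text \<open>The relation \<open>face_of\<close> of the library also admits the empty set, which is not a face of a cone.\<close>

definition cone_face :: "cone \<Rightarrow> cone \<Rightarrow> bool" where
  "cone_face \<tau> \<sigma> \<longleftrightarrow> \<tau> face_of \<sigma> \<and> \<tau> \<noteq> {}"

definition is_fan :: "(real^2) set \<Rightarrow> fan \<Rightarrow> bool" where
  "is_fan N \<Sigma> \<longleftrightarrow> finite \<Sigma> \<and> \<Sigma> \<noteq> {} \<and>
     (\<forall>\<sigma>\<in>\<Sigma>. rational_cone N \<sigma> \<and> strongly_convex \<sigma>) \<and>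
     (\<forall>\<sigma>\<in>\<Sigma>. \<forall>\<tau>. cone_face \<tau> \<sigma> \<longrightarrow> \<tau> \<in> \<Sigma>) \<and>
     (\<forall>\<sigma>\<in>\<Sigma>. \<forall>\<sigma>'\<in>\<Sigma>. cone_face (\<sigma> \<inter> \<sigma>') \<sigma> \<and> cone_face (\<sigma> \<inter> \<sigma>') \<sigma>')"

definition smooth_cone :: "(real^2) set \<Rightarrow> cone \<Rightarrow> bool" where
  "smooth_cone N \<sigma> \<longleftrightarrow>
     (\<exists>e1 e2 S. lattice_basis N e1 e2 \<and> S \<subseteq> {e1, e2} \<and> \<sigma> = convex_cone hull S)"

definition smooth_fan :: "(real^2) set \<Rightarrow> fan \<Rightarrow> bool" where
  "smooth_fan N \<Sigma> \<longleftrightarrow> is_fan N \<Sigma> \<and> (\<forall>\<sigma>\<in>\<Sigma>. smooth_cone N \<sigma>)"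

definition complete_fan :: "fan \<Rightarrow> bool" where
  "complete_fan \<Sigma> \<longleftrightarrow> \<Union>\<Sigma> = UNIV"

definition rays :: "fan \<Rightarrow> cone set" where
  "rays \<Sigma> = {\<tau>\<in>\<Sigma>. dim \<tau> = 1}"

definition ray_generator :: "(real^2) set \<Rightarrow> cone \<Rightarrow> real^2" where
  "ray_generator N \<tau> = (THE v. v \<in> primitive_vectors N \<and> v \<in> \<tau>)"

definition subdivides :: "fan \<Rightarrow> fan \<Rightarrow> bool" where
  "subdivides \<Sigma>' \<Sigma> \<longleftrightarrow> \<Union>\<Sigma>' = \<Union>\<Sigma> \<and> (\<forall>\<sigma>'\<in>\<Sigma>'. \<exists>\<sigma>\<in>\<Sigma>. \<sigma>' \<subseteq> \<sigma>)"

text \<open>The index set \<open>R(\<Sigma>)\<close>.\<close>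

definition smooth_subdivisions :: "(real^2) set \<Rightarrow> fan \<Rightarrow> fan set" where
  "smooth_subdivisions N \<Sigma> = {\<Sigma>'. smooth_fan N \<Sigma>' \<and> subdivides \<Sigma>' \<Sigma>}"


section \<open>Toric divisors and their intersection numbers\<close>

text \<open>
  The closed points of the toric variety \<open>X\<^sub>\<Sigma>\<close> over \<open>k\<close>: the affine chart of a cone \<open>\<sigma>\<close> is
  \<open>Spec k[S]\<close> with \<open>S = \<sigma>\<^sup>\<or> \<inter> M\<close>, its closed points are the monoid homomorphisms
  \<open>S \<rightarrow> (k, \<cdot>)\<close>, and the torus orbit \<open>O(\<sigma>)\<close> consists of those that are non-zero exactly on
  \<open>\<sigma>\<^sup>\<bottom> \<inter> M\<close>.  As \<open>X\<^sub>\<Sigma>\<close> is the disjoint union of the orbits \<open>O(\<sigma>)\<close>, \<open>\<sigma> \<in> \<Sigma>\<close>, its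
  points are encoded as pairs of a cone and such a homomorphism.
\<close>

definition cone_monoid :: "(real^2) set \<Rightarrow> cone \<Rightarrow> (real^2) set" where
  "cone_monoid N \<sigma> = {m \<in> dual_lattice N. \<forall>u\<in>\<sigma>. 0 \<le> m \<bullet> u}"

definition torus_orbit :: "(real^2) set \<Rightarrow> cone \<Rightarrow> (cone \<times> (real^2 \<Rightarrow> 'k::field)) set" where
  "torus_orbit N \<sigma> = {\<sigma>} \<times> {\<gamma> \<in> extensional (cone_monoid N \<sigma>). \<gamma> 0 = 1 \<and>
     (\<forall>m\<in>cone_monoid N \<sigma>. \<forall>m'\<in>cone_monoid N \<sigma>. \<gamma> (m + m') = \<gamma> m * \<gamma> m') \<and>
     (\<forall>m\<in>cone_monoid N \<sigma>. \<gamma> m \<noteq> 0 \<longleftrightarrow> (\<forall>u\<in>\<sigma>. m \<bullet> u = 0))}"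

text \<open>The prime toric divisor \<open>D\<^sub>\<tau>\<close> as a curve on \<open>X\<^sub>\<Sigma>\<close>: the closure of the orbit \<open>O(\<tau>)\<close>.\<close>

definition toric_curve :: "(real^2) set \<Rightarrow> fan \<Rightarrow> cone \<Rightarrow> (cone \<times> (real^2 \<Rightarrow> 'k::field)) set" where
  "toric_curve N \<Sigma> \<tau> = (\<Union>\<sigma>\<in>{\<sigma>\<in>\<Sigma>. cone_face \<tau> \<sigma>}. torus_orbit N \<sigma>)"

text \<open>
  A torus-invariant \<open>\<rat>\<close>-divisor \<open>\<Sum>\<tau>. E \<tau> \<cdot> D\<^sub>\<tau>\<close> is given by its coefficients.
\<close>

definition toric_divisors :: "fan \<Rightarrow> divisor set" where
  "toric_divisors \<Sigma> = {E. \<forall>\<tau>. \<tau> \<notin> rays \<Sigma> \<longrightarrow> E \<tau> = 0}"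

definition prime_divisor :: "cone \<Rightarrow> divisor" where
  "prime_divisor \<tau> = (\<lambda>\<rho>. if \<rho> = \<tau> then 1 else 0)"

text \<open>
  The divisor of the character \<open>\<chi>\<^sup>m\<close>, which vanishes along \<open>D\<^sub>\<tau>\<close> to the order \<open>m \<bullet> v\<^sub>\<tau>\<close>.
  These are all the torus-invariant principal divisors on \<open>X\<^sub>\<Sigma>\<close>, for complete \<open>\<Sigma>\<close>.
\<close>

definition character_divisor :: "(real^2) set \<Rightarrow> fan \<Rightarrow> real^2 \<Rightarrow> divisor" where
  "character_divisor N \<Sigma> m =
     (\<lambda>\<tau>. if \<tau> \<in> rays \<Sigma> then of_int \<lfloor>m \<bullet> ray_generator N \<tau>\<rfloor> else 0)"

text \<open>
  The intersection pairing on a smooth complete surface is the symmetric bilinear form on divisors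
  that depends only on linear equivalence classes and counts the common points of two smooth
  curves meeting transversally.  The form below is its restriction to torus-invariant divisors.
  Distinct curves \<open>D\<^sub>\<tau>\<close> on a smooth toric surface are smooth and meet transversally (in the
  chart \<open>\<bbbA>\<^sup>2\<close> of a maximal cone they are the coordinate axes), and linear equivalence
  of torus-invariant divisors is given by the divisors of characters.
  Each \<open>D\<^sub>\<tau>\<close> is linearly equivalent to a combination of other \<open>D\<^sub>\<rho>\<close>, so that these properties
  also determine the self-intersection numbers.
\<close>

definition intersection_pairing ::
  "'k::alg_closed_field itself \<Rightarrow> (real^2) set \<Rightarrow> fan \<Rightarrow> (divisor \<Rightarrow> divisor \<Rightarrow> rat) \<Rightarrow> bool" where
  "intersection_pairing _ N \<Sigma> B \<longleftrightarrow>
     (\<forall>E\<in>toric_divisors \<Sigma>. \<forall>F\<in>toric_divisors \<Sigma>. B E F = B F E) \<and>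
     (\<forall>E\<in>toric_divisors \<Sigma>. \<forall>E'\<in>toric_divisors \<Sigma>. \<forall>F\<in>toric_divisors \<Sigma>.
        B (\<lambda>\<tau>. E \<tau> + E' \<tau>) F = B E F + B E' F) \<and>
     (\<forall>c. \<forall>E\<in>toric_divisors \<Sigma>. \<forall>F\<in>toric_divisors \<Sigma>. B (\<lambda>\<tau>. c * E \<tau>) F = c * B E F) \<and>
     (\<forall>m\<in>dual_lattice N. \<forall>F\<in>toric_divisors \<Sigma>. B (character_divisor N \<Sigma> m) F = 0) \<and>
     (\<forall>\<tau>\<in>rays \<Sigma>. \<forall>\<rho>\<in>rays \<Sigma>. \<tau> \<noteq> \<rho> \<longrightarrow>
        B (prime_divisor \<tau>) (prime_divisor \<rho>) =
        of_nat (card (toric_curve N \<Sigma> \<tau> \<inter> toric_curve N \<Sigma> \<rho> :: (cone \<times> (real^2 \<Rightarrow> 'k)) set)))"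

definition intersection_number ::
  "'k::alg_closed_field itself \<Rightarrow> (real^2) set \<Rightarrow> fan \<Rightarrow> divisor \<Rightarrow> divisor \<Rightarrow> rat" where
  "intersection_number K N \<Sigma> E F = (THE q. \<exists>B. intersection_pairing K N \<Sigma> B \<and> q = B E F)"


section \<open>Toric b-divisors\<close>

text \<open>
  Push-forward along the birational toric morphism \<open>X\<^sub>\<Sigma>\<^sub>'\<^sub>' \<rightarrow> X\<^sub>\<Sigma>\<^sub>'\<close> of a subdivision
  \<open>\<Sigma>''\<close> of \<open>\<Sigma>'\<close>: the curve \<open>D\<^sub>\<tau>\<close> maps birationally onto \<open>D\<^sub>\<tau>\<close> if \<open>\<tau>\<close> is a ray of \<open>\<Sigma>'\<close>
  and is contracted to a point otherwise.
\<close>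

definition push_forward :: "fan \<Rightarrow> divisor \<Rightarrow> divisor" where
  "push_forward \<Sigma>' E = (\<lambda>\<tau>. if \<tau> \<in> rays \<Sigma>' then E \<tau> else 0)"

definition toric_b_divisor :: "(real^2) set \<Rightarrow> fan \<Rightarrow> (fan \<Rightarrow> divisor) \<Rightarrow> bool" where
  "toric_b_divisor N \<Sigma> D \<longleftrightarrow>
     (\<forall>\<Sigma>'\<in>smooth_subdivisions N \<Sigma>. D \<Sigma>' \<in> toric_divisors \<Sigma>') \<and>
     (\<forall>\<Sigma>'\<in>smooth_subdivisions N \<Sigma>. \<forall>\<Sigma>''\<in>smooth_subdivisions N \<Sigma>.
        subdivides \<Sigma>'' \<Sigma>' \<longrightarrow> push_forward \<Sigma>' (D \<Sigma>'') = D \<Sigma>')"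

text \<open>Only the values of \<open>\<phi>\<close> on \<open>N\<^sub>\<rat>\<close> matter.\<close>

definition conical :: "(real^2) set \<Rightarrow> (real^2 \<Rightarrow> rat) \<Rightarrow> bool" where
  "conical N \<phi> \<longleftrightarrow>
     (\<forall>v\<in>rational_points N. \<forall>q\<ge>0. \<phi> (of_rat q *\<^sub>R v) = q * \<phi> v)"

definition associated_function ::
  "(real^2) set \<Rightarrow> fan \<Rightarrow> (fan \<Rightarrow> divisor) \<Rightarrow> (real^2 \<Rightarrow> rat) \<Rightarrow> bool" where
  "associated_function N \<Sigma> D \<phi> \<longleftrightarrow> conical N \<phi> \<and>
     (\<forall>\<Sigma>'\<in>smooth_subdivisions N \<Sigma>. \<forall>\<tau>\<in>rays \<Sigma>'. D \<Sigma>' \<tau> = - \<phi> (ray_generator N \<tau>))"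

text \<open>The filter of tails of the directed set \<open>R(\<Sigma>)\<close>; limits along it are limits of nets.\<close>

definition subdivision_filter :: "(real^2) set \<Rightarrow> fan \<Rightarrow> fan filter" where
  "subdivision_filter N \<Sigma> = (INF \<Sigma>'\<in>smooth_subdivisions N \<Sigma>.
     principal {\<Sigma>''\<in>smooth_subdivisions N \<Sigma>. subdivides \<Sigma>'' \<Sigma>'})"

definition b_integrable ::
  "'k::alg_closed_field itself \<Rightarrow> (real^2) set \<Rightarrow> fan \<Rightarrow> (fan \<Rightarrow> divisor) \<Rightarrow> bool" where
  "b_integrable K N \<Sigma> D \<longleftrightarrow> (\<exists>L::real.
     ((\<lambda>\<Sigma>'. of_rat (intersection_number K N \<Sigma>' (D \<Sigma>') (D \<Sigma>'))) \<longlongrightarrow> L) (subdivision_filter N \<Sigma>))"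

definition b_degree ::
  "'k::alg_closed_field itself \<Rightarrow> (real^2) set \<Rightarrow> fan \<Rightarrow> (fan \<Rightarrow> divisor) \<Rightarrow> real" where
  "b_degree K N \<Sigma> D =
     Lim (subdivision_filter N \<Sigma>) (\<lambda>\<Sigma>'. of_rat (intersection_number K N \<Sigma>' (D \<Sigma>') (D \<Sigma>')))"


section \<open>The function \<open>\<mu>\<close>\<close>

text \<open>
  \<open>canonical_splitting N \<Sigma> v a b\<close>: for some ordering \<open>e\<^sub>1, e\<^sub>2\<close> of the generators of the
  maximal cone containing \<open>v\<close> in its interior, \<open>a = v\<^sub>\<alpha>\<close> and \<open>b = v\<^sub>\<beta>\<close>.
  The other ordering interchanges \<open>v\<^sub>\<alpha>\<close> and \<open>v\<^sub>\<beta>\<close>, which does not affect \<open>\<mu>\<close>.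
\<close>

definition canonical_splitting ::
  "(real^2) set \<Rightarrow> fan \<Rightarrow> real^2 \<Rightarrow> real^2 \<Rightarrow> real^2 \<Rightarrow> bool" where
  "canonical_splitting N \<Sigma> v a b \<longleftrightarrow>
     (\<exists>e1 e2 (v1::int) (v2::int) (x::int) (y::int).
        lattice_basis N e1 e2 \<and> convex_cone hull {e1, e2} \<in> \<Sigma> \<and>
        v = of_int v1 *\<^sub>R e1 + of_int v2 *\<^sub>R e2 \<and> v1 \<ge> 1 \<and> v2 \<ge> 1 \<and> coprime v1 v2 \<and>
        x * v1 + y * v2 = 1 \<and> 0 \<le> - y \<and> - y < v1 \<and>
        a = of_int (- y) *\<^sub>R e1 + of_int x *\<^sub>R e2 \<and>
        b = of_int (v1 + y) *\<^sub>R e1 + of_int (v2 - x) *\<^sub>R e2)"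

definition mu :: "(real^2) set \<Rightarrow> fan \<Rightarrow> (real^2 \<Rightarrow> rat) \<Rightarrow> real^2 \<Rightarrow> rat" where
  "mu N \<Sigma> \<phi> v =
     (if convex_cone hull {v} \<in> rays \<Sigma> then 0
      else let (a, b) = (SOME (a, b). canonical_splitting N \<Sigma> v a b) in \<phi> v - \<phi> a - \<phi> b)"

end

theory Submission
  imports Defs
begin

text \<open>
  A smooth complete fan is a cyclic arrangement of unimodular sectors, and its smooth
  subdivisions correspond to the larger generator sets.  Any refinement is reached by successively
  inserting \<open>u + v\<close> into a sector spanned by \<open>u\<close> and \<open>v\<close>, that is, by blowing up torus-fixed
  points.  From \<open>D\<^sub>u \<cdot> D\<^sub>v = 1\<close> for neighbours and the relations coming from characters one reads off
  that such a blow-up lowers \<open>D\<^sup>2\<close> by \<open>(\<phi> (u + v) - \<phi> u - \<phi> v)\<^sup>2\<close>, and the pair \<open>u\<close>, \<open>v\<close> is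
  the canonical splitting of \<open>u + v\<close>, by uniqueness of Bezout coefficients in a bounded range.
  Hence \<open>D\<^sup>2\<close> on a subdivision is \<open>D\<^sup>2\<close> on the original fan minus the sum of \<open>\<mu>\<^sup>2\<close> over its
  generators.  A subtractive Euclidean algorithm shows that every finite set of primitive vectors
  occurs among the generators of some subdivision, so the net of degrees converges exactly when
  the series does.
\<close>

section \<open>Planar cones and their faces\<close>

text \<open>Cyclic order is handled without angles: the order inside a pair with
  \<open>vol u v = 1\<close> carries the orientation, relative position becomes a matter of signs of
  determinants, and integrality on the lattice turns inequalities into equalities. What makes
  refinements factor into insertions of sums is that a sector \<open>(u, v)\<close> not kept by a
  refinement must have \<open>u + v\<close> among the new generators; see
  \<open>refined_sector_sum\<close>. A separate obstacle is that \<open>intersection_number\<close>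
  is a definite description over bilinear forms. Before any degree can be computed, a form with the
  required properties has to be exhibited and shown to be the only one. Characters govern both
  halves: they force the self-intersection numbers, and the linear relation between a generator and
  its two neighbours shows that the explicit form vanishes on them.\<close>

lemma convex_cone_hull_insert:
  "x \<in> convex_cone hull (insert u S) \<longleftrightarrow> (\<exists>a y. 0 \<le> a \<and> y \<in> convex_cone hull S \<and> x = a *\<^sub>R u + y)"
proof
  let ?T = "{x. \<exists>a y. 0 \<le> a \<and> y \<in> convex_cone hull S \<and> x = a *\<^sub>R u + y}"
  have T: "convex_cone ?T"
  proof (rule convex_cone_iff[THEN iffD2], intro conjI ballI allI impI)
    show "0 \<in> ?T"
      by (auto intro!: exI[of _ 0] convex_cone_hull_contains_0)
  next
    fix x y assume "x \<in> ?T" "y \<in> ?T"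
    then obtain a b p q where "0 \<le> a" "0 \<le> b" "p \<in> convex_cone hull S" "q \<in> convex_cone hull S"
      "x = a *\<^sub>R u + p" "y = b *\<^sub>R u + q" by auto
    then show "x + y \<in> ?T"
      by (intro CollectI exI[of _ "a + b"] exI[of _ "p + q"])
        (auto simp: convex_cone_hull_add algebra_simps)
  next
    fix x and c :: real assume "x \<in> ?T" "0 \<le> c"
    then obtain a p where "0 \<le> a" "p \<in> convex_cone hull S" "x = a *\<^sub>R u + p" by auto
    with \<open>0 \<le> c\<close> show "c *\<^sub>R x \<in> ?T"
      by (intro CollectI exI[of _ "c * a"] exI[of _ "c *\<^sub>R p"])
        (auto simp: convex_cone_hull_mul algebra_simps)
  qed
  have "insert u S \<subseteq> ?T"
  proof -
    have "u = 1 *\<^sub>R u + 0" "0 \<in> convex_cone hull S"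
      by (auto simp: convex_cone_hull_contains_0)
    then have "u \<in> ?T" by (metis (mono_tags, lifting) CollectI zero_le_one)
    moreover have "x \<in> ?T" if "x \<in> S" for x
      using hull_inc[OF that, of convex_cone]
      by (intro CollectI exI[of _ "0::real"] exI[of _ x]) auto
    ultimately show ?thesis by auto
  qed
  then have "convex_cone hull (insert u S) \<subseteq> ?T"
    using T by (rule hull_minimal)
  then show "x \<in> convex_cone hull (insert u S) \<Longrightarrow> \<exists>a y. 0 \<le> a \<and> y \<in> convex_cone hull S \<and> x = a *\<^sub>R u + y"
    by blast
next
  assume "\<exists>a y. 0 \<le> a \<and> y \<in> convex_cone hull S \<and> x = a *\<^sub>R u + y"
  then obtain a y where "0 \<le> a" "y \<in> convex_cone hull S" "x = a *\<^sub>R u + y" by blast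
  moreover have "convex_cone hull S \<subseteq> convex_cone hull (insert u S)"
    by (rule hull_mono) auto
  moreover have "u \<in> convex_cone hull (insert u S)"
    by (simp add: hull_inc)
  ultimately show "x \<in> convex_cone hull (insert u S)"
    by (auto intro!: convex_cone_hull_add convex_cone_hull_mul)
qed

lemma convex_cone_hull_empty [simp]: "convex_cone hull {} = {0}"
  by (simp add: hull_minimal convex_cone_hull_contains_0 set_eq_subset)

lemma mem_convex_cone_hull_singleton:
  "x \<in> convex_cone hull {u} \<longleftrightarrow> (\<exists>a\<ge>0. x = a *\<^sub>R u)"
  by (auto simp: convex_cone_hull_insert)

lemma mem_convex_cone_hull_pair:
  "x \<in> convex_cone hull {u, v} \<longleftrightarrow> (\<exists>a\<ge>0. \<exists>b\<ge>0. x = a *\<^sub>R u + b *\<^sub>R v)"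
  unfolding convex_cone_hull_insert[of x u] mem_convex_cone_hull_singleton by auto

text \<open>For cones the segments in \<open>face_of\<close> can be traded for sums:
  \<open>a + b\<close> is twice a midpoint, and conversely the summands
  \<open>(1 - t) *\<^sub>R a\<close> and \<open>t *\<^sub>R b\<close> of a point of a segment can be
  rescaled to \<open>a\<close> and \<open>b\<close>. Faces are computed in this form below.\<close>

lemma cone_face_iff:
  assumes S: "convex_cone S"
  shows "cone_face T S \<longleftrightarrow>
    convex_cone T \<and> T \<subseteq> S \<and> (\<forall>a\<in>S. \<forall>b\<in>S. a + b \<in> T \<longrightarrow> a \<in> T \<and> b \<in> T)" (is "_ \<longleftrightarrow> ?R")
proof
  assume T: "cone_face T S"
  have conic: "conic T"
    using T S face_of_conic unfolding cone_face_def convex_cone_def by blast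
  have "convex_cone T"
    using T conic unfolding cone_face_def convex_cone_def face_of_def by blast
  moreover have "a \<in> T \<and> b \<in> T" if ab: "a \<in> S" "b \<in> S" "a + b \<in> T" for a b
  proof -
    have m: "(1/2) *\<^sub>R (a + b) \<in> T"
      using conic ab(3) by (simp add: conic_def)
    show ?thesis
    proof (cases "a = b")
      case True
      then show ?thesis using m by (simp flip: scaleR_2)
    next
      case False
      then have "(1/2) *\<^sub>R (a + b) \<in> open_segment a b"
        unfolding in_segment by (auto intro!: exI[of _ "1/2"] simp: scaleR_add_right)
      then show ?thesis
        using T ab m unfolding cone_face_def face_of_def by blast
    qed
  qed
  moreover have "T \<subseteq> S" using T unfolding cone_face_def face_of_def by blast
  ultimately show ?R by blast
next
  assume R: ?R
  have "a \<in> T \<and> b \<in> T" if ab: "a \<in> S" "b \<in> S" "x \<in> T" "x \<in> open_segment a b" for a b x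
  proof -
    obtain t where t: "0 < t" "t < 1" "x = (1 - t) *\<^sub>R a + t *\<^sub>R b"
      using ab(4) unfolding in_segment by blast
    have "(1 - t) *\<^sub>R a \<in> S" "t *\<^sub>R b \<in> S"
      using S t ab by (auto intro!: convex_cone_scaleR)
    then have "(1 - t) *\<^sub>R a \<in> T" "t *\<^sub>R b \<in> T"
      using R ab t by blast+
    then have "inverse (1 - t) *\<^sub>R (1 - t) *\<^sub>R a \<in> T" "inverse t *\<^sub>R t *\<^sub>R b \<in> T"
      using R t by (auto intro!: convex_cone_scaleR simp del: scaleR_scaleR)
    then show ?thesis using t by simp
  qed
  then show "cone_face T S"
    using R unfolding cone_face_def face_of_def convex_cone_def by blast
qed

lemma cone_face_zero: "cone_face T {0} \<longleftrightarrow> T = {0}"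
  by (subst cone_face_iff) (auto dest: convex_cone_nonempty)


section \<open>The determinant form of a planar lattice\<close>

locale planar_lattice =
  fixes N :: "(real^2) set" and b1 b2 :: "real^2"
  assumes basis: "lattice_basis N b1 b2"
begin

text \<open>Dividing by the determinant of the basis makes the form integral on \<open>N\<close> and
  gives lattice bases the value 1 or -1, whatever the position of \<open>N\<close> in the plane. The
  chosen basis also fixes the orientation.\<close>

definition vol :: "real^2 \<Rightarrow> real^2 \<Rightarrow> real" where
  "vol u v = (u$1 * v$2 - u$2 * v$1) / (b1$1 * b2$2 - b1$2 * b2$1)"

lemma vol_add_left [simp]: "vol (u + u') v = vol u v + vol u' v"
  and vol_add_right [simp]: "vol u (v + v') = vol u v + vol u v'"
  and vol_minus_left [simp]: "vol (- u) v = - vol u v"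
  and vol_minus_right [simp]: "vol u (- v) = - vol u v"
  and vol_scaleR_left [simp]: "vol (c *\<^sub>R u) v = c * vol u v"
  and vol_scaleR_right [simp]: "vol u (c *\<^sub>R v) = c * vol u v"
  and vol_zero_left [simp]: "vol 0 v = 0"
  and vol_zero_right [simp]: "vol u 0 = 0"
  and vol_self [simp]: "vol u u = 0"
  by (simp_all add: vol_def algebra_simps add_divide_distrib diff_divide_distrib)

lemma vol_commute: "vol v u = - vol u v"
  by (simp add: vol_def minus_divide_left)

lemma denominator_nonzero: "b1$1 * b2$2 - b1$2 * b2$1 \<noteq> 0"
proof
  assume d: "b1$1 * b2$2 - b1$2 * b2$1 = 0"
  have ind: "b1 \<noteq> b2" "independent {b1, b2}"
    using basis by (auto simp: lattice_basis_def)
  then have nz: "b1 \<noteq> 0" "b2 \<noteq> 0"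
    using dependent_zero by blast+
  have "independent (insert b2 {b1})"
    using ind by (simp add: insert_commute)
  then have sp: "b2 \<notin> span {b1}"
    using ind(1) unfolding independent_insert by auto
  have "(b1$1) *\<^sub>R b2 = (b2$1) *\<^sub>R b1" "(b1$2) *\<^sub>R b2 = (b2$2) *\<^sub>R b1"
    using d by (simp_all add: vec_eq_iff forall_2 mult.commute)
  moreover have "b1$1 \<noteq> 0 \<or> b1$2 \<noteq> 0"
    using nz(1) by (auto simp: vec_eq_iff forall_2)
  ultimately have "\<exists>c. b2 = c *\<^sub>R b1"
    by (metis (no_types, opaque_lifting) scaleR_scaleR left_inverse scaleR_one)
  then show False using sp by (auto simp: span_base span_scale)
qed

lemma vol_basis [simp]: "vol b1 b2 = 1"
  using denominator_nonzero by (simp add: vol_def)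

lemma vol_cramer: "vol u v *\<^sub>R x = vol x v *\<^sub>R u + vol u x *\<^sub>R v"
  by (simp add: vol_def vec_eq_iff forall_2 algebra_simps diff_divide_distrib)

lemma unimodular_coords: "vol u v = 1 \<Longrightarrow> x = vol x v *\<^sub>R u + vol u x *\<^sub>R v"
  using vol_cramer[of u v x] by simp

lemma vol_eqI: "vol u v = 1 \<Longrightarrow> vol x v = vol y v \<Longrightarrow> vol u x = vol u y \<Longrightarrow> x = y"
  using unimodular_coords by metis

text \<open>\<open>vol x v\<close> and \<open>vol u x\<close> are the coordinates of
  \<open>x\<close> with respect to \<open>u\<close>, \<open>v\<close>; this is the 2 by 2
  determinant in these coordinates.\<close>

lemma vol_expand:
  assumes "vol u v = 1"
  shows "vol x y = vol x v * vol u y - vol u x * vol y v"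
proof -
  have "vol x y = vol (vol x v *\<^sub>R u + vol u x *\<^sub>R v) y"
    using unimodular_coords[OF assms, of x] by simp
  also have "\<dots> = vol x v * vol u y - vol u x * vol y v"
    using vol_commute[of v y] by simp
  finally show ?thesis .
qed

lemma lattice_mem_iff: "x \<in> N \<longleftrightarrow> (\<exists>i j :: int. x = of_int i *\<^sub>R b1 + of_int j *\<^sub>R b2)"
  using basis by (auto simp: lattice_basis_def)

lemma lattice_add: "x \<in> N \<Longrightarrow> y \<in> N \<Longrightarrow> x + y \<in> N"
  unfolding lattice_mem_iff
  apply clarify
  subgoal for i i' j j'
    by (rule exI[of _ "i + i'"], rule exI[of _ "j + j'"]) (simp add: algebra_simps)
  done

lemma lattice_scale_int: "x \<in> N \<Longrightarrow> of_int k *\<^sub>R x \<in> N"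
  unfolding lattice_mem_iff
  apply clarify
  subgoal for i j
    by (rule exI[of _ "k * i"], rule exI[of _ "k * j"]) (simp add: algebra_simps)
  done

lemma vol_Ints: "x \<in> N \<Longrightarrow> y \<in> N \<Longrightarrow> vol x y \<in> \<int>"
  using vol_commute[of b2 b1] by (auto simp: lattice_mem_iff)

lemma vol_int: "x \<in> N \<Longrightarrow> y \<in> N \<Longrightarrow> \<exists>k::int. vol x y = of_int k"
  using vol_Ints by (auto simp: Ints_def)

text \<open>In one direction, the integral change of basis has a determinant whose product with the
  integer \<open>vol u v\<close> is 1. In the other, Cramer's rule gives integral coordinates up to
  the unit \<open>vol u v\<close>.\<close>

lemma lattice_basis_iff: "lattice_basis N u v \<longleftrightarrow> u \<in> N \<and> v \<in> N \<and> \<bar>vol u v\<bar> = 1"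
proof
  assume uv: "lattice_basis N u v"
  then have N: "u \<in> N" "v \<in> N"
    unfolding lattice_basis_def
    by (auto intro: exI[of _ 0] exI[of _ 1] simp del: of_int_0 of_int_1)
      (metis (no_types, lifting) of_int_0 of_int_1 scaleR_one scaleR_zero_left add_0 add.right_neutral)+
  have "b1 \<in> N" "b2 \<in> N"
    unfolding lattice_mem_iff
    by (metis of_int_0 of_int_1 scaleR_one scaleR_zero_left add_0 add.right_neutral)+
  then obtain i j k l :: int where
    ij: "b1 = of_int i *\<^sub>R u + of_int j *\<^sub>R v" and kl: "b2 = of_int k *\<^sub>R u + of_int l *\<^sub>R v"
    using uv unfolding lattice_basis_def by blast
  have "vol b1 b2 = of_int i * vol u b2 + of_int j * vol v b2"
    using arg_cong[OF ij, of "\<lambda>x. vol x b2"] by simp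
  moreover have "vol u b2 = of_int l * vol u v" "vol v b2 = - of_int k * vol u v"
    using arg_cong[OF kl, of "vol u"] arg_cong[OF kl, of "vol v"] vol_commute[of v u] by simp_all
  ultimately have "vol b1 b2 = of_int (i * l - j * k) * vol u v"
    by (simp add: algebra_simps)
  moreover obtain m :: int where m: "vol u v = of_int m" using vol_int N by blast
  ultimately have "1 = (i * l - j * k) * m"
    by (metis of_int_eq_iff of_int_mult of_int_1 vol_basis)
  then have "\<bar>m\<bar> = 1" by (metis zmult_eq_1_iff abs_one abs_minus_cancel)
  then show "u \<in> N \<and> v \<in> N \<and> \<bar>vol u v\<bar> = 1" using N m by (metis of_int_abs of_int_1)
next
  assume R: "u \<in> N \<and> v \<in> N \<and> \<bar>vol u v\<bar> = 1"
  define e where "e = vol u v"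
  have e: "e * e = 1" "e \<noteq> 0" using R by (auto simp: e_def abs_if split: if_splits)
  have ne: "u \<noteq> v" using R by auto
  have "v \<notin> span {u}" using e by (auto simp: e_def span_singleton)
  moreover have "u \<noteq> 0" using R by auto
  ultimately have "independent {v, u}"
    using ne by (simp add: independent_insert)
  moreover have "N = {of_int i *\<^sub>R u + of_int j *\<^sub>R v | i j. True}"
  proof (intro equalityI subsetI)
    fix x assume x: "x \<in> N"
    obtain i j k :: int where "vol x v = of_int i" "vol u x = of_int j" and k: "e = of_int k"
      using vol_int x R unfolding e_def by metis
    then have "e *\<^sub>R x = of_int i *\<^sub>R u + of_int j *\<^sub>R v"
      using vol_cramer[of u v x] by (simp add: e_def)
    \<comment> \<open>Since \<open>e * e = 1\<close>, multiplying once more by \<open>e\<close>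
      moves the sign to the integral coefficients.\<close>
    then have "e *\<^sub>R e *\<^sub>R x = of_int (k * i) *\<^sub>R u + of_int (k * j) *\<^sub>R v"
      using k by (simp add: scaleR_add_right del: of_int_eq_iff)
    then have "x = of_int (k * i) *\<^sub>R u + of_int (k * j) *\<^sub>R v" using e by simp
    then show "x \<in> {of_int i *\<^sub>R u + of_int j *\<^sub>R v | i j. True}" by blast
  next
    fix x assume "x \<in> {of_int i *\<^sub>R u + of_int j *\<^sub>R v | i j. True}"
    then show "x \<in> N" using R lattice_add lattice_scale_int by auto
  qed
  ultimately show "lattice_basis N u v"
    using ne unfolding lattice_basis_def by (simp add: insert_commute)
qed

end

section \<open>Rays and sectors: faces and relative position\<close>

abbreviation ray :: "real^2 \<Rightarrow> cone" where
  "ray u \<equiv> convex_cone hull {u}"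

abbreviation sector :: "real^2 \<Rightarrow> real^2 \<Rightarrow> cone" where
  "sector u v \<equiv> convex_cone hull {u, v}"

lemma mem_self_ray: "u \<in> ray u" and mem_self_sector: "u \<in> sector u v" "v \<in> sector u v"
  by (simp_all add: hull_inc)

lemma dim_convex_cone_hull: "dim (convex_cone hull S) = dim S" for S :: "'a::euclidean_space set"
proof (rule antisym)
  have "convex_cone hull S \<subseteq> span S"
    by (simp add: hull_minimal span_superset convex_cone_span)
  then show "dim (convex_cone hull S) \<le> dim S" by (rule dim_mono)
  show "dim S \<le> dim (convex_cone hull S)" by (simp add: dim_subset hull_subset)
qed

context planar_lattice
begin

definition open_sector :: "real^2 \<Rightarrow> real^2 \<Rightarrow> (real^2) set" where
  "open_sector u v = {x. 0 < vol x v \<and> 0 < vol u x}"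

lemma mem_open_sector: "x \<in> open_sector u v \<longleftrightarrow> 0 < vol x v \<and> 0 < vol u x"
  by (simp add: open_sector_def)

lemma mem_sector:
  assumes "vol u v = 1"
  shows "x \<in> sector u v \<longleftrightarrow> 0 \<le> vol x v \<and> 0 \<le> vol u x"
proof
  assume "x \<in> sector u v"
  then show "0 \<le> vol x v \<and> 0 \<le> vol u x"
    using assms by (auto simp: mem_convex_cone_hull_pair)
next
  assume "0 \<le> vol x v \<and> 0 \<le> vol u x"
  then show "x \<in> sector u v"
    unfolding mem_convex_cone_hull_pair using unimodular_coords[OF assms] by blast
qed

lemma mem_ray_left:
  assumes "vol u v = 1"
  shows "x \<in> ray u \<longleftrightarrow> 0 \<le> vol x v \<and> vol u x = 0"
proof
  assume "x \<in> ray u"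
  then show "0 \<le> vol x v \<and> vol u x = 0"
    using assms by (auto simp: mem_convex_cone_hull_singleton)
next
  assume x: "0 \<le> vol x v \<and> vol u x = 0"
  then have "x = vol x v *\<^sub>R u" using unimodular_coords[OF assms, of x] by simp
  then show "x \<in> ray u" unfolding mem_convex_cone_hull_singleton using x by blast
qed

lemma mem_ray_right:
  assumes "vol u v = 1"
  shows "x \<in> ray v \<longleftrightarrow> vol x v = 0 \<and> 0 \<le> vol u x"
proof
  assume "x \<in> ray v"
  then show "vol x v = 0 \<and> 0 \<le> vol u x"
    using assms by (auto simp: mem_convex_cone_hull_singleton)
next
  assume x: "vol x v = 0 \<and> 0 \<le> vol u x"
  then have "x = vol u x *\<^sub>R v" using unimodular_coords[OF assms, of x] by simp
  then show "x \<in> ray v" unfolding mem_convex_cone_hull_singleton using x by blast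
qed

lemma open_sector_subset: "vol u v = 1 \<Longrightarrow> open_sector u v \<subseteq> sector u v"
  by (auto simp: mem_sector mem_open_sector)

lemma sector_eq_union:
  assumes "vol u v = 1"
  shows "sector u v = open_sector u v \<union> ray u \<union> ray v"
  using assms by (auto simp: mem_sector mem_ray_left[OF assms] mem_ray_right[OF assms] mem_open_sector)

lemma ray_subset_iff: "convex_cone S \<Longrightarrow> ray u \<subseteq> S \<longleftrightarrow> u \<in> S"
  by (meson empty_subsetI hull_minimal insert_subset mem_self_ray subsetD)

lemma sector_subset_iff: "convex_cone S \<Longrightarrow> sector u v \<subseteq> S \<longleftrightarrow> u \<in> S \<and> v \<in> S"
  by (meson empty_subsetI hull_minimal insert_subset mem_self_sector subsetD)

lemma cone_face_ray:
  assumes "u \<noteq> 0"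
  shows "cone_face T (ray u) \<longleftrightarrow> T = {0} \<or> T = ray u"
proof
  assume "cone_face T (ray u)"
  then have T: "convex_cone T" "T \<subseteq> ray u"
    by (simp_all add: cone_face_iff convex_cone_convex_cone_hull)
  show "T = {0} \<or> T = ray u"
  proof (cases "u \<in> T")
    case True
    then show ?thesis using T by (auto simp: ray_subset_iff[symmetric])
  next
    case False
    have "x = 0" if x: "x \<in> T" for x
    proof (rule ccontr)
      assume "x \<noteq> 0"
      then obtain a where "a > 0" "x = a *\<^sub>R u"
        using x T(2) unfolding mem_convex_cone_hull_singleton
        by (metis (no_types, opaque_lifting) mem_convex_cone_hull_singleton order_le_less scaleR_zero_left subsetD)
      then have "u = inverse a *\<^sub>R x" "0 \<le> inverse a" by auto
      then show False using False x T(1) convex_cone_scaleR by metis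
    qed
    then show ?thesis using convex_cone_contains_0[OF T(1)] by blast
  qed
next
  assume "T = {0} \<or> T = ray u"
  then show "cone_face T (ray u)"
    using assms
    by (auto simp: cone_face_iff convex_cone_convex_cone_hull convex_cone_hull_contains_0
        mem_convex_cone_hull_singleton simp flip: scaleR_add_left)
qed

text \<open>A face containing a point with positive \<open>u\<close>-coordinate contains the
  \<open>u\<close>-component of that point, hence \<open>u\<close>; likewise for \<open>v\<close>.
  So a face is determined by which of the two generators it contains.\<close>

lemma cone_face_sector:
  assumes uv: "vol u v = 1"
  shows "cone_face T (sector u v) \<longleftrightarrow> T = {0} \<or> T = ray u \<or> T = ray v \<or> T = sector u v"
proof
  assume "cone_face T (sector u v)"
  then have T: "convex_cone T" "T \<subseteq> sector u v"
      "\<And>a b. a \<in> sector u v \<Longrightarrow> b \<in> sector u v \<Longrightarrow> a + b \<in> T \<Longrightarrow> a \<in> T \<and> b \<in> T"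
    by (simp_all add: cone_face_iff convex_cone_convex_cone_hull)
  have T0: "0 \<in> T" using convex_cone_contains_0[OF T(1)] .
  have L: "u \<in> T" if x: "x \<in> T" "vol x v > 0" for x
  proof -
    let ?a = "vol x v *\<^sub>R u" and ?b = "vol u x *\<^sub>R v"
    have "x \<in> sector u v" using x T(2) by blast
    then have "?a \<in> sector u v" "?b \<in> sector u v"
      by (auto simp: mem_sector uv)
    moreover have "?a + ?b \<in> T" using unimodular_coords[OF uv, of x] x by simp
    ultimately have "?a \<in> T" using T(3) by blast
    from convex_cone_scaleR[OF T(1) _ this, of "inverse (vol x v)"]
    have "inverse (vol x v) *\<^sub>R ?a \<in> T" using x by simp
    then show "u \<in> T" using x by simp
  qed
  have R: "v \<in> T" if x: "x \<in> T" "vol u x > 0" for x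
  proof -
    let ?a = "vol x v *\<^sub>R u" and ?b = "vol u x *\<^sub>R v"
    have "x \<in> sector u v" using x T(2) by blast
    then have "?a \<in> sector u v" "?b \<in> sector u v"
      by (auto simp: mem_sector uv)
    moreover have "?a + ?b \<in> T" using unimodular_coords[OF uv, of x] x by simp
    ultimately have "?b \<in> T" using T(3) by blast
    from convex_cone_scaleR[OF T(1) _ this, of "inverse (vol u x)"]
    have "inverse (vol u x) *\<^sub>R ?b \<in> T" using x by simp
    then show "v \<in> T" using x by simp
  qed
  have pos: "0 \<le> vol x v" "0 \<le> vol u x" if "x \<in> T" for x
    using T(2) that by (auto simp: mem_sector uv)
  consider "u \<in> T" "v \<in> T" | "u \<in> T" "v \<notin> T" | "u \<notin> T" "v \<in> T" | "u \<notin> T" "v \<notin> T" by blast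
  then show "T = {0} \<or> T = ray u \<or> T = ray v \<or> T = sector u v"
  proof cases
    case 1
    then show ?thesis using T(2) sector_subset_iff[OF T(1), of u v] by blast
  next
    case 2
    then have "T \<subseteq> ray u"
      using R pos by (force simp: mem_ray_left[OF uv])
    then show ?thesis using ray_subset_iff[OF T(1), of u] 2 by blast
  next
    case 3
    then have "T \<subseteq> ray v"
      using L pos by (force simp: mem_ray_right[OF uv])
    then show ?thesis using ray_subset_iff[OF T(1), of v] 3 by blast
  next
    case 4
    have "x = 0" if "x \<in> T" for x
      by (rule vol_eqI[OF uv]) (use 4 L R pos that in force)+
    then show ?thesis using T0 by blast
  qed
next
  assume "T = {0} \<or> T = ray u \<or> T = ray v \<or> T = sector u v"
  moreover have "cone_face {0} (sector u v)"
  proof -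
    have "a = 0 \<and> b = 0" if "a \<in> sector u v" "b \<in> sector u v" "a + b = 0" for a b
    proof -
      have "vol a v + vol b v = 0" "vol u a + vol u b = 0"
        using arg_cong[OF that(3), of "\<lambda>x. vol x v"] arg_cong[OF that(3), of "vol u"] by simp_all
      then show ?thesis
        using that by (auto simp: mem_sector uv intro!: vol_eqI[OF uv])
    qed
    then show ?thesis
      by (auto simp: cone_face_iff convex_cone_convex_cone_hull convex_cone_hull_contains_0)
  qed
  moreover have "cone_face (ray u) (sector u v)"
    by (auto simp: cone_face_iff convex_cone_convex_cone_hull mem_sector uv mem_ray_left[OF uv])
  moreover have "cone_face (ray v) (sector u v)"
    by (auto simp: cone_face_iff convex_cone_convex_cone_hull mem_sector uv mem_ray_right[OF uv])
  moreover have "cone_face (sector u v) (sector u v)"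
    by (auto simp: cone_face_iff convex_cone_convex_cone_hull)
  ultimately show "cone_face T (sector u v)" by blast
qed

lemma strongly_convex_sector:
  assumes uv: "vol u v = 1" and S: "S \<subseteq> sector u v" "0 \<in> S"
  shows "strongly_convex S"
  unfolding strongly_convex_def
proof (intro equalityI subsetI)
  fix x assume "x \<in> S \<inter> uminus ` S"
  then have "x \<in> sector u v" "- x \<in> sector u v" using S by auto
  then show "x \<in> {0}"
    by (auto simp: mem_sector uv intro!: vol_eqI[OF uv])
next
  fix x assume "x \<in> {0 :: real^2}"
  then show "x \<in> S \<inter> uminus ` S" using S(2) by (auto intro!: image_eqI[of _ _ 0])
qed

lemma generator_nonzero: "vol u v = 1 \<Longrightarrow> u \<noteq> 0" "vol u v = 1 \<Longrightarrow> v \<noteq> 0"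
  by auto

text \<open>In the coordinates given by \<open>a\<close>, \<open>b\<close> the point
  \<open>x\<close> lies in the open first quadrant while \<open>c\<close> and \<open>d\<close> do
  not. As \<open>x\<close> is a positive combination of \<open>c\<close>, \<open>d\<close> and
  \<open>vol c d = 1\<close>, the vector \<open>c\<close> must lie in the closed fourth quadrant and
  \<open>d\<close> in the closed second one, so the cone between them covers the first. This is the
  main tool for comparing sectors, within a tiling and across refinements.\<close>

lemma sector_nested:
  assumes ab: "vol a b = 1" and cd: "vol c d = 1"
    and x: "x \<in> open_sector a b" "x \<in> open_sector c d"
    and n: "c \<notin> open_sector a b" "d \<notin> open_sector a b"
  shows "a \<in> sector c d" "b \<in> sector c d"
proof -
  define c1 c2 d1 d2 x1 x2 where
    d: "c1 = vol c b" "c2 = vol a c" "d1 = vol d b" "d2 = vol a d" "x1 = vol x b" "x2 = vol a x"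
  have e: "c1 * d2 - c2 * d1 = 1" "x1 * d2 - x2 * d1 = vol x d" "c1 * x2 - c2 * x1 = vol c x"
    using vol_expand[OF ab, of c d] vol_expand[OF ab, of x d] vol_expand[OF ab, of c x] cd
    by (simp_all add: d)
  define p q where "p = vol x d" and "q = vol c x"
  have pos: "p > 0" "q > 0" "x1 > 0" "x2 > 0"
    using x by (auto simp: mem_open_sector d p_def q_def)
  have "x = p *\<^sub>R c + q *\<^sub>R d" using unimodular_coords[OF cd, of x] by (simp add: p_def q_def)
  then have c: "x1 = p * c1 + q * d1" "x2 = p * c2 + q * d2" by (simp_all add: d)
  have nc: "\<not> (c1 > 0 \<and> c2 > 0)" "\<not> (d1 > 0 \<and> d2 > 0)"
    using n by (auto simp: mem_open_sector d)
  have "c1 > 0"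
  proof (rule ccontr)
    assume "\<not> c1 > 0"
    then have c1: "p * c1 \<le> 0" using pos by (simp add: mult_nonneg_nonpos)
    then have d1: "d1 > 0" using c pos by (smt (verit) zero_less_mult_iff)
    then have d2: "d2 \<le> 0" using nc by simp
    then have "x1 * d2 \<le> 0" using pos by (simp add: mult_nonneg_nonpos)
    moreover have "x2 * d1 > 0" using pos d1 by simp
    ultimately show False using e(2) pos(1) p_def by linarith
  qed
  then have c2: "c2 \<le> 0" using nc by simp
  then have "p * c2 \<le> 0" using pos by (simp add: mult_nonneg_nonpos)
  then have d2: "d2 > 0" using c pos by (smt (verit) zero_less_mult_iff)
  then have d1: "d1 \<le> 0" using nc by simp
  show "a \<in> sector c d" "b \<in> sector c d"
    using \<open>c1 > 0\<close> c2 d1 d2 vol_commute[of c a] vol_commute[of b d]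
    by (auto simp: mem_sector cd d)
qed

text \<open>The two inclusions make \<open>vol c u\<close> and \<open>vol v d\<close> vanish, so the
  passage from \<open>c\<close>, \<open>d\<close> to \<open>u\<close>, \<open>v\<close> is diagonal
  with nonnegative integral entries and determinant 1. Real multiples such as
  \<open>2 *\<^sub>R c\<close> and \<open>(1/2) *\<^sub>R d\<close> are excluded by
  integrality.\<close>

lemma sector_antisym:
  assumes uv: "vol u v = 1" "u \<in> N" "v \<in> N" and cd: "vol c d = 1" "c \<in> N" "d \<in> N"
    and 1: "u \<in> sector c d" "v \<in> sector c d" and 2: "c \<in> sector u v" "d \<in> sector u v"
  shows "u = c" "v = d"
proof -
  have z: "vol c u = 0" "vol v d = 0"
    using 1 2 vol_commute[of u c] vol_commute[of v d] by (auto simp: mem_sector uv cd)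
  obtain p s :: int where ps: "vol u d = of_int p" "vol c v = of_int s"
    using vol_int uv cd by metis
  have "vol u d * vol c v = 1"
    using vol_expand[OF cd(1), of u v] uv z by simp
  then have "p * s = 1" using ps by (metis of_int_eq_iff of_int_mult of_int_1)
  moreover have "0 \<le> p" using 1 ps by (auto simp: mem_sector cd)
  ultimately have "p = 1" "s = 1" by (auto simp: zmult_eq_1_iff)
  then show "u = c" "v = d"
    using z ps cd by (auto intro!: vol_eqI[OF cd(1)])
qed

text \<open>The complements \<open>g'\<close> and \<open>h'\<close> certify that \<open>g\<close>
  and \<open>h\<close> are primitive: pairing with them shows that the scaling factor and its
  inverse are both integers.\<close>

lemma ray_unique:
  assumes "g \<in> N" "h \<in> N" "g' \<in> N" "h' \<in> N" "\<bar>vol g g'\<bar> = 1" "\<bar>vol h h'\<bar> = 1" "g \<in> ray h"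
  shows "g = h"
proof -
  obtain t where t: "t \<ge> 0" "g = t *\<^sub>R h"
    using assms(7) by (auto simp: mem_convex_cone_hull_singleton)
  obtain k l m n :: int where k: "vol g h' = of_int k" "vol h h' = of_int l"
      "vol g g' = of_int m" "vol h g' = of_int n"
    using vol_int assms by metis
  have l: "\<bar>l\<bar> = 1" "\<bar>m\<bar> = 1"
    using assms(5,6) k by (metis of_int_abs of_int_eq_iff of_int_1)+
  have "vol g h' = t * vol h h'" "vol g g' = t * vol h g'" using t by simp_all
  then have "of_int k = t * of_int l" "of_int m = t * of_int n" using k by metis+
  then have "of_int (k * n) = (of_int (m * l) :: real)"
    by simp
  then have "k * n = m * l" by (metis of_int_eq_iff)
  then have "\<bar>k\<bar> * \<bar>n\<bar> = 1" using l by (metis abs_mult mult_1)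
  then have "\<bar>k\<bar> = 1" by (auto simp: zmult_eq_1_iff)
  then have "t = 1"
    using \<open>of_int k = t * of_int l\<close> l t(1)
    by (auto simp: abs_if split: if_splits)
  then show ?thesis using t by simp
qed

section \<open>Smooth complete fans as unimodular tilings\<close>

text \<open>The set of pairs of consecutive generators, that is, the graph of the successor in the
  orientation of \<open>vol\<close>. Equality of the two projections says that every generator has a
  sector on either side. Disjointness of the open sectors is a consequence of the clause that no
  generator lies in any of them.\<close>

definition tiling :: "((real^2) \<times> (real^2)) set \<Rightarrow> bool" where
  "tiling P \<longleftrightarrow> finite P \<and> (\<forall>(u, v)\<in>P. u \<in> N \<and> v \<in> N \<and> vol u v = 1) \<and> fst ` P = snd ` P \<and>
     (\<forall>g\<in>fst ` P. \<forall>(u, v)\<in>P. g \<notin> open_sector u v) \<and>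
     (\<forall>x. x \<noteq> 0 \<longrightarrow> (\<exists>g\<in>fst ` P. x \<in> ray g) \<or> (\<exists>(u, v)\<in>P. x \<in> open_sector u v))"

definition fan_of :: "((real^2) \<times> (real^2)) set \<Rightarrow> fan" where
  "fan_of P = insert {0} (ray ` fst ` P \<union> (\<lambda>(u, v). sector u v) ` P)"

definition pairs_of :: "fan \<Rightarrow> ((real^2) \<times> (real^2)) set" where
  "pairs_of \<Sigma> = {(u, v). u \<in> N \<and> v \<in> N \<and> vol u v = 1 \<and> sector u v \<in> \<Sigma>}"

lemma tilingD:
  assumes "tiling P"
  shows "finite P" "fst ` P = snd ` P"
    and "(u, v) \<in> P \<Longrightarrow> u \<in> N" "(u, v) \<in> P \<Longrightarrow> v \<in> N" "(u, v) \<in> P \<Longrightarrow> vol u v = 1"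
    and "g \<in> fst ` P \<Longrightarrow> (u, v) \<in> P \<Longrightarrow> g \<notin> open_sector u v"
    and "(u, v) \<in> P \<Longrightarrow> u \<in> fst ` P" "(u, v) \<in> P \<Longrightarrow> v \<in> fst ` P"
proof -
  show e: "fst ` P = snd ` P"
    using assms unfolding tiling_def by blast
  show "(u, v) \<in> P \<Longrightarrow> u \<in> fst ` P" by (force intro: rev_image_eqI)
  show "(u, v) \<in> P \<Longrightarrow> v \<in> fst ` P" unfolding e by (force intro: rev_image_eqI)
  have p: "\<forall>(u, v)\<in>P. u \<in> N \<and> v \<in> N \<and> vol u v = 1"
    and g: "\<forall>g\<in>fst ` P. \<forall>(u, v)\<in>P. g \<notin> open_sector u v"
    using assms unfolding tiling_def by blast+
  show "(u, v) \<in> P \<Longrightarrow> u \<in> N" "(u, v) \<in> P \<Longrightarrow> v \<in> N" "(u, v) \<in> P \<Longrightarrow> vol u v = 1"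
    using p by auto
  show "g \<in> fst ` P \<Longrightarrow> (u, v) \<in> P \<Longrightarrow> g \<notin> open_sector u v"
    using g by (metis (no_types, lifting) case_prodD)
  show "finite P" using assms unfolding tiling_def by blast
qed

lemma tiling_cases:
  assumes "tiling P" "x \<noteq> 0"
  obtains (ray) g where "g \<in> fst ` P" "x \<in> ray g"
    | (sector) u v where "(u, v) \<in> P" "x \<in> open_sector u v"
proof -
  have "(\<exists>g\<in>fst ` P. x \<in> ray g) \<or> (\<exists>(u, v)\<in>P. x \<in> open_sector u v)"
    using assms unfolding tiling_def by blast
  then show thesis using ray sector by (metis case_prodE)
qed

lemma tiling_nextE:
  assumes "tiling P" "g \<in> fst ` P"
  obtains v where "(g, v) \<in> P"
  using assms by auto

lemma tiling_prevE:
  assumes "tiling P" "g \<in> fst ` P"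
  obtains u where "(u, g) \<in> P"
proof -
  have "g \<in> snd ` P" using assms unfolding tiling_def by blast
  then show thesis using that by auto
qed

lemma tiling_ray_unique:
  assumes P: "tiling P" and "g \<in> fst ` P" "h \<in> fst ` P" "g \<in> ray h"
  shows "g = h"
proof -
  obtain g' h' where g: "(g, g') \<in> P" and h: "(h, h') \<in> P" using assms by auto
  note D = tilingD(3-5)[OF P]
  show ?thesis
    by (rule ray_unique[of g h g' h']) (use D[OF g] D[OF h] assms in auto)
qed

text \<open>By \<open>sector_nested\<close>, used in both directions, each sector contains the
  generators of the other.\<close>

lemma tiling_sector_unique:
  assumes P: "tiling P" and uv: "(u, v) \<in> P" "(c, d) \<in> P"
    and x: "x \<in> open_sector u v" "x \<in> open_sector c d"
  shows "u = c" "v = d"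
proof -
  note D = tilingD[OF P]
  have n: "c \<notin> open_sector u v" "d \<notin> open_sector u v" "u \<notin> open_sector c d" "v \<notin> open_sector c d"
    using D(6-8) uv by blast+
  have 1: "vol u v = 1" "u \<in> N" "v \<in> N" "vol c d = 1" "c \<in> N" "d \<in> N" using D(3-5) uv by blast+
  have 2: "u \<in> sector c d" "v \<in> sector c d"
    by (rule sector_nested[of u v c d x]; use 1 n x in simp)+
  have 3: "c \<in> sector u v" "d \<in> sector u v"
    by (rule sector_nested[of c d u v x]; use 1 n x in simp)+
  show "u = c" "v = d" using sector_antisym[OF 1 2 3] by blast+
qed

text \<open>Two successors of \<open>u\<close> have the same determinant with \<open>u\<close>; if
  they differed, one would lie strictly inside the sector ending at the other.\<close>

lemma tiling_next_unique:
  assumes P: "tiling P" and uv: "(u, v) \<in> P" "(u, w) \<in> P"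
  shows "v = w"
proof -
  note D = tilingD[OF P]
  have "vol u v = 1" "vol u w = 1" using D(5) uv by blast+
  moreover have "w \<notin> open_sector u v" "v \<notin> open_sector u w" using D(6-8) uv by blast+
  ultimately have "vol w v = 0"
    using vol_commute[of v w] by (auto simp: mem_open_sector)
  then show ?thesis
    using \<open>vol u v = 1\<close> \<open>vol u w = 1\<close> by (auto intro!: vol_eqI[of u v])
qed

lemma tiling_prev_unique:
  assumes P: "tiling P" and uv: "(u, v) \<in> P" "(w, v) \<in> P"
  shows "u = w"
proof -
  note D = tilingD[OF P]
  have "vol u v = 1" "vol w v = 1" using D(5) uv by blast+
  moreover have "w \<notin> open_sector u v" "u \<notin> open_sector w v" using D(6-8) uv by blast+
  ultimately have "vol u w = 0"
    using vol_commute[of u w] by (auto simp: mem_open_sector)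
  then show ?thesis
    using \<open>vol u v = 1\<close> \<open>vol w v = 1\<close> by (auto intro!: vol_eqI[of u v])
qed

lemma ray_mem_iff:
  assumes "x \<in> ray g" "x \<noteq> 0" "convex_cone S"
  shows "x \<in> S \<longleftrightarrow> g \<in> S"
proof -
  obtain t where t: "t > 0" "x = t *\<^sub>R g"
    using assms by (metis mem_convex_cone_hull_singleton order_le_less scaleR_zero_left)
  then have "g = inverse t *\<^sub>R x" by simp
  then show ?thesis using t assms(3) convex_cone_scaleR
    by (metis inverse_nonnegative_iff_nonnegative less_imp_le)
qed

lemma ray_mem_open_sector_iff:
  assumes "x \<in> ray g" "x \<noteq> 0"
  shows "x \<in> open_sector u v \<longleftrightarrow> g \<in> open_sector u v"
proof -
  obtain t where t: "t > 0" "x = t *\<^sub>R g"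
    using assms by (metis mem_convex_cone_hull_singleton order_le_less scaleR_zero_left)
  then show ?thesis by (simp add: mem_open_sector zero_less_mult_iff)
qed

lemma fan_of_cases:
  assumes "tiling P" "\<sigma> \<in> fan_of P"
  obtains (zero) "\<sigma> = {0}" | (ray) g where "g \<in> fst ` P" "\<sigma> = ray g"
    | (sector) u v where "(u, v) \<in> P" "\<sigma> = sector u v"
  using assms unfolding fan_of_def by auto

lemma convex_cone_fan_of: "tiling P \<Longrightarrow> \<sigma> \<in> fan_of P \<Longrightarrow> convex_cone \<sigma>"
  by (erule fan_of_cases) (auto simp: convex_cone_convex_cone_hull)

lemma tiling_generator: "tiling P \<Longrightarrow> g \<in> fst ` P \<Longrightarrow> g \<in> N \<and> g \<noteq> 0"
  using tilingD(3,5) generator_nonzero(1) by fastforce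

text \<open>If \<open>\<sigma>\<close> is a sector and the other cone differs from it, the other
  cone cannot meet the open sector, so the intersection lies in the two boundary rays. It cannot
  contain both generators, because their sum would be interior; hence it is one of the two rays or
  zero.\<close>

lemma fan_of_inter_face:
  assumes P: "tiling P" and s: "\<sigma> \<in> fan_of P" "\<sigma>' \<in> fan_of P"
  shows "cone_face (\<sigma> \<inter> \<sigma>') \<sigma>"
proof -
  note D = tilingD[OF P]
  have cc: "convex_cone \<sigma>" "convex_cone \<sigma>'" using convex_cone_fan_of[OF P] s by auto
  have z: "0 \<in> \<sigma>" "0 \<in> \<sigma>'" using cc convex_cone_contains_0 by auto
  have cT: "convex_cone (\<sigma> \<inter> \<sigma>')"
    using cc by (simp add: convex_cone_iff)
  show ?thesis
    using P s(1)
  proof (cases rule: fan_of_cases)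
    case zero
    then show ?thesis using z by (auto simp: cone_face_zero)
  next
    case (ray g)
    have "g \<noteq> 0" using tiling_generator[OF P ray(1)] by simp
    have "\<sigma> \<inter> \<sigma>' = ray g \<or> \<sigma> \<inter> \<sigma>' = {0}"
    proof (cases "g \<in> \<sigma>'")
      case True
      then show ?thesis using ray cc ray_subset_iff by blast
    next
      case False
      then show ?thesis using ray_mem_iff[OF _ _ cc(2)] ray z by blast
    qed
    then show ?thesis using cone_face_ray[OF \<open>g \<noteq> 0\<close>] ray by auto
  next
    case (sector u v)
    have uv: "vol u v = 1" using D(5) sector by blast
    have out: "g \<notin> open_sector u v" if "g \<in> fst ` P" for g using D(6) sector that by blast
    show ?thesis
    proof (cases "\<sigma> = \<sigma>'")
      case True
      then have "\<sigma> \<inter> \<sigma>' = sector u v" using sector by simp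
      then show ?thesis unfolding sector(2) cone_face_sector[OF uv] by blast
    next
      case False
      have no: "x \<notin> open_sector u v" if x: "x \<in> \<sigma>'" for x
      proof
        assume xo: "x \<in> open_sector u v"
        then have x0: "x \<noteq> 0" by (auto simp: mem_open_sector)
        show False
          using P s(2)
        proof (cases rule: fan_of_cases)
          case zero
          then show ?thesis using x x0 by simp
        next
          case (ray g)
          then show ?thesis using ray_mem_open_sector_iff[of x g u v] xo x0 x out by blast
        next
          case (sector c d)
          then have cd: "vol c d = 1" using D(5) by blast
          have "x \<notin> open_sector c d"
            using tiling_sector_unique[OF P \<open>(u, v) \<in> P\<close> sector(1) xo] False \<open>\<sigma> = sector u v\<close> sector
            by blast
          then have "x \<in> ray c \<or> x \<in> ray d" using sector_eq_union[OF cd] sector x by blast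
          then show ?thesis
            using ray_mem_open_sector_iff[of x _ u v] xo x0 out D(7,8)[OF sector(1)] by blast
        qed
      qed
      let ?T = "\<sigma> \<inter> \<sigma>'"
      have T: "x \<in> ray u \<or> x \<in> ray v" if "x \<in> ?T" for x
        using that no sector sector_eq_union[OF uv] by blast
      have "u + v \<in> open_sector u v" using uv by (simp add: mem_open_sector)
      then have nb: "\<not> (u \<in> ?T \<and> v \<in> ?T)"
        using no convex_cone_add[OF cT] by blast
      have "?T = ray u \<or> ?T = ray v \<or> ?T = {0}"
      proof -
        have T': "x = 0 \<or> (x \<in> ray u \<and> u \<in> ?T) \<or> (x \<in> ray v \<and> v \<in> ?T)" if "x \<in> ?T" for x
          using T[OF that] ray_mem_iff[OF _ _ cT, of x] that by blast
        consider "u \<in> ?T" "v \<notin> ?T" | "v \<in> ?T" "u \<notin> ?T" | "u \<notin> ?T" "v \<notin> ?T" using nb by blast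
        then show ?thesis
        proof cases
          case 1
          then have "ray u \<subseteq> ?T" by (simp only: ray_subset_iff[OF cT])
          moreover have "?T \<subseteq> ray u" using T' 1 convex_cone_hull_contains_0 by blast
          ultimately show ?thesis by blast
        next
          case 2
          then have "ray v \<subseteq> ?T" by (simp only: ray_subset_iff[OF cT])
          moreover have "?T \<subseteq> ray v" using T' 2 convex_cone_hull_contains_0 by blast
          ultimately show ?thesis by blast
        next
          case 3
          then show ?thesis using T' z by blast
        qed
      qed
      then show ?thesis unfolding sector(2) cone_face_sector[OF uv] by blast
    qed
  qed
qed

lemma smooth_fan_fan_of:
  assumes P: "tiling P"
  shows "smooth_fan N (fan_of P)"
proof -
  note D = tilingD[OF P]
  have fin: "finite (fan_of P)" using D(1) by (simp add: fan_of_def)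
  have cone: "rational_cone N \<sigma> \<and> strongly_convex \<sigma> \<and> smooth_cone N \<sigma>" if s: "\<sigma> \<in> fan_of P" for \<sigma>
    using P s
  proof (cases rule: fan_of_cases)
    case zero
    have "rational_cone N {0}"
      unfolding rational_cone_def by (rule exI[of _ "{}"]) simp
    moreover have "smooth_cone N {0}"
      unfolding smooth_cone_def using basis by (metis convex_cone_hull_empty empty_subsetI)
    ultimately show ?thesis using zero by (auto simp: strongly_convex_def)
  next
    case (ray g)
    obtain v where v: "(g, v) \<in> P" using ray by auto
    have "rational_cone N \<sigma>"
      unfolding rational_cone_def using ray tiling_generator[OF P] by (intro exI[of _ "{g}"]) auto
    moreover have "strongly_convex \<sigma>"
      using ray D(5)[OF v] convex_cone_hull_contains_0
      by (intro strongly_convex_sector[of g v]) (auto intro: hull_mono[THEN subsetD, rotated])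
    moreover have "lattice_basis N g v" using D(3-5)[OF v] by (auto simp: lattice_basis_iff)
    then have "smooth_cone N \<sigma>"
      unfolding smooth_cone_def using ray by (metis insert_subset empty_subsetI insertI1)
    ultimately show ?thesis by blast
  next
    case (sector u v)
    have "rational_cone N \<sigma>"
      unfolding rational_cone_def using sector D(3,4) by (intro exI[of _ "{u, v}"]) auto
    moreover have "strongly_convex \<sigma>"
      using sector D(5) convex_cone_hull_contains_0 by (intro strongly_convex_sector[of u v]) auto
    moreover have "lattice_basis N u v" using D(3-5) sector by (auto simp: lattice_basis_iff)
    then have "smooth_cone N \<sigma>"
      unfolding smooth_cone_def using sector by blast
    ultimately show ?thesis by blast
  qed
  have faces: "\<tau> \<in> fan_of P" if s: "\<sigma> \<in> fan_of P" and t: "cone_face \<tau> \<sigma>" for \<sigma> \<tau>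
    using P s
  proof (cases rule: fan_of_cases)
    case zero
    then show ?thesis using t by (simp add: cone_face_zero fan_of_def)
  next
    case (ray g)
    then show ?thesis using t tiling_generator[OF P] by (auto simp: cone_face_ray fan_of_def)
  next
    case (sector u v)
    then show ?thesis using t D(5)[OF sector(1)] D(7)[OF sector(1)] D(8)[OF sector(1)]
      by (auto simp: cone_face_sector fan_of_def)
  qed
  have "cone_face (\<sigma> \<inter> \<sigma>') \<sigma> \<and> cone_face (\<sigma> \<inter> \<sigma>') \<sigma>'"
    if "\<sigma> \<in> fan_of P" "\<sigma>' \<in> fan_of P" for \<sigma> \<sigma>'
    using fan_of_inter_face[OF P that] fan_of_inter_face[OF P that(2,1)] by (simp add: Int_commute)
  then show ?thesis
    unfolding smooth_fan_def is_fan_def using fin cone faces by (auto simp: fan_of_def)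
qed

lemma complete_fan_fan_of:
  assumes P: "tiling P"
  shows "complete_fan (fan_of P)"
proof -
  note D = tilingD[OF P]
  have "x \<in> \<Union> (fan_of P)" for x
  proof (cases "x = 0")
    case True
    then show ?thesis by (auto simp: fan_of_def)
  next
    case False
    from P False show ?thesis
    proof (cases rule: tiling_cases)
      case (ray g)
      then show ?thesis by (auto simp: fan_of_def)
    next
      case (sector u v)
      then have "x \<in> sector u v" using open_sector_subset D(5) by blast
      then show ?thesis using sector by (auto simp: fan_of_def)
    qed
  qed
  then show ?thesis by (auto simp: complete_fan_def)
qed

lemma pairs_of_fan_of:
  assumes P: "tiling P"
  shows "pairs_of (fan_of P) = P"
proof (intro equalityI subsetI)
  fix z assume "z \<in> P"
  then show "z \<in> pairs_of (fan_of P)"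
    using tilingD(3-5)[OF P] by (cases z) (auto simp: pairs_of_def fan_of_def)
next
  fix z assume "z \<in> pairs_of (fan_of P)"
  then obtain u v where z: "z = (u, v)" "u \<in> N" "v \<in> N" "vol u v = 1" "sector u v \<in> fan_of P"
    by (auto simp: pairs_of_def)
  from P z(5) show "z \<in> P"
  proof (cases rule: fan_of_cases)
    case zero
    then show ?thesis using z mem_self_sector[of u v] by auto
  next
    case (ray g)
    have "u \<in> ray g" "v \<in> ray g"
      using mem_self_sector(1)[of u v] mem_self_sector(2)[of v u] unfolding ray(2) by this+
    then show ?thesis using z(4) by (auto simp: mem_convex_cone_hull_singleton)
  next
    case (sector c d)
    have 1: "u \<in> sector c d" "v \<in> sector c d"
      using mem_self_sector(1)[of u v] mem_self_sector(2)[of v u] unfolding sector(2) by this+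
    have 2: "c \<in> sector u v" "d \<in> sector u v"
      unfolding sector(2) by (rule mem_self_sector)+
    have "u = c" "v = d"
      using sector_antisym[OF z(4,2,3) _ _ _ 1 2] tilingD(3-5)[OF P sector(1)] by blast+
    then show ?thesis using z sector by simp
  qed
qed

lemma rays_fan_of:
  assumes P: "tiling P"
  shows "rays (fan_of P) = ray ` fst ` P"
proof -
  have 1: "dim (ray g) = 1" if "g \<in> fst ` P" for g
    using tiling_generator[OF P that] by (simp add: dim_convex_cone_hull dim_singleton)
  have 2: "dim (sector u v) = 2" if "(u, v) \<in> P" for u v
  proof -
    have uv: "vol u v = 1" using tilingD(5)[OF P that] .
    then have "u \<notin> span {v}" by (auto simp: span_singleton)
    moreover have "v \<noteq> 0" using uv by auto
    ultimately show ?thesis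
      by (simp add: dim_convex_cone_hull dim_insert dim_singleton)
  qed
  show ?thesis
  proof (intro equalityI subsetI)
    fix \<tau> assume t: "\<tau> \<in> rays (fan_of P)"
    then have "\<tau> \<in> fan_of P" by (simp add: rays_def)
    with P show "\<tau> \<in> ray ` fst ` P"
      by (cases rule: fan_of_cases) (use t 2 in \<open>auto simp: rays_def\<close>)
  next
    fix \<tau> assume "\<tau> \<in> ray ` fst ` P"
    then show "\<tau> \<in> rays (fan_of P)" using 1 by (auto simp: rays_def fan_of_def)
  qed
qed

end

section \<open>From smooth complete fans to tilings\<close>

lemma nonneg_of_infinitely_many:
  fixes a b :: real
  assumes A: "infinite (A :: nat set)" and nn: "\<And>n. n \<in> A \<Longrightarrow> 0 \<le> a + b / (real n + 1)"
  shows "0 \<le> a"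
proof (rule ccontr)
  assume "\<not> 0 \<le> a"
  then have a: "a < 0" by simp
  obtain k :: nat where k: "b / (- a) < real k" using reals_Archimedean2 by blast
  obtain n where n: "n \<in> A" "n > k" using A by (meson infinite_nat_iff_unbounded)
  have "b < (- a) * real k" using k a by (simp add: divide_simps mult.commute)
  also have "\<dots> \<le> (- a) * (real n + 1)" using n a by (intro mult_left_mono) auto
  finally have "b / (real n + 1) < - a" by (simp add: divide_simps)
  then show False using nn[OF n(1)] by simp
qed

context planar_lattice
begin

lemma lattice_minus: "x \<in> N \<Longrightarrow> - x \<in> N"
  using lattice_scale_int[of x "-1"] by simp

lemma smooth_cone_cases:
  assumes "smooth_cone N \<sigma>"
  obtains (zero) "\<sigma> = {0}"
    | (ray) u v where "u \<in> N" "v \<in> N" "vol u v = 1" "\<sigma> = ray u"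
    | (sector) u v where "u \<in> N" "v \<in> N" "vol u v = 1" "\<sigma> = sector u v"
proof -
  have oriented: "\<exists>v\<in>N. vol e v = 1" if "lattice_basis N e f \<or> lattice_basis N f e" for e f
  proof -
    have "f \<in> N" "vol e f = 1 \<or> vol e f = -1"
      using that vol_commute[of e f] by (auto simp: lattice_basis_iff)
    then show ?thesis using lattice_minus[of f] by force
  qed
  obtain e1 e2 S where e: "lattice_basis N e1 e2" and S: "S \<subseteq> {e1, e2}" "\<sigma> = convex_cone hull S"
    using assms unfolding smooth_cone_def by blast
  then have N: "e1 \<in> N" "e2 \<in> N" by (auto simp: lattice_basis_iff)
  consider "S = {}" | "S = {e1}" | "S = {e2}" | "S = {e1, e2}" using S(1) by blast
  then show thesis
  proof cases
    case 1
    then show ?thesis using S zero by simp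
  next
    case 2
    then show ?thesis using S ray[of e1] oriented e N by metis
  next
    case 3
    then show ?thesis using S ray[of e2] oriented e N by metis
  next
    case 4
    have "vol e1 e2 = 1 \<or> vol e2 e1 = 1"
      using e vol_commute[of e1 e2] by (auto simp: lattice_basis_iff)
    moreover have "sector e1 e2 = sector e2 e1" by (simp add: insert_commute)
    ultimately show ?thesis using S 4 sector N by metis
  qed
qed

lemma is_fanD:
  assumes "smooth_fan N \<Sigma>"
  shows "finite \<Sigma>" "\<Sigma> \<noteq> {}" "\<sigma> \<in> \<Sigma> \<Longrightarrow> smooth_cone N \<sigma>"
    and "\<sigma> \<in> \<Sigma> \<Longrightarrow> cone_face \<tau> \<sigma> \<Longrightarrow> \<tau> \<in> \<Sigma>"
    and "\<sigma> \<in> \<Sigma> \<Longrightarrow> \<sigma>' \<in> \<Sigma> \<Longrightarrow> cone_face (\<sigma> \<inter> \<sigma>') \<sigma>"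
  using assms unfolding smooth_fan_def is_fan_def by blast+

lemma ray_face_of_sector:
  assumes cd: "vol c d = 1" "c \<in> N" "d \<in> N" and g: "g \<in> N" "g' \<in> N" "\<bar>vol g g'\<bar> = 1"
    and face: "cone_face (ray g) (sector c d)"
  shows "g = c \<or> g = d"
proof -
  have g0: "g \<noteq> 0" using g by auto
  have "ray g \<noteq> {0}" using mem_self_ray[of g] g0 by auto
  moreover have "ray g \<noteq> sector c d"
  proof
    assume eq: "ray g = sector c d"
    have "c \<in> ray g" "d \<in> ray g"
      unfolding eq by (rule mem_self_sector)+
    then show False using cd by (auto simp: mem_convex_cone_hull_singleton)
  qed
  ultimately have "ray g = ray c \<or> ray g = ray d"
    using face cone_face_sector[OF cd(1)] by blast
  then have "g \<in> ray c \<or> g \<in> ray d" using mem_self_ray[of g] by blast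
  then show ?thesis
    using ray_unique[of g c g' d] ray_unique[of g d g' c] cd g vol_commute[of c d] by auto
qed

text \<open>Points close to \<open>u\<close> on the side of \<open>w\<close> lie in finitely many cones, so that one cone
  contains a sequence of such points converging to \<open>u\<close>.\<close>

lemma neighbour_sector:
  assumes fan: "smooth_fan N \<Sigma>" "complete_fan \<Sigma>"
    and u: "ray u \<in> \<Sigma>" "u \<in> N" "u' \<in> N" "vol u u' = 1" and w: "vol u w \<noteq> 0"
  obtains e where "e \<in> N" "\<bar>vol u e\<bar> = 1" "sector u e \<in> \<Sigma>" "0 < vol u e * vol u w"
proof -
  note F = is_fanD[OF fan(1)]
  define x where "x n = u + (1 / (real n + 1)) *\<^sub>R w" for n
  have "\<exists>\<sigma>\<in>\<Sigma>. x n \<in> \<sigma>" for n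
    using fan(2) unfolding complete_fan_def by blast
  then obtain f where f: "\<And>n. f n \<in> \<Sigma>" "\<And>n. x n \<in> f n" by metis
  have "finite (range f)" using f(1) F(1) by (metis finite_subset image_subsetI)
  then obtain m where "infinite {n. f n = f m}"
    using pigeonhole_infinite[of UNIV f] by auto
  define \<sigma> A where "\<sigma> = f m" and "A = {n. f n = f m}"
  have A: "infinite A" "\<And>n. n \<in> A \<Longrightarrow> x n \<in> \<sigma>"
    using \<open>infinite _\<close> f(2) by (auto simp: A_def \<sigma>_def)
  have \<sigma>: "\<sigma> \<in> \<Sigma>" using f by (simp add: \<sigma>_def)
  obtain n1 where n1: "n1 \<in> A" using A(1) by (metis finite.emptyI ex_in_conv)
  obtain n2 where n2: "n2 \<in> A" "n1 < n2"
    using A(1) by (meson infinite_nat_iff_unbounded)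
  have ux: "vol u (x n) = vol u w / (real n + 1)" for n by (simp add: x_def)
  \<comment> \<open>Two points of the sequence are linearly independent, so their common cone cannot
    be \<open>{0}\<close> or a ray.\<close>
  have xx: "vol (x n1) (x n2) \<noteq> 0"
  proof -
    have "vol (x n1) (x n2) = (1 / (real n2 + 1) - 1 / (real n1 + 1)) * vol u w"
      using vol_commute[of w u] by (simp add: x_def algebra_simps)
    moreover have "1 / (real n2 + 1) \<noteq> 1 / (real n1 + 1)" using n2 by simp
    ultimately show ?thesis using w by simp
  qed
  from F(3)[OF \<sigma>] show thesis
  proof (cases rule: smooth_cone_cases)
    case zero
    then show ?thesis using A(2)[OF n1] xx by simp
  next
    case (ray c d)
    then show ?thesis
      using A(2)[OF n1] A(2)[OF n2(1)] xx by (auto simp: mem_convex_cone_hull_singleton)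
  next
    case (sector c d)
    have x: "0 \<le> vol u d + vol w d / (real n + 1)" "0 \<le> vol c u + vol c w / (real n + 1)" if "n \<in> A" for n
      using A(2)[OF that] unfolding sector(4) mem_sector[OF sector(3)] by (simp_all add: x_def)
    \<comment> \<open>The limit of the points still satisfies the closed inequalities of the cone,
      so \<open>u\<close> itself lies in it.\<close>
    have "0 \<le> vol u d" by (rule nonneg_of_infinitely_many[OF A(1)]) (rule x)
    moreover have "0 \<le> vol c u" by (rule nonneg_of_infinitely_many[OF A(1)]) (rule x)
    ultimately have "u \<in> sector c d" by (simp add: mem_sector[OF sector(3)])
    then have "ray u \<subseteq> sector c d"
      using ray_subset_iff convex_cone_convex_cone_hull by blast
    \<comment> \<open>Both cones belong to the fan, so their intersection is a face; hence
      \<open>u\<close> is one of the two generators.\<close>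
    then have "sector c d \<inter> ray u = ray u" by blast
    moreover have "sector c d \<in> \<Sigma>" using \<sigma> sector by simp
    ultimately have "cone_face (ray u) (sector c d)" using F(5)[of "sector c d" "ray u"] u(1) by simp
    then have "u = c \<or> u = d"
      using ray_face_of_sector sector u by (metis abs_one)
    then show ?thesis
    proof
      assume uc: "u = c"
      have "0 \<le> vol u w"
        using x(2)[OF n1] unfolding uc[symmetric] by (simp add: zero_le_divide_iff)
      then show ?thesis using that[of d] sector \<open>sector c d \<in> \<Sigma>\<close> uc w by simp
    next
      assume ud: "u = d"
      have "0 \<le> vol w u"
        using x(1)[OF n1] unfolding ud[symmetric] by (simp add: zero_le_divide_iff)
      moreover have "vol u c = -1" using sector(3) ud vol_commute[of u c] by simp
      moreover have "sector u c \<in> \<Sigma>" using \<open>sector c d \<in> \<Sigma>\<close> ud by (simp add: insert_commute)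
      ultimately show ?thesis using that[of c] sector w vol_commute[of w u] by simp
    qed
  qed
qed

lemma mem_pairs_of:
  "(u, v) \<in> pairs_of \<Sigma> \<longleftrightarrow> u \<in> N \<and> v \<in> N \<and> vol u v = 1 \<and> sector u v \<in> \<Sigma>"
  by (simp add: pairs_of_def)

lemma ray_neighbours:
  assumes fan: "smooth_fan N \<Sigma>" "complete_fan \<Sigma>"
    and u: "ray u \<in> \<Sigma>" "u \<in> N" "u' \<in> N" "vol u u' = 1"
  shows "\<exists>v. (u, v) \<in> pairs_of \<Sigma>" "\<exists>v. (v, u) \<in> pairs_of \<Sigma>"
proof -
  obtain e where e: "e \<in> N" "\<bar>vol u e\<bar> = 1" "sector u e \<in> \<Sigma>" "0 < vol u e * vol u u'"
    using neighbour_sector[OF assms, of u'] u(4) by auto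
  then have "vol u e = 1" using u(4) by auto
  then show "\<exists>v. (u, v) \<in> pairs_of \<Sigma>" using e u by (auto simp: mem_pairs_of)
  obtain e where e: "e \<in> N" "\<bar>vol u e\<bar> = 1" "sector u e \<in> \<Sigma>" "0 < vol u e * vol u (- u')"
    using neighbour_sector[OF assms, of "- u'"] u(4) by auto
  then have "vol e u = 1" using u(4) vol_commute[of u e] by auto
  then show "\<exists>v. (v, u) \<in> pairs_of \<Sigma>" using e u by (auto simp: mem_pairs_of insert_commute)
qed

lemma sector_inject:
  assumes "vol u v = 1" "u \<in> N" "v \<in> N" "vol c d = 1" "c \<in> N" "d \<in> N" "sector u v = sector c d"
  shows "u = c \<and> v = d"
proof -
  have 1: "u \<in> sector c d" "v \<in> sector c d"
    unfolding assms(7)[symmetric] by (rule mem_self_sector)+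
  have 2: "c \<in> sector u v" "d \<in> sector u v"
    unfolding assms(7) by (rule mem_self_sector)+
  show ?thesis using sector_antisym[OF assms(1-6) 1 2] by blast
qed

lemma pairs_of_rays:
  assumes fan: "smooth_fan N \<Sigma>" "complete_fan \<Sigma>" and uv: "(u, v) \<in> pairs_of \<Sigma>"
  shows "ray u \<in> \<Sigma>" "ray v \<in> \<Sigma>" "\<exists>w. (w, u) \<in> pairs_of \<Sigma>" "\<exists>w. (v, w) \<in> pairs_of \<Sigma>"
proof -
  have p: "u \<in> N" "v \<in> N" "vol u v = 1" "sector u v \<in> \<Sigma>"
    using uv by (simp_all add: mem_pairs_of)
  have f: "cone_face (ray u) (sector u v)" "cone_face (ray v) (sector u v)"
    using cone_face_sector[OF p(3)] by blast+
  show r: "ray u \<in> \<Sigma>" "ray v \<in> \<Sigma>" using is_fanD(4)[OF fan(1)] f p(4) by blast+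
  show "\<exists>w. (w, u) \<in> pairs_of \<Sigma>" using ray_neighbours(2)[OF fan r(1) p(1-3)] .
  show "\<exists>w. (v, w) \<in> pairs_of \<Sigma>"
    using ray_neighbours(1)[OF fan r(2), of "- u"] p lattice_minus[of u] vol_commute[of u v] by simp
qed

text \<open>Completeness enters twice: in the covering clause, and in the equality of the
  projections, where every boundary ray of a sector needs a sector on its other side.\<close>

lemma tiling_pairs_of:
  assumes fan: "smooth_fan N \<Sigma>" "complete_fan \<Sigma>"
  shows "tiling (pairs_of \<Sigma>)"
  unfolding tiling_def
proof (intro conjI)
  note F = is_fanD[OF fan(1)]
  let ?P = "pairs_of \<Sigma>"
  have "inj_on (\<lambda>(u, v). sector u v) ?P"
    using sector_inject by (auto simp: inj_on_def mem_pairs_of)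
  moreover have "(\<lambda>(u, v). sector u v) ` ?P \<subseteq> \<Sigma>" by (auto simp: mem_pairs_of)
  ultimately show "finite ?P" using F(1) by (metis inj_on_finite)
  show "\<forall>(u, v)\<in>?P. u \<in> N \<and> v \<in> N \<and> vol u v = 1" by (auto simp: mem_pairs_of)
  show "fst ` ?P = snd ` ?P"
    using pairs_of_rays(3,4)[OF fan] by (force simp: image_iff)
  show "\<forall>g\<in>fst ` ?P. \<forall>(u, v)\<in>?P. g \<notin> open_sector u v"
  proof (clarsimp)
    fix g g' u v assume g: "(g, g') \<in> ?P" and uv: "(u, v) \<in> ?P" and o: "g \<in> open_sector u v"
    have p: "u \<in> N" "v \<in> N" "vol u v = 1" "sector u v \<in> \<Sigma>"
      and q: "g \<in> N" "g' \<in> N" "vol g g' = 1"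
      using uv g by (simp_all add: mem_pairs_of)
    have "g \<in> sector u v" using o open_sector_subset p by blast
    then have "ray g \<subseteq> sector u v" using ray_subset_iff convex_cone_convex_cone_hull by blast
    then have "sector u v \<inter> ray g = ray g" by blast
    then have "cone_face (ray g) (sector u v)"
      using F(5)[OF p(4) pairs_of_rays(1)[OF fan g]] by simp
    then have "g = u \<or> g = v" using ray_face_of_sector[OF p(3,1,2), of g g'] q by simp
    then show False using o by (auto simp: mem_open_sector)
  qed
  show "\<forall>x. x \<noteq> 0 \<longrightarrow> (\<exists>g\<in>fst ` ?P. x \<in> ray g) \<or> (\<exists>(u, v)\<in>?P. x \<in> open_sector u v)"
  proof (intro allI impI)
    fix x :: "real^2" assume x: "x \<noteq> 0"
    obtain \<sigma> where s: "\<sigma> \<in> \<Sigma>" "x \<in> \<sigma>" using fan(2) unfolding complete_fan_def by blast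
    from F(3)[OF s(1)] show "(\<exists>g\<in>fst ` ?P. x \<in> ray g) \<or> (\<exists>(u, v)\<in>?P. x \<in> open_sector u v)"
    proof (cases rule: smooth_cone_cases)
      case zero
      then show ?thesis using s x by simp
    next
      case (ray u v)
      then obtain w where "(u, w) \<in> ?P" using ray_neighbours(1)[OF fan, of u v] s by auto
      then have "u \<in> fst ` ?P" by (force intro: rev_image_eqI)
      then show ?thesis using ray s by blast
    next
      case (sector u v)
      then have uv: "(u, v) \<in> ?P" using s by (simp add: mem_pairs_of)
      obtain w where "(v, w) \<in> ?P" using pairs_of_rays[OF fan uv] by blast
      then have "u \<in> fst ` ?P" "v \<in> fst ` ?P" using uv by (force intro: rev_image_eqI)+
      moreover have "x \<in> open_sector u v \<or> x \<in> ray u \<or> x \<in> ray v"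
        using sector_eq_union[OF sector(3)] s(2) sector(4) by blast
      ultimately show ?thesis using uv by blast
    qed
  qed
qed

lemma fan_of_pairs_of:
  assumes fan: "smooth_fan N \<Sigma>" "complete_fan \<Sigma>"
  shows "fan_of (pairs_of \<Sigma>) = \<Sigma>"
proof (intro equalityI subsetI)
  note F = is_fanD[OF fan(1)]
  fix \<sigma> assume s: "\<sigma> \<in> fan_of (pairs_of \<Sigma>)"
  from tiling_pairs_of[OF fan] s show "\<sigma> \<in> \<Sigma>"
  proof (cases rule: fan_of_cases)
    case zero
    obtain \<tau> where t: "\<tau> \<in> \<Sigma>" using F(2) by blast
    have "cone_face {0} \<tau>"
      using F(3)[OF t]
    proof (cases rule: smooth_cone_cases)
      case zero
      then show ?thesis by (simp add: cone_face_zero)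
    next
      case (ray u v)
      then have "u \<noteq> 0" by auto
      then show ?thesis using cone_face_ray[of u] ray by simp
    next
      case (sector u v)
      then show ?thesis using cone_face_sector[of u v] by auto
    qed
    then show ?thesis using F(4)[OF t] zero by simp
  next
    case (ray g)
    then show ?thesis using pairs_of_rays(1)[OF fan] by auto
  next
    case (sector u v)
    then show ?thesis by (simp add: mem_pairs_of)
  qed
next
  note F = is_fanD[OF fan(1)]
  fix \<sigma> assume s: "\<sigma> \<in> \<Sigma>"
  from F(3)[OF s] show "\<sigma> \<in> fan_of (pairs_of \<Sigma>)"
  proof (cases rule: smooth_cone_cases)
    case zero
    then show ?thesis by (simp add: fan_of_def)
  next
    case (ray u v)
    then obtain w where "(u, w) \<in> pairs_of \<Sigma>" using ray_neighbours(1)[OF fan, of u v] s by auto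
    then have "u \<in> fst ` pairs_of \<Sigma>" by (force intro: rev_image_eqI)
    then show ?thesis using ray by (simp add: fan_of_def)
  next
    case (sector u v)
    then have "(u, v) \<in> pairs_of \<Sigma>" using s by (simp add: mem_pairs_of)
    then show ?thesis unfolding fan_of_def sector(4) by force
  qed
qed

section \<open>Refinements of tilings\<close>

text \<open>Suppose \<open>g\<close> lay inside an open sector of \<open>Q\<close>. That sector is
  contained in a cone of \<open>P\<close> having \<open>ray g\<close> as a face, so the components
  of \<open>g\<close> along the two generators of the sector would have to lie on
  \<open>ray g\<close>, which they do not.\<close>

lemma subdivides_imp_generators:
  assumes P: "tiling P" and Q: "tiling Q" and sub: "subdivides (fan_of Q) (fan_of P)"
  shows "fst ` P \<subseteq> fst ` Q"
proof
  fix g assume g: "g \<in> fst ` P"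
  obtain g' where g': "(g, g') \<in> P" using g by auto
  note gN = tilingD(3-5)[OF P g']
  have g0: "g \<noteq> 0" using gN by auto
  from Q g0 show "g \<in> fst ` Q"
  proof (cases rule: tiling_cases)
    case (ray h)
    then obtain h' where h: "(h, h') \<in> Q" by auto
    have "g = h" by (rule ray_unique[of g h g' h']) (use gN tilingD(3-5)[OF Q h] ray in auto)
    then show ?thesis using ray by simp
  next
    case (sector a b)
    have ab: "vol a b = 1" using tilingD(5)[OF Q sector(1)] .
    have "sector a b \<in> fan_of Q" using sector unfolding fan_of_def by force
    then obtain \<sigma> where s: "\<sigma> \<in> fan_of P" "sector a b \<subseteq> \<sigma>"
      using sub unfolding subdivides_def by blast
    have cc: "convex_cone \<sigma>" using convex_cone_fan_of[OF P s(1)] .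
    have ab': "a \<in> \<sigma>" "b \<in> \<sigma>" using s(2) mem_self_sector by blast+
    have gs: "g \<in> \<sigma>" using sector(2) open_sector_subset[OF ab] s(2) by blast
    then have "ray g \<subseteq> \<sigma>" using ray_subset_iff cc by blast
    then have "\<sigma> \<inter> ray g = ray g" by blast
    moreover have "ray g \<in> fan_of P" using g unfolding fan_of_def by blast
    ultimately have "cone_face (ray g) \<sigma>" using fan_of_inter_face[OF P s(1)] by metis
    then have face: "x \<in> ray g" if "x \<in> \<sigma>" "y \<in> \<sigma>" "x + y \<in> ray g" for x y
      using that by (simp add: cone_face_iff[OF cc])
    have pos: "0 < vol g b" "0 < vol a g" using sector(2) by (simp_all add: mem_open_sector)
    have "vol g b *\<^sub>R a \<in> ray g"
    proof (rule face)
      show "vol g b *\<^sub>R a \<in> \<sigma>" "vol a g *\<^sub>R b \<in> \<sigma>"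
        using pos ab' cc by (auto intro!: convex_cone_scaleR)
      show "vol g b *\<^sub>R a + vol a g *\<^sub>R b \<in> ray g"
        using unimodular_coords[OF ab, of g] mem_self_ray[of g] by simp
    qed
    then obtain t where "vol g b *\<^sub>R a = t *\<^sub>R g" by (auto simp: mem_convex_cone_hull_singleton)
    from arg_cong[OF this, of "\<lambda>x. vol x g"] show ?thesis using pos by simp
  qed
qed

text \<open>The sum \<open>a + b\<close> locates the cone of \<open>P\<close> that contains a given
  sector of \<open>Q\<close>. It cannot lie on a ray of \<open>P\<close>, whose generator would then
  be inside a sector of \<open>Q\<close>; and the sector of \<open>P\<close> around it contains the
  whole sector by \<open>sector_nested\<close>.\<close>

lemma generators_imp_subdivides:
  assumes P: "tiling P" and Q: "tiling Q" and sub: "fst ` P \<subseteq> fst ` Q"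
  shows "subdivides (fan_of Q) (fan_of P)"
proof -
  have sec: "\<exists>\<sigma>\<in>fan_of P. sector a b \<subseteq> \<sigma>" if ab: "(a, b) \<in> Q" for a b
  proof -
    have v: "vol a b = 1" using tilingD(5)[OF Q ab] .
    have x: "a + b \<in> open_sector a b" using v by (simp add: mem_open_sector)
    have x0: "a + b \<noteq> 0"
      using v by (metis add.right_neutral vol_add_left vol_self vol_zero_left zero_neq_one add_0)
    from P x0 show ?thesis
    proof (cases rule: tiling_cases)
      case (ray h)
      then have "h \<in> open_sector a b" using ray_mem_open_sector_iff x x0 by blast
      then show ?thesis using tilingD(6)[OF Q _ ab] ray sub by blast
    next
      case (sector c d)
      have cd: "vol c d = 1" using tilingD(5)[OF P sector(1)] .
      have "c \<notin> open_sector a b" "d \<notin> open_sector a b"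
        using tilingD(6)[OF Q _ ab] tilingD(7,8)[OF P sector(1)] sub by blast+
      from sector_nested[OF v cd x sector(2) this]
      have "sector a b \<subseteq> sector c d"
        using sector_subset_iff convex_cone_convex_cone_hull by blast
      moreover have "sector c d \<in> fan_of P" using sector unfolding fan_of_def by force
      ultimately show ?thesis by blast
    qed
  qed
  have "\<exists>\<sigma>\<in>fan_of P. \<tau> \<subseteq> \<sigma>" if "\<tau> \<in> fan_of Q" for \<tau>
    using Q that
  proof (cases rule: fan_of_cases)
    case zero
    then show ?thesis by (auto simp: fan_of_def)
  next
    case (ray g)
    then obtain v where v: "(g, v) \<in> Q" by auto
    have "ray g \<subseteq> sector g v" by (rule hull_mono) simp
    then show ?thesis using sec[OF v] ray by blast
  next
    case (sector a b)
    then show ?thesis using sec by simp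
  qed
  moreover have "\<Union> (fan_of Q) = \<Union> (fan_of P)"
    using complete_fan_fan_of[OF P] complete_fan_fan_of[OF Q] by (simp add: complete_fan_def)
  ultimately show ?thesis unfolding subdivides_def by blast
qed

section \<open>Star subdivisions and prescribed generators\<close>

definition star :: "((real^2) \<times> (real^2)) set \<Rightarrow> real^2 \<Rightarrow> real^2 \<Rightarrow> ((real^2) \<times> (real^2)) set" where
  "star P u v = P - {(u, v)} \<union> {(u, u + v), (u + v, v)}"

lemma open_sector_sum:
  "open_sector u (u + v) \<subseteq> open_sector u v" "open_sector (u + v) v \<subseteq> open_sector u v"
  using vol_commute[of _ u] vol_commute[of v] by (force simp: mem_open_sector)+

text \<open>One step of the subtractive Euclidean algorithm: the smaller of the two coordinates of
  \<open>x\<close> is subtracted from the larger, and equality means that \<open>x\<close> lies on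
  the new ray.\<close>

lemma open_sector_split:
  assumes uv: "vol u v = 1" and x: "x \<in> open_sector u v"
  shows "x \<in> open_sector u (u + v) \<or> x \<in> open_sector (u + v) v \<or> x \<in> ray (u + v)"
proof -
  consider "vol u x < vol x v" | "vol u x > vol x v" | "vol u x = vol x v" by linarith
  then show ?thesis
  proof cases
    case 1
    then show ?thesis using x vol_commute[of x u] by (simp add: mem_open_sector)
  next
    case 2
    then show ?thesis using x vol_commute[of v x] by (simp add: mem_open_sector)
  next
    case 3
    then have "x = vol x v *\<^sub>R (u + v)"
      using unimodular_coords[OF uv, of x] by (simp add: scaleR_add_right)
    then show ?thesis using x
      unfolding mem_convex_cone_hull_singleton mem_open_sector by (metis less_imp_le)
  qed
qed

lemma sum_mem_open_sector: "vol u v = 1 \<Longrightarrow> u + v \<in> open_sector u v"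
  by (simp add: mem_open_sector)

lemma fst_star: "(u, v) \<in> P \<Longrightarrow> fst ` star P u v = insert (u + v) (fst ` P)"
  and snd_star: "(u, v) \<in> P \<Longrightarrow> snd ` star P u v = insert (u + v) (snd ` P)"
  unfolding star_def by force+

text \<open>Old generators stay outside the two new open sectors because these are contained in the
  old one; the new generator stays outside the remaining sectors because \<open>(u, v)\<close> was
  the only one around it.\<close>

lemma tiling_star:
  assumes P: "tiling P" and uv: "(u, v) \<in> P"
  shows "tiling (star P u v)"
  unfolding tiling_def
proof (intro conjI)
  note D = tilingD[OF P]
  let ?Q = "star P u v" and ?w = "u + v"
  have v1: "u \<in> N" "v \<in> N" "vol u v = 1" using D(3-5)[OF uv] by blast+
  have w: "?w \<in> N" "vol u ?w = 1" "vol ?w v = 1"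
    using v1 lattice_add by auto
  have Q: "(a, b) \<in> ?Q \<longleftrightarrow> (a, b) \<in> P \<and> (a, b) \<noteq> (u, v) \<or> (a, b) = (u, ?w) \<or> (a, b) = (?w, v)" for a b
    by (auto simp: star_def)
  show "finite ?Q" using D(1) by (simp add: star_def)
  show "\<forall>(a, b)\<in>?Q. a \<in> N \<and> b \<in> N \<and> vol a b = 1"
    using v1 w D(3-5) by (auto simp: Q)
  show "fst ` ?Q = snd ` ?Q" using fst_star[OF uv] snd_star[OF uv] D(2) by simp
  have wo: "?w \<in> open_sector u v" using sum_mem_open_sector[OF v1(3)] .
  have old: "g \<notin> open_sector a b" if "g \<in> fst ` P" "(a, b) \<in> ?Q" for g a b
    using that D(6)[OF that(1)] uv open_sector_sum[of u v] unfolding Q by blast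
  have new: "?w \<notin> open_sector a b" if ab: "(a, b) \<in> ?Q" for a b
    using ab[unfolded Q]
  proof (elim disjE conjE)
    assume "(a, b) \<in> P" "(a, b) \<noteq> (u, v)"
    then show ?thesis using tiling_sector_unique[OF P _ uv _ wo] by blast
  qed (auto simp: mem_open_sector)
  show "\<forall>g\<in>fst ` ?Q. \<forall>(a, b)\<in>?Q. g \<notin> open_sector a b"
    unfolding fst_star[OF uv] using old new by blast
  show "\<forall>x. x \<noteq> 0 \<longrightarrow> (\<exists>g\<in>fst ` ?Q. x \<in> ray g) \<or> (\<exists>(a, b)\<in>?Q. x \<in> open_sector a b)"
  proof (intro allI impI)
    fix x :: "real^2" assume x: "x \<noteq> 0"
    from P x show "(\<exists>g\<in>fst ` ?Q. x \<in> ray g) \<or> (\<exists>(a, b)\<in>?Q. x \<in> open_sector a b)"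
    proof (cases rule: tiling_cases)
      case (ray g)
      then show ?thesis unfolding fst_star[OF uv] by blast
    next
      case (sector a b)
      show ?thesis
      proof (cases "(a, b) = (u, v)")
        case True
        then have "x \<in> open_sector u ?w \<or> x \<in> open_sector ?w v \<or> x \<in> ray ?w"
          using open_sector_split[OF v1(3)] sector by blast
        moreover have "(u, ?w) \<in> ?Q" "(?w, v) \<in> ?Q" by (simp_all add: Q)
        ultimately show ?thesis unfolding fst_star[OF uv] by blast
      next
        case False
        then have "(a, b) \<in> ?Q" using sector by (simp add: Q)
        then show ?thesis using sector by blast
      qed
    qed
  qed
qed

lemma sum_not_generator: "tiling P \<Longrightarrow> (u, v) \<in> P \<Longrightarrow> u + v \<notin> fst ` P"
  using sum_mem_open_sector tilingD(5,6) by blast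

lemma unimodular_primitive:
  assumes "u \<in> N" "v \<in> N" "\<bar>vol u v\<bar> = 1"
  shows "u \<in> primitive_vectors N"
  unfolding primitive_vectors_def
proof (intro CollectI conjI ballI allI impI assms(1))
  fix w and n :: int assume w: "w \<in> N" "u = of_int n *\<^sub>R w"
  obtain k l :: int where k: "vol w v = of_int k" "vol u v = of_int l" using vol_int assms w by metis
  have "vol u v = of_int n * vol w v" using w by simp
  then have "l = n * k" using k by (metis of_int_eq_iff of_int_mult)
  moreover have "\<bar>l\<bar> = 1" using assms(3) k by (metis of_int_abs of_int_eq_iff of_int_1)
  ultimately have "\<bar>n\<bar> * \<bar>k\<bar> = 1" by (simp add: abs_mult)
  then show "\<bar>n\<bar> = 1" by (auto simp: zmult_eq_1_iff)
qed

lemma primitive_mem_ray: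
  assumes v: "v \<in> primitive_vectors N" and g: "g \<in> N" "g' \<in> N" "\<bar>vol g g'\<bar> = 1" "v \<in> ray g"
  shows "v = g"
proof -
  obtain t where t: "t \<ge> 0" "v = t *\<^sub>R g" using g(4) by (auto simp: mem_convex_cone_hull_singleton)
  have vN: "v \<in> N" using v by (simp add: primitive_vectors_def)
  obtain k l :: int where k: "vol v g' = of_int k" "vol g g' = of_int l" using vol_int vN g by metis
  have l: "\<bar>l\<bar> = 1" using g(3) k by (metis of_int_abs of_int_eq_iff of_int_1)
  have "of_int k = t * of_int l" using k t by (metis vol_scaleR_left)
  then have "t = of_int (k * l)" using l by (auto simp: abs_if split: if_splits)
  then have "\<bar>k * l\<bar> = 1" using v t(2) g(1) unfolding primitive_vectors_def by blast
  then have "t = 1" using \<open>t = of_int (k * l)\<close> t(1) by (auto simp: abs_if split: if_splits)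
  then show ?thesis using t by simp
qed

lemma generator_primitive: "tiling P \<Longrightarrow> g \<in> fst ` P \<Longrightarrow> g \<in> primitive_vectors N"
  using unimodular_primitive tilingD(3-5) by (metis abs_one tiling_nextE)

text \<open>Each star subdivision lowers the sum of the two coordinates of \<open>v\<close> by the
  smaller one. Inside an open sector the coordinates of a lattice vector are positive integers, so
  the bound \<open>n\<close> can drop by 1. The process stops when \<open>v\<close> reaches the new
  ray, and primitivity then makes it the new generator.\<close>

lemma insert_vector_in_sector:
  assumes v: "v \<in> primitive_vectors N"
  shows "tiling P \<Longrightarrow> (a, b) \<in> P \<Longrightarrow> v \<in> open_sector a b \<Longrightarrow> vol v b + vol a v \<le> of_nat n \<Longrightarrow>
    \<exists>Q. tiling Q \<and> fst ` P \<subseteq> fst ` Q \<and> v \<in> fst ` Q"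
proof (induction n arbitrary: P a b)
  case 0
  then show ?case by (simp add: mem_open_sector)
next
  case (Suc n)
  let ?w = "a + b" and ?S = "star P a b"
  have ab: "a \<in> N" "b \<in> N" "vol a b = 1" using tilingD(3-5)[OF Suc.prems(1,2)] by blast+
  have vN: "v \<in> N" using v by (simp add: primitive_vectors_def)
  obtain k l :: int where k: "vol v b = of_int k" "vol a v = of_int l" using vol_int vN ab by metis
  have "k > 0" "l > 0" using Suc.prems(3) k by (simp_all add: mem_open_sector)
  then have ge: "vol v b \<ge> 1" "vol a v \<ge> 1" using k by simp_all
  have S: "tiling ?S" using tiling_star[OF Suc.prems(1,2)] .
  have f: "fst ` P \<subseteq> fst ` ?S" "?w \<in> fst ` ?S" using fst_star[OF Suc.prems(2)] by auto
  consider "v \<in> open_sector a ?w" | "v \<in> open_sector ?w b" | "v \<in> ray ?w"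
    using open_sector_split[OF ab(3) Suc.prems(3)] by blast
  then show ?case
  proof cases
    case 1
    have "(a, ?w) \<in> ?S" by (simp add: star_def)
    moreover have "vol v ?w + vol a v \<le> of_nat n"
      using Suc.prems(4) ge vol_commute[of v a] by simp
    ultimately show ?thesis using Suc.IH[OF S _ 1] f(1) by blast
  next
    case 2
    have "(?w, b) \<in> ?S" by (simp add: star_def)
    moreover have "vol v b + vol ?w v \<le> of_nat n"
      using Suc.prems(4) ge vol_commute[of v b] by simp
    ultimately show ?thesis using Suc.IH[OF S _ 2] f(1) by blast
  next
    case 3
    have "v = ?w"
      by (rule primitive_mem_ray[OF v, of _ b]) (use ab lattice_add 3 in auto)
    then show ?thesis using S f by blast
  qed
qed

lemma insert_vector:
  assumes P: "tiling P" and v: "v \<in> primitive_vectors N"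
  shows "\<exists>Q. tiling Q \<and> fst ` P \<subseteq> fst ` Q \<and> v \<in> fst ` Q"
proof -
  have "v \<noteq> 0"
  proof
    assume "v = 0"
    then have "\<bar>2::int\<bar> = 1" using v unfolding primitive_vectors_def by (metis (mono_tags, lifting) mem_Collect_eq scaleR_zero_right)
    then show False by simp
  qed
  with P show ?thesis
  proof (cases rule: tiling_cases)
    case (ray g)
    then obtain g' where g: "(g, g') \<in> P" by auto
    have "v = g" by (rule primitive_mem_ray[OF v, of _ g']) (use tilingD(3-5)[OF P g] ray in auto)
    then show ?thesis using P ray by blast
  next
    case (sector a b)
    obtain n :: nat where "vol v b + vol a v \<le> of_nat n" using real_arch_simple by blast
    then show ?thesis using insert_vector_in_sector[OF v P sector] by blast
  qed
qed

lemma insert_vectors: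
  assumes P: "tiling P" and A: "finite A" "A \<subseteq> primitive_vectors N"
  shows "\<exists>Q. tiling Q \<and> fst ` P \<subseteq> fst ` Q \<and> A \<subseteq> fst ` Q"
  using A
proof (induction A rule: finite_induct)
  case empty
  then show ?case using P by blast
next
  case (insert v A)
  then obtain Q where Q: "tiling Q" "fst ` P \<subseteq> fst ` Q" "A \<subseteq> fst ` Q" by blast
  moreover obtain R where "tiling R" "fst ` Q \<subseteq> fst ` R" "v \<in> fst ` R"
    using insert_vector[OF Q(1)] insert.prems by blast
  ultimately show ?case by (intro exI[of _ R]) blast
qed

text \<open>If \<open>u + v\<close> were inside a sector \<open>(a, b)\<close> of \<open>Q\<close>,
  that sector would lie in \<open>sector u v\<close>, so \<open>a\<close> and \<open>b\<close> would
  have nonnegative integral coordinates with respect to \<open>u\<close>, \<open>v\<close>. A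
  combination of them with positive integers \<open>i\<close>, \<open>j\<close> has coordinates
  \<open>(1, 1)\<close> only for \<open>a = u\<close> and \<open>b = v\<close>, and that pair is not
  in \<open>Q\<close>.\<close>

lemma refined_sector_sum:
  assumes P: "tiling P" and Q: "tiling Q" and sub: "fst ` P \<subseteq> fst ` Q"
    and uv: "(u, v) \<in> P" "(u, v) \<notin> Q"
  shows "u + v \<in> fst ` Q"
proof -
  let ?w = "u + v"
  have p: "u \<in> N" "v \<in> N" "vol u v = 1" using tilingD(3-5)[OF P uv(1)] by blast+
  have w: "?w \<in> N" "vol ?w v = 1" "vol u ?w = 1" using p lattice_add by auto
  have w0: "?w \<noteq> 0" using w(2) by (metis vol_zero_left zero_neq_one)
  from Q w0 show ?thesis
  proof (cases rule: tiling_cases)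
    case (ray h)
    then obtain h' where h: "(h, h') \<in> Q" by auto
    have "?w = h"
      by (rule ray_unique[of _ h v h']) (use w p tilingD(3-5)[OF Q h] ray in auto)
    then show ?thesis using ray by simp
  next
    case (sector a b)
    have q: "a \<in> N" "b \<in> N" "vol a b = 1" using tilingD(3-5)[OF Q sector(1)] by blast+
    have "u \<notin> open_sector a b" "v \<notin> open_sector a b"
      using tilingD(6)[OF Q _ sector(1)] tilingD(7,8)[OF P uv(1)] sub by blast+
    from sector_nested[OF q(3) p(3) sector(2) sum_mem_open_sector[OF p(3)] this]
    have ab: "a \<in> sector u v" "b \<in> sector u v" by blast+
    obtain a1 a2 c1 c2 i j :: int where
      e: "vol a v = of_int a1" "vol u a = of_int a2" "vol b v = of_int c1" "vol u b = of_int c2"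
        "vol ?w b = of_int i" "vol a ?w = of_int j"
      using vol_int p q w(1) by metis
    have nn: "a1 \<ge> 0" "a2 \<ge> 0" "c1 \<ge> 0" "c2 \<ge> 0" "i \<ge> 1" "j \<ge> 1"
      using ab sector(2) e by (auto simp: mem_sector[OF p(3)] mem_open_sector)
    have "?w = of_int i *\<^sub>R a + of_int j *\<^sub>R b"
      using unimodular_coords[OF q(3), of ?w] unfolding e(5,6) .
    from arg_cong[OF this, of "\<lambda>x. vol x v"] arg_cong[OF this, of "vol u"]
    have "(1::real) = of_int (i * a1 + j * c1)" "(1::real) = of_int (i * a2 + j * c2)"
      using e w by simp_all
    then have s: "i * a1 + j * c1 = 1" "i * a2 + j * c2 = 1" by linarith+
    have "(1::real) = of_int (a1 * c2 - a2 * c1)"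
      using vol_expand[OF p(3), of a b] e q(3) by simp
    then have "a1 * c2 - a2 * c1 = 1" by linarith
    moreover have "0 \<le> a2 * c1" using nn by simp
    ultimately have "a1 * c2 \<ge> 1" by linarith
    then have pos: "a1 \<ge> 1" "c2 \<ge> 1" using nn by (auto simp: int_one_le_iff_zero_less zero_less_mult_iff)
    \<comment> \<open>As \<open>i\<close> and \<open>j\<close> are at least 1, each of the two
      equations with value 1 has one coordinate equal to 1 and the other equal to 0.\<close>
    have "i * a1 \<ge> a1" "j * c2 \<ge> c2" "j * c1 \<ge> c1" "i * a2 \<ge> a2"
      using nn by (auto simp: mult_le_cancel_right1)
    then have "a1 = 1" "c1 = 0" "a2 = 0" "c2 = 1" using s pos nn by linarith+
    then have "a = u" "b = v"
      using e p by (auto intro!: vol_eqI[OF p(3)])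
    then show ?thesis using sector uv by simp
  qed
qed

lemma refinement_step:
  assumes P: "tiling P" and Q: "tiling Q" and sub: "fst ` P \<subset> fst ` Q"
  obtains u v where "(u, v) \<in> P" "u + v \<in> fst ` Q"
proof -
  obtain g where g: "g \<in> fst ` Q" "g \<notin> fst ` P" using sub by blast
  obtain g' where g': "(g, g') \<in> Q" using g by auto
  note gN = tilingD(3-5)[OF Q g']
  have "g \<noteq> 0" using gN by auto
  with P show thesis
  proof (cases rule: tiling_cases)
    case (ray h)
    then obtain h' where h: "(h, h') \<in> P" by auto
    have "g = h" by (rule ray_unique[of _ h g' h']) (use gN tilingD(3-5)[OF P h] ray in auto)
    then show ?thesis using ray g by simp
  next
    case (sector u v)
    then have "(u, v) \<notin> Q" using tilingD(6)[OF Q g(1)] by blast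
    then show ?thesis using refined_sector_sum[OF P Q _ sector(1)] sub that sector(1) by blast
  qed
qed

text \<open>A sector of one tiling that is missing in the other would have its sum among the common
  generators, although a sum of neighbours is never a generator.\<close>

lemma tiling_eqI:
  assumes P: "tiling P" and Q: "tiling Q" and eq: "fst ` P = fst ` Q"
  shows "P = Q"
proof -
  have "(u, v) \<in> Q'" if "tiling P'" "tiling Q'" "fst ` P' = fst ` Q'" "(u, v) \<in> P'" for P' Q' u v
  proof (rule ccontr)
    assume "(u, v) \<notin> Q'"
    then have "u + v \<in> fst ` Q'" using refined_sector_sum[OF that(1,2) _ that(4)] that(3) by blast
    then show False using sum_not_generator[OF that(1,4)] that(3) by simp
  qed
  then show ?thesis using assms by (metis subrelI subset_antisym)
qed

text \<open>The induction runs downwards from \<open>Q\<close>: the hypothesis concerns the finer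
  tiling \<open>star P u v\<close>, and the number of generators of \<open>Q\<close> still missing
  decreases. Only \<open>Q\<close> stays fixed in the step, so facts about the starting tiling have
  to be built into \<open>R\<close>.\<close>

lemma refinement_induct [consumes 3, case_names refl step]:
  assumes "tiling P" "tiling Q" "fst ` P \<subseteq> fst ` Q"
    and base: "R Q"
    and step: "\<And>P u v. tiling P \<Longrightarrow> (u, v) \<in> P \<Longrightarrow> fst ` P \<subseteq> fst ` Q \<Longrightarrow> u + v \<in> fst ` Q \<Longrightarrow>
      R (star P u v) \<Longrightarrow> R P"
  shows "R P"
  using assms(1,3)
proof (induction "card (fst ` Q - fst ` P)" arbitrary: P rule: less_induct)
  case less
  show ?case
  proof (cases "fst ` P = fst ` Q")
    case True
    then show ?thesis using tiling_eqI[OF less.prems(1) assms(2)] base by simp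
  next
    case False
    then obtain u v where uv: "(u, v) \<in> P" "u + v \<in> fst ` Q"
      using refinement_step[OF less.prems(1) assms(2)] less.prems(2) by blast
    have f: "fst ` star P u v = insert (u + v) (fst ` P)" using fst_star[OF uv(1)] .
    have "finite (fst ` Q - fst ` P)" using tilingD(1)[OF assms(2)] by simp
    moreover have "u + v \<in> fst ` Q - fst ` P"
      using uv(2) sum_not_generator[OF less.prems(1) uv(1)] by blast
    ultimately have "card (fst ` Q - fst ` star P u v) < card (fst ` Q - fst ` P)"
      unfolding f by (intro psubset_card_mono) auto
    then have "R (star P u v)"
      using less.hyps[OF _ tiling_star[OF less.prems(1) uv(1)]] f uv(2) less.prems(2) by auto
    then show ?thesis using step[OF less.prems(1) uv(1) less.prems(2) uv(2)] by blast
  qed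
qed

end

section \<open>The intersection pairing of a smooth complete fan\<close>

lemma prime_divisor_toric: "\<tau> \<in> rays \<Sigma> \<Longrightarrow> prime_divisor \<tau> \<in> toric_divisors \<Sigma>"
  by (auto simp: prime_divisor_def toric_divisors_def)

lemma character_divisor_toric: "character_divisor N \<Sigma> m \<in> toric_divisors \<Sigma>"
  by (auto simp: character_divisor_def toric_divisors_def)

lemma intersection_pairingD:
  assumes "intersection_pairing K N \<Sigma> B"
  shows "E \<in> toric_divisors \<Sigma> \<Longrightarrow> F \<in> toric_divisors \<Sigma> \<Longrightarrow> B E F = B F E"
    and "E \<in> toric_divisors \<Sigma> \<Longrightarrow> E' \<in> toric_divisors \<Sigma> \<Longrightarrow> F \<in> toric_divisors \<Sigma> \<Longrightarrow>
      B (\<lambda>\<tau>. E \<tau> + E' \<tau>) F = B E F + B E' F"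
    and "E \<in> toric_divisors \<Sigma> \<Longrightarrow> F \<in> toric_divisors \<Sigma> \<Longrightarrow> B (\<lambda>\<tau>. c * E \<tau>) F = c * B E F"
    and "m \<in> dual_lattice N \<Longrightarrow> F \<in> toric_divisors \<Sigma> \<Longrightarrow> B (character_divisor N \<Sigma> m) F = 0"
proof -
  note B = assms[unfolded intersection_pairing_def]
  note 1 = B[THEN conjunct1]
    and 2 = B[THEN conjunct2, THEN conjunct1]
    and 3 = B[THEN conjunct2, THEN conjunct2, THEN conjunct1]
    and 4 = B[THEN conjunct2, THEN conjunct2, THEN conjunct2, THEN conjunct1]
  show "E \<in> toric_divisors \<Sigma> \<Longrightarrow> F \<in> toric_divisors \<Sigma> \<Longrightarrow> B E F = B F E"
    using 1 by blast
  show "E \<in> toric_divisors \<Sigma> \<Longrightarrow> E' \<in> toric_divisors \<Sigma> \<Longrightarrow> F \<in> toric_divisors \<Sigma> \<Longrightarrow>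
      B (\<lambda>\<tau>. E \<tau> + E' \<tau>) F = B E F + B E' F"
    using 2 by blast
  show "E \<in> toric_divisors \<Sigma> \<Longrightarrow> F \<in> toric_divisors \<Sigma> \<Longrightarrow> B (\<lambda>\<tau>. c * E \<tau>) F = c * B E F"
    using 3 by blast
  show "m \<in> dual_lattice N \<Longrightarrow> F \<in> toric_divisors \<Sigma> \<Longrightarrow> B (character_divisor N \<Sigma> m) F = 0"
    using 4 by blast
qed

lemma intersection_pairing_expand:
  assumes B: "intersection_pairing K N \<Sigma> B" and fin: "finite (rays \<Sigma>)"
    and E: "E \<in> toric_divisors \<Sigma>" and F: "F \<in> toric_divisors \<Sigma>"
  shows "B E F = (\<Sum>\<tau>\<in>rays \<Sigma>. E \<tau> * B (prime_divisor \<tau>) F)"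
proof -
  note D = intersection_pairingD[OF B]
  have part: "B (\<lambda>\<rho>. \<Sum>\<tau>\<in>T. E \<tau> * prime_divisor \<tau> \<rho>) F = (\<Sum>\<tau>\<in>T. E \<tau> * B (prime_divisor \<tau>) F)"
    if "finite T" "T \<subseteq> rays \<Sigma>" for T
    using that
  proof (induction T rule: finite_induct)
    case empty
    then show ?case using D(3)[OF E F, of 0] by simp
  next
    case (insert \<tau> T)
    have s: "(\<lambda>\<rho>. \<Sum>\<tau>\<in>T. E \<tau> * prime_divisor \<tau> \<rho>) \<in> toric_divisors \<Sigma>"
      using insert.prems by (auto simp: toric_divisors_def prime_divisor_def intro!: sum.neutral)
    have p: "prime_divisor \<tau> \<in> toric_divisors \<Sigma>"
      using insert.prems by (simp add: prime_divisor_toric)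
    then have c: "(\<lambda>\<rho>. E \<tau> * prime_divisor \<tau> \<rho>) \<in> toric_divisors \<Sigma>"
      by (auto simp: toric_divisors_def)
    show ?case
      using insert D(2)[OF c s F] D(3)[OF p F, of "E \<tau>"] by simp
  qed
  have "(\<Sum>\<tau>\<in>rays \<Sigma>. E \<tau> * prime_divisor \<tau> \<rho>) = E \<rho>" for \<rho>
  proof -
    have "(\<Sum>\<tau>\<in>rays \<Sigma>. E \<tau> * prime_divisor \<tau> \<rho>) = (\<Sum>\<tau>\<in>rays \<Sigma>. if \<rho> = \<tau> then E \<tau> else 0)"
      by (rule sum.cong) (auto simp: prime_divisor_def)
    also have "\<dots> = E \<rho>" using E fin by (simp add: toric_divisors_def)
    finally show ?thesis .
  qed
  then show ?thesis using part[OF fin order_refl] by simp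
qed

section \<open>Uniqueness of the pairing and common points of toric curves\<close>

context planar_lattice
begin

text \<open>For \<open>v \<in> N\<close> this \<open>m\<close> lies in the dual lattice: it is the
  character that vanishes on \<open>v\<close> and has the value 1 on every \<open>u\<close> with
  \<open>vol u v = 1\<close>.\<close>

lemma vol_as_inner: "\<exists>m. \<forall>x. m \<bullet> x = vol x v"
proof -
  let ?d = "b1$1 * b2$2 - b1$2 * b2$1"
  have "(vector [v$2 / ?d, - v$1 / ?d] :: real^2) \<bullet> x = vol x v" for x
    by (simp add: inner_vec_def sum_2 vector_2 vol_def diff_divide_distrib mult.commute)
  then show ?thesis by blast
qed

lemma ray_generator_ray:
  assumes "u \<in> N" "u' \<in> N" "\<bar>vol u u'\<bar> = 1"
  shows "ray_generator N (ray u) = u"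
  unfolding ray_generator_def
proof (rule the_equality)
  show "u \<in> primitive_vectors N \<and> u \<in> ray u"
    using unimodular_primitive[OF assms] mem_self_ray by blast
  show "v = u" if "v \<in> primitive_vectors N \<and> v \<in> ray u" for v
    using primitive_mem_ray[of v u u'] assms that by blast
qed

lemma tiling_ray_generator:
  assumes "tiling P" "g \<in> fst ` P"
  shows "ray_generator N (ray g) = g"
proof -
  obtain v where "(g, v) \<in> P" using assms by auto
  then show ?thesis using ray_generator_ray[of g v] tilingD(3-5)[OF assms(1)] by simp
qed

lemma tiling_ray_inject:
  assumes "tiling P" "g \<in> fst ` P" "h \<in> fst ` P"
  shows "ray g = ray h \<longleftrightarrow> g = h"
  using tiling_ray_generator assms by metis

text \<open>Intersections of distinct curves are prescribed. For a self-intersection, a character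
  whose divisor contains the curve with coefficient 1 replaces the curve by a combination of the
  others.\<close>

lemma intersection_pairing_unique:
  assumes P: "tiling P" and B: "intersection_pairing K N (fan_of P) B"
    and B': "intersection_pairing K N (fan_of P) B'"
    and E: "E \<in> toric_divisors (fan_of P)" and F: "F \<in> toric_divisors (fan_of P)"
  shows "B E F = B' E F"
proof -
  let ?\<Sigma> = "fan_of P"
  have fin: "finite (rays ?\<Sigma>)" using rays_fan_of[OF P] tilingD(1)[OF P] by simp
  have distinct: "B (prime_divisor \<tau>) (prime_divisor \<rho>) = B' (prime_divisor \<tau>) (prime_divisor \<rho>)"
    if "\<tau> \<in> rays ?\<Sigma>" "\<rho> \<in> rays ?\<Sigma>" "\<tau> \<noteq> \<rho>" for \<tau> \<rho>
    using B B' that unfolding intersection_pairing_def by simp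
  have same: "B (prime_divisor \<tau>) (prime_divisor \<tau>) = B' (prime_divisor \<tau>) (prime_divisor \<tau>)"
    if \<tau>: "\<tau> \<in> rays ?\<Sigma>" for \<tau>
  proof -
    obtain g where g: "g \<in> fst ` P" "\<tau> = ray g" using \<tau> rays_fan_of[OF P] by blast
    then obtain v where v: "(g, v) \<in> P" by auto
    \<comment> \<open>The successor \<open>v\<close> of \<open>g\<close> provides a character with
      value \<open>vol g v = 1\<close> on \<open>g\<close>.\<close>
    obtain m where m: "\<And>x. m \<bullet> x = vol x v" using vol_as_inner by blast
    have dual: "m \<in> dual_lattice N"
      using m vol_Ints tilingD(4)[OF P v] by (simp add: dual_lattice_def)
    define c where "c = character_divisor N ?\<Sigma> m"
    have c1: "c \<tau> = 1"
      using \<tau> g m tiling_ray_generator[OF P g(1)] tilingD(5)[OF P v]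
      by (simp add: c_def character_divisor_def)
    have self: "C (prime_divisor \<tau>) (prime_divisor \<tau>) =
        - (\<Sum>\<rho>\<in>rays ?\<Sigma> - {\<tau>}. c \<rho> * C (prime_divisor \<rho>) (prime_divisor \<tau>))"
      if C: "intersection_pairing K N ?\<Sigma> C" for C
    proof -
      have "0 = C c (prime_divisor \<tau>)"
        using intersection_pairingD(4)[OF C dual prime_divisor_toric[OF \<tau>]] by (simp add: c_def)
      also have "\<dots> = (\<Sum>\<rho>\<in>rays ?\<Sigma>. c \<rho> * C (prime_divisor \<rho>) (prime_divisor \<tau>))"
        by (rule intersection_pairing_expand[OF C fin])
          (simp_all add: c_def character_divisor_toric prime_divisor_toric \<tau>)
      finally show ?thesis using c1 by (simp add: sum.remove[OF fin \<tau>])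
    qed
    have "(\<Sum>\<rho>\<in>rays ?\<Sigma> - {\<tau>}. c \<rho> * B (prime_divisor \<rho>) (prime_divisor \<tau>)) =
        (\<Sum>\<rho>\<in>rays ?\<Sigma> - {\<tau>}. c \<rho> * B' (prime_divisor \<rho>) (prime_divisor \<tau>))"
      by (rule sum.cong) (use distinct \<tau> in auto)
    then show ?thesis using self[OF B] self[OF B'] by simp
  qed
  have double: "C E F = (\<Sum>\<tau>\<in>rays ?\<Sigma>. E \<tau> * (\<Sum>\<rho>\<in>rays ?\<Sigma>. F \<rho> * C (prime_divisor \<rho>) (prime_divisor \<tau>)))"
    if C: "intersection_pairing K N ?\<Sigma> C" for C
    unfolding intersection_pairing_expand[OF C fin E F]
  proof (rule sum.cong[OF refl])
    fix \<tau> assume "\<tau> \<in> rays ?\<Sigma>"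
    then have p: "prime_divisor \<tau> \<in> toric_divisors ?\<Sigma>" by (rule prime_divisor_toric)
    show "E \<tau> * C (prime_divisor \<tau>) F = E \<tau> * (\<Sum>\<rho>\<in>rays ?\<Sigma>. F \<rho> * C (prime_divisor \<rho>) (prime_divisor \<tau>))"
      using intersection_pairing_expand[OF C fin F p] intersection_pairingD(1)[OF C p F] by simp
  qed
  show ?thesis unfolding double[OF B] double[OF B']
    using distinct same by (intro sum.cong arg_cong2[of _ _ _ _ "(*)"] refl) metis
qed

text \<open>Only \<open>m = 0\<close> vanishes on a two-dimensional cone, so the homomorphism must
  be 1 at 0 and 0 elsewhere: the orbit is a torus-fixed point.\<close>

lemma card_torus_orbit_sector:
  assumes uv: "vol u v = 1"
  shows "card (torus_orbit N (sector u v) :: (cone \<times> (real^2 \<Rightarrow> 'k::field)) set) = 1"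
proof -
  let ?S = "sector u v" and ?M = "cone_monoid N (sector u v)"
  have zero: "m = 0" if "\<forall>x\<in>?S. m \<bullet> x = 0" for m
  proof -
    have "m \<bullet> u = 0" "m \<bullet> v = 0" using that mem_self_sector by blast+
    then have "m \<bullet> x = 0" for x
      using arg_cong[OF unimodular_coords[OF uv, of x], of "inner m"] by (simp add: inner_simps)
    then show ?thesis by (metis inner_eq_zero_iff)
  qed
  have M0: "0 \<in> ?M" by (simp add: cone_monoid_def dual_lattice_def)
  have Mpos: "0 \<le> m \<bullet> x" if "m \<in> ?M" "x \<in> ?S" for m x using that by (simp add: cone_monoid_def)
  have Madd: "m + m' \<in> ?M" if "m \<in> ?M" "m' \<in> ?M" for m m'
    using that by (auto simp: cone_monoid_def dual_lattice_def inner_simps)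
  \<comment> \<open>The monoid has no invertible elements except 0; this makes the indicator
    function of 0 multiplicative.\<close>
  have sharp: "m = 0 \<and> m' = 0" if "m \<in> ?M" "m' \<in> ?M" "m + m' = 0" for m m'
  proof -
    have "m \<bullet> x = 0 \<and> m' \<bullet> x = 0" if "x \<in> ?S" for x
    proof -
      have "m \<bullet> x + m' \<bullet> x = 0" using \<open>m + m' = 0\<close> by (metis inner_left_distrib inner_zero_left)
      then show ?thesis using Mpos[OF \<open>m \<in> ?M\<close> that] Mpos[OF \<open>m' \<in> ?M\<close> that] by linarith
    qed
    then show ?thesis using zero by blast
  qed
  define \<gamma> :: "real^2 \<Rightarrow> 'k" where "\<gamma> = restrict (\<lambda>m. if m = 0 then 1 else 0) ?M"
  have "torus_orbit N ?S = {(?S, \<gamma>)}"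
  proof (intro equalityI subsetI)
    fix z :: "cone \<times> (real^2 \<Rightarrow> 'k)" assume "z \<in> torus_orbit N ?S"
    then obtain \<delta> where z: "z = (?S, \<delta>)" and d: "\<delta> \<in> extensional ?M" "\<delta> 0 = 1"
        "\<And>m. m \<in> ?M \<Longrightarrow> \<delta> m \<noteq> 0 \<longleftrightarrow> (\<forall>x\<in>?S. m \<bullet> x = 0)"
      by (auto simp: torus_orbit_def)
    have "\<delta> m = \<gamma> m" for m
      using d zero[of m] by (cases "m \<in> ?M") (auto simp: \<gamma>_def extensional_def)
    then show "z \<in> {(?S, \<gamma>)}" using z by auto
  next
    fix z :: "cone \<times> (real^2 \<Rightarrow> 'k)" assume "z \<in> {(?S, \<gamma>)}"
    moreover have "\<gamma> (m + m') = \<gamma> m * \<gamma> m'" if "m \<in> ?M" "m' \<in> ?M" for m m'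
      using that Madd[OF that] sharp[OF that] by (auto simp: \<gamma>_def)
    moreover have "\<gamma> m \<noteq> 0 \<longleftrightarrow> (\<forall>x\<in>?S. m \<bullet> x = 0)" if "m \<in> ?M" for m
      using that zero[of m] by (auto simp: \<gamma>_def)
    moreover have "\<gamma> \<in> extensional ?M" "\<gamma> 0 = 1" using M0 by (simp_all add: \<gamma>_def)
    ultimately show "z \<in> torus_orbit N ?S" by (simp add: torus_orbit_def)
  qed
  then show ?thesis by simp
qed

lemma ray_face_of_fan_cone:
  assumes P: "tiling P" and g: "g \<in> fst ` P" and s: "\<sigma> \<in> fan_of P"
  shows "cone_face (ray g) \<sigma> \<longleftrightarrow> \<sigma> = ray g \<or> (\<exists>v. (g, v) \<in> P \<and> \<sigma> = sector g v) \<or> (\<exists>u. (u, g) \<in> P \<and> \<sigma> = sector u g)"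
proof -
  obtain g' where g': "(g, g') \<in> P" using g by auto
  note gN = tilingD(3-5)[OF P g']
  have g0: "g \<noteq> 0" using gN by auto
  have rg: "ray g \<noteq> {0}" using mem_self_ray[of g] g0 by auto
  have ns: "sector u v \<noteq> ray h" if "(u, v) \<in> P" for u v h
  proof
    assume eq: "sector u v = ray h"
    have "u \<in> ray h" "v \<in> ray h" unfolding eq[symmetric] by (rule mem_self_sector)+
    then show False using tilingD(5)[OF P that] by (auto simp: mem_convex_cone_hull_singleton)
  qed
  from P s show ?thesis
  proof (cases rule: fan_of_cases)
    case zero
    have "{0} \<noteq> sector u v" if "(u, v) \<in> P" for u v
    proof
      assume eq: "{0} = sector u v"
      have "u \<in> {0}" unfolding eq by (rule mem_self_sector)
      then show False using tilingD(5)[OF P that] by simp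
    qed
    then show ?thesis unfolding zero cone_face_zero using rg by blast
  next
    case (ray h)
    have "h \<noteq> 0" using tiling_generator[OF P ray(1)] by blast
    then show ?thesis unfolding ray(2) using ns rg cone_face_ray by blast
  next
    case (sector u v)
    have uv: "u \<in> N" "v \<in> N" "vol u v = 1" using tilingD(3-5)[OF P sector(1)] by blast+
    show ?thesis
    proof
      assume "cone_face (ray g) \<sigma>"
      then have "g = u \<or> g = v"
        using ray_face_of_sector[OF uv(3,1,2) gN(1,2)] gN(3) unfolding sector(2) by simp
      then show "\<sigma> = ray g \<or> (\<exists>v. (g, v) \<in> P \<and> \<sigma> = sector g v) \<or> (\<exists>u. (u, g) \<in> P \<and> \<sigma> = sector u g)"
        using sector by blast
    next
      assume "\<sigma> = ray g \<or> (\<exists>v. (g, v) \<in> P \<and> \<sigma> = sector g v) \<or> (\<exists>u. (u, g) \<in> P \<and> \<sigma> = sector u g)"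
      then show "cone_face (ray g) \<sigma>"
      proof (elim disjE exE conjE)
        assume "\<sigma> = ray g"
        then show ?thesis using ns[OF sector(1)] unfolding sector(2) by blast
      next
        fix w assume "(g, w) \<in> P" "\<sigma> = sector g w"
        then show ?thesis using cone_face_sector[OF tilingD(5)[OF P]] by blast
      next
        fix w assume "(w, g) \<in> P" "\<sigma> = sector w g"
        then show ?thesis using cone_face_sector[OF tilingD(5)[OF P]] by blast
      qed
    qed
  qed
qed

text \<open>Points carry their cone, so orbits of different cones are disjoint and the intersection
  consists of the orbits of those cones that have both rays as faces. The only candidate is the
  sector spanned by \<open>g\<close> and \<open>h\<close>, which contributes one fixed point; at
  most one order of the two is in \<open>P\<close> because \<open>vol\<close> is
  alternating.\<close>

lemma card_toric_curve_inter:
  assumes P: "tiling P" and gh: "g \<in> fst ` P" "h \<in> fst ` P" "g \<noteq> h"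
  shows "card (toric_curve N (fan_of P) (ray g) \<inter> toric_curve N (fan_of P) (ray h)
      :: (cone \<times> (real^2 \<Rightarrow> 'k::field)) set) = (if (g, h) \<in> P \<or> (h, g) \<in> P then 1 else 0)"
proof -
  let ?I = "toric_curve N (fan_of P) (ray g) \<inter> toric_curve N (fan_of P) (ray h)
      :: (cone \<times> (real^2 \<Rightarrow> 'k)) set"
  define S where "S = {\<sigma> \<in> fan_of P. cone_face (ray g) \<sigma> \<and> cone_face (ray h) \<sigma>}"
  have I: "?I = (\<Union>\<sigma>\<in>S. torus_orbit N \<sigma>)"
    by (auto simp: toric_curve_def S_def torus_orbit_def)
  have rgh: "ray g \<noteq> ray h" using tiling_ray_inject[OF P gh(1,2)] gh(3) by simp
  have nr: "sector u v \<noteq> ray k" if "(u, v) \<in> P" for u v k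
  proof
    assume eq: "sector u v = ray k"
    have "u \<in> ray k" "v \<in> ray k" unfolding eq[symmetric] by (rule mem_self_sector)+
    then show False using tilingD(5)[OF P that] by (auto simp: mem_convex_cone_hull_singleton)
  qed
  have inj: "u = c \<and> v = d" if "(u, v) \<in> P" "(c, d) \<in> P" "sector u v = sector c d" for u v c d
    using sector_inject tilingD(3-5)[OF P that(1)] tilingD(3-5)[OF P that(2)] that(3) by blast
  have mem: "\<sigma> \<in> S \<longleftrightarrow> (g, h) \<in> P \<and> \<sigma> = sector g h \<or> (h, g) \<in> P \<and> \<sigma> = sector h g" for \<sigma>
  proof
    assume "\<sigma> \<in> S"
    then have s: "\<sigma> \<in> fan_of P" "cone_face (ray g) \<sigma>" "cone_face (ray h) \<sigma>" by (auto simp: S_def)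
    note G = ray_face_of_fan_cone[OF P gh(1) s(1), THEN iffD1, OF s(2)]
    note H = ray_face_of_fan_cone[OF P gh(2) s(1), THEN iffD1, OF s(3)]
    have "\<sigma> \<noteq> ray g" using H rgh nr by metis
    moreover have "\<sigma> \<noteq> ray h" using G rgh nr by metis
    ultimately show "(g, h) \<in> P \<and> \<sigma> = sector g h \<or> (h, g) \<in> P \<and> \<sigma> = sector h g"
      using G H inj gh(3) by metis
  next
    assume a: "(g, h) \<in> P \<and> \<sigma> = sector g h \<or> (h, g) \<in> P \<and> \<sigma> = sector h g"
    then have s: "\<sigma> \<in> fan_of P" unfolding fan_of_def by force
    then show "\<sigma> \<in> S"
      using a ray_face_of_fan_cone[OF P gh(1) s] ray_face_of_fan_cone[OF P gh(2) s] by (auto simp: S_def)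
  qed
  have excl: "\<not> ((g, h) \<in> P \<and> (h, g) \<in> P)"
    using tilingD(5)[OF P, of g h] tilingD(5)[OF P, of h g] vol_commute[of g h] by auto
  consider "(g, h) \<in> P" | "(h, g) \<in> P" | "(g, h) \<notin> P" "(h, g) \<notin> P" by blast
  then show ?thesis
  proof cases
    case 1
    then have "S = {sector g h}" using mem excl by blast
    then show ?thesis using 1 unfolding I by (simp add: card_torus_orbit_sector tilingD(5)[OF P 1])
  next
    case 2
    then have "S = {sector h g}" using mem excl by blast
    then show ?thesis using 2 unfolding I by (simp add: card_torus_orbit_sector tilingD(5)[OF P 2])
  next
    case 3
    then have "S = {}" using mem by blast
    then show ?thesis using 3 unfolding I by simp
  qed
qed

section \<open>The explicit pairing of a tiling and its change under blow-up\<close>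

definition next_gen :: "((real^2) \<times> (real^2)) set \<Rightarrow> real^2 \<Rightarrow> real^2" where
  "next_gen P u = (THE v. (u, v) \<in> P)"

definition prev_gen :: "((real^2) \<times> (real^2)) set \<Rightarrow> real^2 \<Rightarrow> real^2" where
  "prev_gen P v = (THE u. (u, v) \<in> P)"

lemma next_gen_eq: "tiling P \<Longrightarrow> (u, v) \<in> P \<Longrightarrow> next_gen P u = v"
  unfolding next_gen_def by (rule the_equality) (use tiling_next_unique in blast)+

lemma prev_gen_eq: "tiling P \<Longrightarrow> (u, v) \<in> P \<Longrightarrow> prev_gen P v = u"
  unfolding prev_gen_def by (rule the_equality) (use tiling_prev_unique in blast)+

text \<open>The neighbours of a generator \<open>u\<close> add up to \<open>turn P u\<close> times \<open>u\<close>, and \<open>- turn P u\<close>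
  is the self-intersection number of the corresponding curve.\<close>

definition turn :: "((real^2) \<times> (real^2)) set \<Rightarrow> real^2 \<Rightarrow> rat" where
  "turn P u = of_int \<lfloor>vol (prev_gen P u) (next_gen P u)\<rfloor>"

text \<open>Neighbouring curves meet in one point, and \<open>- turn P u\<close> is the diagonal
  entry at \<open>u\<close>. Each neighbouring pair is listed once in \<open>P\<close>, so both
  \<open>e u * f v\<close> and \<open>e v * f u\<close> have to appear.\<close>

definition tiling_form ::
  "((real^2) \<times> (real^2)) set \<Rightarrow> (real^2 \<Rightarrow> rat) \<Rightarrow> (real^2 \<Rightarrow> rat) \<Rightarrow> rat" where
  "tiling_form P e f =
     (\<Sum>(u, v)\<in>P. e u * f v + e v * f u) - (\<Sum>u\<in>fst ` P. turn P u * e u * f u)"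

lemma floor_inner_of_int: "m \<in> dual_lattice N \<Longrightarrow> x \<in> N \<Longrightarrow> m \<bullet> x = of_int \<lfloor>m \<bullet> x\<rfloor>"
proof -
  assume "m \<in> dual_lattice N" "x \<in> N"
  then have "m \<bullet> x \<in> \<int>" unfolding dual_lattice_def by blast
  then show ?thesis by (auto elim: Ints_cases)
qed

text \<open>The functional \<open>m\<close> is applied to the relation
  \<open>p + n = vol p n *\<^sub>R u\<close> between the two neighbours of \<open>u\<close>. The
  floors only carry integers from the reals to the rationals.\<close>

lemma inner_neighbours:
  assumes P: "tiling P" and u: "u \<in> fst ` P" and m: "m \<in> dual_lattice N"
  shows "of_int \<lfloor>m \<bullet> prev_gen P u\<rfloor> + of_int \<lfloor>m \<bullet> next_gen P u\<rfloor> = turn P u * of_int \<lfloor>m \<bullet> u\<rfloor>"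
proof -
  obtain p where p: "(p, u) \<in> P" using tiling_prevE[OF P u] .
  obtain n where n: "(u, n) \<in> P" using u by auto
  note D = tilingD(3-5)[OF P p] tilingD(3-5)[OF P n]
  have "p + n = vol p n *\<^sub>R u"
    using D vol_commute[of u p] by (intro vol_eqI[OF D(6)]) simp_all
  then have "m \<bullet> p + m \<bullet> n = vol p n * (m \<bullet> u)" by (metis inner_add_right inner_scaleR_right)
  moreover have "vol p n = of_int \<lfloor>vol p n\<rfloor>" using vol_Ints[OF D(1,5)] by auto
  ultimately have "(of_int (\<lfloor>m \<bullet> p\<rfloor> + \<lfloor>m \<bullet> n\<rfloor>) :: real) = of_int (\<lfloor>vol p n\<rfloor> * \<lfloor>m \<bullet> u\<rfloor>)"
    using floor_inner_of_int[OF m] D by (metis of_int_add of_int_mult)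
  then have "\<lfloor>m \<bullet> p\<rfloor> + \<lfloor>m \<bullet> n\<rfloor> = \<lfloor>vol p n\<rfloor> * \<lfloor>m \<bullet> u\<rfloor>" by (simp only: of_int_eq_iff)
  then have "of_int \<lfloor>m \<bullet> p\<rfloor> + of_int \<lfloor>m \<bullet> n\<rfloor> = (of_int \<lfloor>vol p n\<rfloor> * of_int \<lfloor>m \<bullet> u\<rfloor> :: rat)"
    by (metis of_int_add of_int_mult)
  then show ?thesis
    by (simp add: turn_def next_gen_eq[OF P n] prev_gen_eq[OF P p])
qed

text \<open>Collecting the terms by \<open>f u\<close> leaves as coefficient the defect of
  \<open>e\<close> in the neighbour relation at \<open>u\<close>, which is zero when
  \<open>e\<close> comes from a character.\<close>

lemma tiling_form_neighbours:
  assumes P: "tiling P"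
  shows "tiling_form P e f = (\<Sum>u\<in>fst ` P. (e (prev_gen P u) + e (next_gen P u) - turn P u * e u) * f u)"
proof -
  have i1: "inj_on fst P" using tiling_next_unique[OF P] by (auto simp: inj_on_def)
  have i2: "inj_on snd P" using tiling_prev_unique[OF P] by (auto simp: inj_on_def)
  have "(\<Sum>(u, v)\<in>P. e v * f u) = (\<Sum>u\<in>fst ` P. e (next_gen P u) * f u)"
    unfolding sum.reindex[OF i1] by (rule sum.cong) (auto simp: next_gen_eq[OF P])
  moreover have "(\<Sum>(u, v)\<in>P. e u * f v) = (\<Sum>v\<in>snd ` P. e (prev_gen P v) * f v)"
    unfolding sum.reindex[OF i2] by (rule sum.cong) (auto simp: prev_gen_eq[OF P])
  ultimately have "(\<Sum>(u, v)\<in>P. e u * f v + e v * f u) =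
      (\<Sum>u\<in>fst ` P. e (prev_gen P u) * f u) + (\<Sum>u\<in>fst ` P. e (next_gen P u) * f u)"
    using tilingD(2)[OF P] by (simp add: case_prod_unfold sum.distrib)
  then show ?thesis
    by (simp add: tiling_form_def algebra_simps sum.distrib sum_subtractf)
qed

lemma tiling_form_cong:
  assumes P: "tiling P" and "\<And>u. u \<in> fst ` P \<Longrightarrow> e u = e' u" "\<And>u. u \<in> fst ` P \<Longrightarrow> f u = f' u"
  shows "tiling_form P e f = tiling_form P e' f'"
proof -
  have "(\<Sum>(u, v)\<in>P. e u * f v + e v * f u) = (\<Sum>(u, v)\<in>P. e' u * f' v + e' v * f' u)"
    using assms(2,3) tilingD(7,8)[OF P] by (intro sum.cong) auto
  moreover have "(\<Sum>u\<in>fst ` P. turn P u * e u * f u) = (\<Sum>u\<in>fst ` P. turn P u * e' u * f' u)"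
    using assms(2,3) by (intro sum.cong) auto
  ultimately show ?thesis by (simp add: tiling_form_def)
qed

lemma tiling_form_deltas:
  assumes P: "tiling P" and gh: "g \<in> fst ` P" "h \<in> fst ` P" "g \<noteq> h"
  shows "tiling_form P (\<lambda>u. if u = g then 1 else 0) (\<lambda>u. if u = h then 1 else 0) =
    (if (g, h) \<in> P \<or> (h, g) \<in> P then 1 else 0)"
proof -
  let ?e = "\<lambda>u. if u = g then 1 else 0 :: rat" and ?f = "\<lambda>u. if u = h then 1 else 0 :: rat"
  have "(\<Sum>(u, v)\<in>P. ?e u * ?f v + ?e v * ?f u) =
      (\<Sum>z\<in>P. (if z = (g, h) then 1 else 0) + (if z = (h, g) then 1 else 0))"
  proof (rule sum.cong[OF refl], clarify)
    fix u v
    show "?e u * ?f v + ?e v * ?f u =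
        (if (u, v) = (g, h) then 1 else 0) + (if (u, v) = (h, g) then 1 else 0)"
      by (cases "u = g"; cases "v = h"; cases "v = g"; cases "u = h") simp_all
  qed
  also have "\<dots> = (if (g, h) \<in> P then 1 else 0) + (if (h, g) \<in> P then 1 else 0)"
    using tilingD(1)[OF P] by (simp add: sum.distrib)
  also have "\<dots> = (if (g, h) \<in> P \<or> (h, g) \<in> P then 1 else 0)"
    using tilingD(5)[OF P, of g h] tilingD(5)[OF P, of h g] vol_commute[of g h] by auto
  finally have "(\<Sum>(u, v)\<in>P. ?e u * ?f v + ?e v * ?f u) = \<dots>" .
  moreover have "(\<Sum>u\<in>fst ` P. turn P u * ?e u * ?f u) = 0"
    using gh by (intro sum.neutral) auto
  ultimately show ?thesis by (simp add: tiling_form_def)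
qed

lemma intersection_pairing_tiling_form:
  assumes P: "tiling P"
  shows "intersection_pairing K N (fan_of P) (\<lambda>E F. tiling_form P (\<lambda>u. E (ray u)) (\<lambda>u. F (ray u)))"
    (is "intersection_pairing K N ?\<Sigma> ?B")
  unfolding intersection_pairing_def
proof (intro conjI ballI allI impI)
  fix E F
  show "?B E F = ?B F E"
    unfolding tiling_form_def by (simp add: algebra_simps)
  show "?B (\<lambda>\<tau>. E \<tau> + E' \<tau>) F = ?B E F + ?B E' F" for E'
    unfolding tiling_form_neighbours[OF P] sum.distrib[symmetric]
    by (rule sum.cong) (simp_all add: algebra_simps)
  show "?B (\<lambda>\<tau>. c * E \<tau>) F = c * ?B E F" for c
    unfolding tiling_form_neighbours[OF P] sum_distrib_left
    by (rule sum.cong) (simp_all add: algebra_simps)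
next
  fix m F assume m: "m \<in> dual_lattice N"
  have char: "character_divisor N ?\<Sigma> m (ray u) = of_int \<lfloor>m \<bullet> u\<rfloor>" if "u \<in> fst ` P" for u
    using that rays_fan_of[OF P] tiling_ray_generator[OF P that]
    by (auto simp: character_divisor_def)
  have "?B (character_divisor N ?\<Sigma> m) F = tiling_form P (\<lambda>u. of_int \<lfloor>m \<bullet> u\<rfloor>) (\<lambda>u. F (ray u))"
    using char by (intro tiling_form_cong[OF P]) auto
  also have "\<dots> = 0"
    unfolding tiling_form_neighbours[OF P] using inner_neighbours[OF P _ m]
    by (intro sum.neutral) auto
  finally show "?B (character_divisor N ?\<Sigma> m) F = 0" .
next
  fix \<tau> \<rho> assume \<tau>\<rho>: "\<tau> \<in> rays ?\<Sigma>" "\<rho> \<in> rays ?\<Sigma>" "\<tau> \<noteq> \<rho>"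
  have "\<tau> \<in> ray ` fst ` P" "\<rho> \<in> ray ` fst ` P"
    using \<tau>\<rho>(1,2) by (simp_all only: rays_fan_of[OF P])
  then have "\<exists>g. \<tau> = ray g \<and> g \<in> fst ` P" "\<exists>h. \<rho> = ray h \<and> h \<in> fst ` P"
    unfolding image_iff[of _ _ "fst ` P"] by auto
  then obtain g h where g: "\<tau> = ray g" "g \<in> fst ` P" and h: "\<rho> = ray h" "h \<in> fst ` P"
    by (elim exE conjE)
  have "g \<noteq> h" using \<tau>\<rho>(3) unfolding g(1) h(1) by (rule contrapos_nn) (rule arg_cong)
  note gh = g(2) h(2) g(1) h(1) this
  have "?B (prime_divisor \<tau>) (prime_divisor \<rho>) =
      tiling_form P (\<lambda>u. if u = g then 1 else 0) (\<lambda>u. if u = h then 1 else 0)"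
    unfolding gh(3,4) prime_divisor_def
    by (intro tiling_form_cong[OF P]) (simp_all only: tiling_ray_inject[OF P] gh(1,2))
  also have "\<dots> = of_nat (card (toric_curve N ?\<Sigma> \<tau> \<inter> toric_curve N ?\<Sigma> \<rho>
      :: (cone \<times> (real^2 \<Rightarrow> 'a)) set))"
    using tiling_form_deltas[OF P gh(1,2,5)] card_toric_curve_inter[OF P gh(1,2,5), where 'k = 'a]
    by (simp add: gh(3,4))
  finally show "?B (prime_divisor \<tau>) (prime_divisor \<rho>) =
      of_nat (card (toric_curve N ?\<Sigma> \<tau> \<inter> toric_curve N ?\<Sigma> \<rho> :: (cone \<times> (real^2 \<Rightarrow> 'a)) set))" .
qed

text \<open>The explicit form gives existence, and together with uniqueness it makes the definite
  description meaningful.\<close>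

lemma intersection_number_eq:
  assumes P: "tiling P" and E: "E \<in> toric_divisors (fan_of P)" and F: "F \<in> toric_divisors (fan_of P)"
  shows "intersection_number K N (fan_of P) E F = tiling_form P (\<lambda>u. E (ray u)) (\<lambda>u. F (ray u))"
  unfolding intersection_number_def
proof (rule the_equality)
  show "\<exists>B. intersection_pairing K N (fan_of P) B \<and>
      tiling_form P (\<lambda>u. E (ray u)) (\<lambda>u. F (ray u)) = B E F"
    using intersection_pairing_tiling_form[OF P]
    by (intro exI[of _ "\<lambda>E F. tiling_form P (\<lambda>u. E (ray u)) (\<lambda>u. F (ray u))"]) simp
  fix q assume "\<exists>B. intersection_pairing K N (fan_of P) B \<and> q = B E F"
  then show "q = tiling_form P (\<lambda>u. E (ray u)) (\<lambda>u. F (ray u))"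
    using intersection_pairing_unique[OF P _ intersection_pairing_tiling_form[OF P] E F] by blast
qed

text \<open>Only \<open>u\<close> and \<open>v\<close> get a new neighbour, and for the predecessor
  \<open>p\<close> of \<open>u\<close> one has \<open>vol p (u + v) = vol p v + 1\<close>: a curve
  through the blown-up point loses 1 in self-intersection.\<close>

lemma turn_star:
  assumes P: "tiling P" and uv: "(u, v) \<in> P" and g: "g \<in> fst ` P"
  shows "turn (star P u v) g = turn P g + (if g = u then 1 else 0) + (if g = v then 1 else 0)"
proof -
  let ?Q = "star P u v" and ?w = "u + v"
  have Q: "tiling ?Q" using tiling_star[OF P uv] .
  obtain p where p: "(p, g) \<in> P" using tiling_prevE[OF P g] .
  obtain n where n: "(g, n) \<in> P" using g by auto
  have ne: "u \<noteq> v" using tilingD(5)[OF P uv] by auto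
  have np: "next_gen P g = n" "prev_gen P g = p" using next_gen_eq[OF P n] prev_gen_eq[OF P p] .
  consider "g = u" | "g = v" | "g \<noteq> u" "g \<noteq> v" by blast
  then show ?thesis
  proof cases
    case 1
    then have nv: "n = v" using n uv tiling_next_unique[OF P] by blast
    have "(p, g) \<in> ?Q" "(g, ?w) \<in> ?Q" using p 1 ne by (auto simp: star_def)
    then have "next_gen ?Q g = ?w" "prev_gen ?Q g = p" using next_gen_eq[OF Q] prev_gen_eq[OF Q] by blast+
    moreover have "vol p ?w = vol p n + 1" using tilingD(5)[OF P p] 1 nv by simp
    ultimately show ?thesis using 1 ne np by (simp add: turn_def)
  next
    case 2
    then have pu: "p = u" using p uv tiling_prev_unique[OF P] by blast
    have "(g, n) \<in> ?Q" "(?w, g) \<in> ?Q" using n 2 ne by (auto simp: star_def)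
    then have "next_gen ?Q g = n" "prev_gen ?Q g = ?w" using next_gen_eq[OF Q] prev_gen_eq[OF Q] by blast+
    moreover have "vol ?w n = vol p n + 1" using tilingD(5)[OF P n] 2 pu by simp
    ultimately show ?thesis using 2 ne np by (simp add: turn_def)
  next
    case 3
    then have "(g, n) \<in> ?Q" "(p, g) \<in> ?Q" using n p by (auto simp: star_def)
    then have "next_gen ?Q g = n" "prev_gen ?Q g = p" using next_gen_eq[OF Q] prev_gen_eq[OF Q] by blast+
    then show ?thesis using 3 np by (simp add: turn_def)
  qed
qed

text \<open>The exceptional curve has self-intersection -1.\<close>

lemma turn_star_new:
  assumes P: "tiling P" and uv: "(u, v) \<in> P"
  shows "turn (star P u v) (u + v) = 1"
proof -
  let ?Q = "star P u v"
  have Q: "tiling ?Q" using tiling_star[OF P uv] .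
  have "(u, u + v) \<in> ?Q" "(u + v, v) \<in> ?Q" by (auto simp: star_def)
  then show ?thesis
    using next_gen_eq[OF Q] prev_gen_eq[OF Q] tilingD(5)[OF P uv] by (simp add: turn_def)
qed

text \<open>Put \<open>w = u + v\<close>. The lost pair takes away \<open>2 * f u * f v\<close>, the
  two new pairs add \<open>2 * f w * (f u + f v)\<close>, and the new values of \<open>turn\<close>
  subtract the squares of \<open>f u\<close>, \<open>f v\<close> and \<open>f w\<close>. Together
  this is minus the square of \<open>f w - f u - f v\<close>.\<close>

lemma tiling_form_star:
  assumes P: "tiling P" and uv: "(u, v) \<in> P"
  shows "tiling_form (star P u v) f f = tiling_form P f f - (f (u + v) - f u - f v)\<^sup>2"
proof -
  let ?Q = "star P u v" and ?w = "u + v"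
  let ?h = "\<lambda>(u, v). f u * f v + f v * f u"
  note D = tilingD[OF P]
  have wn: "?w \<notin> fst ` P" using sum_not_generator[OF P uv] .
  have ne: "u \<noteq> v" using D(5)[OF uv] by auto
  have uvf: "u \<in> fst ` P" "v \<in> fst ` P" using D(7,8)[OF uv] .
  have new: "(u, ?w) \<notin> P" "(?w, v) \<notin> P" "(u, ?w) \<noteq> (?w, v)"
    using wn D(7,8) uvf by (blast, blast, auto)
  have "sum ?h ?Q = sum ?h (P - {(u, v)}) + sum ?h {(u, ?w), (?w, v)}"
    unfolding star_def using new D(1) by (intro sum.union_disjoint) auto
  also have "\<dots> = sum ?h P - ?h (u, v) + ?h (u, ?w) + ?h (?w, v)"
    using new(3) D(1) uv by (simp add: sum_diff1)
  finally have pairs: "sum ?h ?Q = sum ?h P - 2 * f u * f v + 2 * f ?w * (f u + f v)"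
    by (simp add: algebra_simps)
  have "(\<Sum>g\<in>fst ` ?Q. turn ?Q g * f g * f g) =
      f ?w * f ?w + (\<Sum>g\<in>fst ` P. turn ?Q g * f g * f g)"
    unfolding fst_star[OF uv] using wn D(1) turn_star_new[OF P uv] by simp
  also have "(\<Sum>g\<in>fst ` P. turn ?Q g * f g * f g) = (\<Sum>g\<in>fst ` P. turn P g * f g * f g +
      ((if g = u then f g * f g else 0) + (if g = v then f g * f g else 0)))"
    by (rule sum.cong) (auto simp: turn_star[OF P uv] algebra_simps)
  also have "\<dots> = (\<Sum>g\<in>fst ` P. turn P g * f g * f g) + (f u * f u + f v * f v)"
    using uvf D(1) by (simp add: sum.distrib)
  finally have "(\<Sum>g\<in>fst ` ?Q. turn ?Q g * f g * f g) =
      (\<Sum>g\<in>fst ` P. turn P g * f g * f g) + (f u * f u + f v * f v + f ?w * f ?w)" by simp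
  with pairs show ?thesis
    by (simp add: tiling_form_def power2_eq_square algebra_simps)
qed

end

section \<open>The degree along refinements\<close>

text \<open>The determinant condition says that \<open>q\<close>, \<open>- p\<close> are also Bezout
  coefficients of \<open>p + p'\<close> and \<open>q + q'\<close>. Two such pairs differ in the
  second entry by a multiple of \<open>p + p'\<close>, and the prescribed range admits one value
  only.\<close>

lemma bezout_splitting_unique:
  fixes p q p' q' :: int
  assumes nn: "0 \<le> p" "0 \<le> q" "0 \<le> p'" "0 \<le> q'" and det: "q * p' - p * q' = 1"
    and cop: "coprime (p + p') (q + q')" and xy: "x * (p + p') + y * (q + q') = 1"
    and y: "0 \<le> - y" "- y < p + p'"
  shows "y = - p" "x = q"
proof -
  \<comment> \<open>With \<open>p' = 0\<close> the determinant would be \<open>- p * q'\<close>,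
    which is at most 0; so \<open>p\<close> itself obeys the strict upper bound of the
    range.\<close>
  have "p' \<noteq> 0"
  proof
    assume "p' = 0"
    then have "p * q' = - 1" using det by simp
    then show False using nn by (metis mult_nonneg_nonneg not_one_le_zero neg_0_le_iff_le)
  qed
  then have p: "p < p + p'" using nn by simp
  have e: "(q - x) * (p + p') = (p + y) * (q + q')" using det xy by (simp add: algebra_simps)
  then have "p + p' dvd (p + y) * (q + q')" by (metis dvd_triv_right)
  then have d: "p + p' dvd p + y" using cop by (simp add: coprime_dvd_mult_left_iff)
  have "\<bar>p + y\<bar> < p + p'" using p y nn by linarith
  then have "p + y = 0" using d by (meson zdvd_imp_le zero_less_abs_iff abs_dvd_iff dvd_abs_iff not_less)
  then show "y = - p" by simp
  then show "x = q" using e p nn by simp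
qed

section \<open>The canonical splitting inside a refinement\<close>

context planar_lattice
begin

text \<open>The order of \<open>e1\<close>, \<open>e2\<close> is not prescribed, which accounts for
  the two alternatives: for \<open>vol e1 e2 = 1\<close> the splitting is \<open>v\<close>,
  \<open>u\<close>, and for the value -1 it is \<open>u\<close>, \<open>v\<close>. In the
  coordinates of \<open>e1\<close>, \<open>e2\<close> the equation \<open>vol u v = 1\<close>
  becomes, up to this sign, the determinant hypothesis of
  \<open>bezout_splitting_unique\<close>.\<close>

lemma canonical_splitting_imp:
  assumes P: "tiling P" and Q: "tiling Q" and sub: "fst ` P \<subseteq> fst ` Q"
    and uv: "(u, v) \<in> Q" and split: "canonical_splitting N (fan_of P) (u + v) a b"
  shows "a = u \<and> b = v \<or> a = v \<and> b = u"
proof -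
  obtain e1 e2 and v1 v2 x y :: int where e: "lattice_basis N e1 e2" "sector e1 e2 \<in> fan_of P"
    and w: "u + v = of_int v1 *\<^sub>R e1 + of_int v2 *\<^sub>R e2" "v1 \<ge> 1" "v2 \<ge> 1" "coprime v1 v2"
    and xy: "x * v1 + y * v2 = 1" "0 \<le> - y" "- y < v1"
    and a: "a = of_int (- y) *\<^sub>R e1 + of_int x *\<^sub>R e2"
    and b: "b = of_int (v1 + y) *\<^sub>R e1 + of_int (v2 - x) *\<^sub>R e2"
    using split unfolding canonical_splitting_def by blast
  define s where "s = vol e1 e2"
  have s: "s = 1 \<or> s = -1" using e(1) by (auto simp: lattice_basis_iff s_def)
  have comb: "vol (c1 *\<^sub>R e1 + c2 *\<^sub>R e2) (d1 *\<^sub>R e1 + d2 *\<^sub>R e2) = (c1 * d2 - c2 * d1) * s" for c1 c2 d1 d2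
    using vol_commute[of e1 e2] by (simp add: s_def algebra_simps)
  have coords: "c1 = d1 \<and> c2 = d2" if "c1 *\<^sub>R e1 + c2 *\<^sub>R e2 = d1 *\<^sub>R e1 + d2 *\<^sub>R e2" for c1 c2 d1 d2
    using arg_cong[OF that, of "\<lambda>x. vol x e2"] arg_cong[OF that, of "vol e1"] s
    by (auto simp: s_def)
  have "sector u v \<in> fan_of Q" using uv unfolding fan_of_def by force
  then obtain \<sigma> where \<sigma>: "\<sigma> \<in> fan_of P" "sector u v \<subseteq> \<sigma>"
    using generators_imp_subdivides[OF P Q sub] unfolding subdivides_def by blast
  have uv\<sigma>: "u \<in> \<sigma>" "v \<in> \<sigma>" using \<sigma>(2) mem_self_sector by blast+
  have cc: "convex_cone \<sigma>" using convex_cone_fan_of[OF P \<sigma>(1)] .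
  have "u + v \<in> sector e1 e2"
    unfolding mem_convex_cone_hull_pair using w
    by (intro exI[of _ "of_int v1"] conjI exI[of _ "of_int v2"]) auto
  then have "u + v \<in> \<sigma> \<inter> sector e1 e2" using convex_cone_add[OF cc uv\<sigma>] by blast
  \<comment> \<open>The intersection is a face of \<open>\<sigma>\<close> containing
    \<open>u + v\<close>, hence both summands: this puts \<open>u\<close> and \<open>v\<close> into
    the sector that contains their sum.\<close>
  moreover have "cone_face (\<sigma> \<inter> sector e1 e2) \<sigma>" using fan_of_inter_face[OF P \<sigma>(1) e(2)] .
  ultimately have mem: "u \<in> sector e1 e2" "v \<in> sector e1 e2"
    using uv\<sigma> by (auto simp: cone_face_iff[OF cc])
  have int_coords: "\<exists>p q::int. 0 \<le> p \<and> 0 \<le> q \<and> z = of_int p *\<^sub>R e1 + of_int q *\<^sub>R e2"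
    if z: "z \<in> N" "z \<in> sector e1 e2" for z
  proof -
    obtain p q :: int where pq: "z = of_int p *\<^sub>R e1 + of_int q *\<^sub>R e2"
      using z(1) e(1) unfolding lattice_basis_def by blast
    obtain c d where "0 \<le> c" "0 \<le> d" "z = c *\<^sub>R e1 + d *\<^sub>R e2"
      using z(2) unfolding mem_convex_cone_hull_pair by blast
    then have "0 \<le> (of_int p :: real)" "0 \<le> (of_int q :: real)"
      using coords pq by metis+
    then show ?thesis using pq by auto
  qed
  have D: "u \<in> N" "v \<in> N" "vol u v = 1" using tilingD(3-5)[OF Q uv] by blast+
  obtain p q :: int where pq: "0 \<le> p" "0 \<le> q" "u = of_int p *\<^sub>R e1 + of_int q *\<^sub>R e2"
    using int_coords[OF D(1) mem(1)] by blast
  obtain p' q' :: int where pq': "0 \<le> p'" "0 \<le> q'" "v = of_int p' *\<^sub>R e1 + of_int q' *\<^sub>R e2"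
    using int_coords[OF D(2) mem(2)] by blast
  have "u + v = (of_int (p + p')) *\<^sub>R e1 + (of_int (q + q')) *\<^sub>R e2"
    using pq pq' by (simp add: algebra_simps)
  then have "(of_int v1 :: real) = of_int (p + p')" "(of_int v2 :: real) = of_int (q + q')"
    using coords w(1) by metis+
  then have sums: "v1 = p + p'" "v2 = q + q'" by (simp_all only: of_int_eq_iff)
  have det: "(of_int p * of_int q' - of_int q * of_int p') * s = 1"
    using D(3) comb unfolding pq(3) pq'(3) by simp
  from s show ?thesis
  proof
    assume "s = 1"
    then have "(of_int (q' * p - p' * q) :: real) = 1" using det by (simp add: algebra_simps)
    then have "q' * p - p' * q = 1" by linarith
    from bezout_splitting_unique[OF pq'(1,2) pq(1,2) this, of x y]
    have "y = - p'" "x = q'" using w(4) xy unfolding sums by (simp_all add: add.commute)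
    then show ?thesis using a b sums pq pq' by simp
  next
    assume "s = -1"
    then have "(of_int (q * p' - p * q') :: real) = 1" using det by (simp add: algebra_simps)
    then have "q * p' - p * q' = 1" by linarith
    from bezout_splitting_unique[OF pq(1,2) pq'(1,2) this, of x y]
    have "y = - p" "x = q" using w(4) xy unfolding sums by simp_all
    then show ?thesis using a b sums pq pq' by simp
  qed
qed

lemma canonical_splitting_exists:
  assumes P: "tiling P" and Q: "tiling Q" and sub: "fst ` P \<subseteq> fst ` Q" and uv: "(u, v) \<in> Q"
  shows "\<exists>a b. canonical_splitting N (fan_of P) (u + v) a b"
proof -
  have D: "u \<in> N" "v \<in> N" "vol u v = 1" using tilingD(3-5)[OF Q uv] by blast+
  have wo: "u + v \<in> open_sector u v" using sum_mem_open_sector[OF D(3)] .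
  then have w0: "u + v \<noteq> 0" by (metis mem_open_sector order_less_irrefl vol_zero_left)
  from P w0 show ?thesis
  proof (cases rule: tiling_cases)
    case (ray g)
    then have "g \<in> open_sector u v" using ray_mem_open_sector_iff wo w0 by blast
    then show ?thesis using tilingD(6)[OF Q _ uv] ray sub by blast
  next
    case (sector c d)
    have cd: "c \<in> N" "d \<in> N" "vol c d = 1" using tilingD(3-5)[OF P sector(1)] by blast+
    have "c \<notin> open_sector u v" "d \<notin> open_sector u v"
      using tilingD(6)[OF Q _ uv] tilingD(7,8)[OF P sector(1)] sub by blast+
    from sector_nested[OF D(3) cd(3) wo sector(2) this]
    have mem: "u \<in> sector c d" "v \<in> sector c d" by blast+
    obtain p q p' q' :: int where e: "vol u d = of_int p" "vol c u = of_int q"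
        "vol v d = of_int p'" "vol c v = of_int q'"
      using vol_int D cd by metis
    have nn: "0 \<le> p" "0 \<le> q" "0 \<le> p'" "0 \<le> q'"
      using mem e by (auto simp: mem_sector[OF cd(3)])
    have u: "u = of_int p *\<^sub>R c + of_int q *\<^sub>R d" and v: "v = of_int p' *\<^sub>R c + of_int q' *\<^sub>R d"
      using unimodular_coords[OF cd(3)] e by metis+
    have "(of_int (p * q' - q * p') :: real) = 1"
      using vol_expand[OF cd(3), of u v] e D(3) by simp
    then have det: "p * q' - q * p' = 1" by linarith
    have pos: "p \<ge> 1" "q' \<ge> 1"
    proof -
      have "p * q' \<ge> 1" using det nn mult_nonneg_nonneg[of q p'] by linarith
      then show "p \<ge> 1" "q' \<ge> 1" using nn by (auto simp: int_one_le_iff_zero_less zero_less_mult_iff)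
    qed
    have bez: "q' * (p + p') + (- p') * (q + q') = 1" using det by (simp add: algebra_simps)
    have cop: "coprime (p + p') (q + q')"
    proof (rule coprimeI)
      fix r assume "r dvd p + p'" "r dvd q + q'"
      then have "r dvd q' * (p + p') + (- p') * (q + q')" by (intro dvd_add[OF dvd_mult dvd_mult])
      then show "is_unit r" using bez by simp
    qed
    \<comment> \<open>In positively oriented coordinates the Bezout pair within the range is
      \<open>q'\<close>, \<open>- p'\<close>, so \<open>v\<close> comes first.\<close>
    have "canonical_splitting N (fan_of P) (u + v) v u"
      unfolding canonical_splitting_def
    proof (intro exI conjI)
      show "lattice_basis N c d" using cd by (simp add: lattice_basis_iff)
      show "sector c d \<in> fan_of P" using sector unfolding fan_of_def by force
      show "u + v = of_int (p + p') *\<^sub>R c + of_int (q + q') *\<^sub>R d"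
        using u v by (simp add: algebra_simps)
      show "p + p' \<ge> 1" "q + q' \<ge> 1" using pos nn by auto
      show "coprime (p + p') (q + q')" by (rule cop)
      show "q' * (p + p') + (- p') * (q + q') = 1" by (rule bez)
      show "0 \<le> - (- p')" "- (- p') < p + p'" using nn pos by simp_all
      show "v = of_int (- (- p')) *\<^sub>R c + of_int q' *\<^sub>R d" using v by simp
      show "u = of_int (p + p' + - p') *\<^sub>R c + of_int (q + q' - q') *\<^sub>R d" using u by simp
    qed
    then show ?thesis by blast
  qed
qed

lemma mu_generator:
  assumes P: "tiling P" and g: "g \<in> fst ` P"
  shows "mu N (fan_of P) \<phi> g = 0"
  using rays_fan_of[OF P] g by (simp add: mu_def)

text \<open>\<open>SOME\<close> may return either order of the two neighbours, but only the
  symmetric expression \<open>\<phi> a + \<phi> b\<close> enters.\<close>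

lemma mu_sum:
  assumes P: "tiling P" and Q: "tiling Q" and sub: "fst ` P \<subseteq> fst ` Q" and uv: "(u, v) \<in> Q"
  shows "mu N (fan_of P) \<phi> (u + v) = \<phi> (u + v) - \<phi> u - \<phi> v"
proof -
  have D: "u \<in> N" "v \<in> N" "vol u v = 1" using tilingD(3-5)[OF Q uv] by blast+
  have nr: "ray (u + v) \<notin> rays (fan_of P)"
  proof
    assume "ray (u + v) \<in> rays (fan_of P)"
    then have "ray (u + v) \<in> ray ` fst ` P" using rays_fan_of[OF P] by simp
    then obtain g where g: "g \<in> fst ` P" "ray (u + v) = ray g" by blast
    then obtain g' where g': "(g, g') \<in> P" by auto
    have "u + v \<in> ray g" using mem_self_ray[of "u + v"] unfolding g(2) .
    then have "u + v = g"
      by (intro ray_unique[of _ g v g'])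
        (use D lattice_add tilingD(3-5)[OF P g'] in auto)
    then show False using sum_not_generator[OF Q uv] g(1) sub by blast
  qed
  define z where "z = (SOME (a, b). canonical_splitting N (fan_of P) (u + v) a b)"
  have "\<exists>z. case z of (a, b) \<Rightarrow> canonical_splitting N (fan_of P) (u + v) a b"
    using canonical_splitting_exists[OF assms] by auto
  from someI_ex[OF this] have "case z of (a, b) \<Rightarrow> canonical_splitting N (fan_of P) (u + v) a b"
    by (simp add: z_def)
  then have "canonical_splitting N (fan_of P) (u + v) (fst z) (snd z)"
    by (simp add: case_prod_unfold)
  from canonical_splitting_imp[OF assms this]
  have "\<phi> (fst z) + \<phi> (snd z) = \<phi> u + \<phi> v" by auto
  moreover have "mu N (fan_of P) \<phi> (u + v) = \<phi> (u + v) - \<phi> (fst z) - \<phi> (snd z)"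
    using nr unfolding mu_def z_def[symmetric] by (simp add: case_prod_unfold)
  ultimately show ?thesis by simp
qed

text \<open>\<mu> is taken with respect to the fixed tiling \<open>P\<close>, although each blow-up
  happens in an intermediate tiling; \<open>mu_sum\<close> applies since its \<open>u\<close> and
  \<open>v\<close> are neighbours in an arbitrary refinement of \<open>P\<close>.\<close>

lemma tiling_form_refinement:
  assumes P: "tiling P" and Q: "tiling Q" and sub: "fst ` P \<subseteq> fst ` Q"
  shows "tiling_form Q \<phi> \<phi> = tiling_form P \<phi> \<phi> - (\<Sum>v\<in>fst ` Q. (mu N (fan_of P) \<phi> v)\<^sup>2)"
proof -
  let ?\<mu> = "mu N (fan_of P) \<phi>"
  \<comment> \<open>Containment of the generators of \<open>P\<close> is part of the predicate
    because the induction does not keep track of \<open>P\<close>.\<close>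
  let ?C = "\<lambda>R. fst ` P \<subseteq> fst ` R \<longrightarrow>
      tiling_form Q \<phi> \<phi> = tiling_form R \<phi> \<phi> - (\<Sum>v\<in>fst ` Q - fst ` R. (?\<mu> v)\<^sup>2)"
  have "?C P"
  proof (rule refinement_induct[OF P Q sub, where R = ?C])
    show "?C Q" by simp
  next
    fix R u v
    assume R: "tiling R" and uv: "(u, v) \<in> R" and w: "u + v \<in> fst ` Q" and IH: "?C (star R u v)"
    show "?C R"
    proof
      assume PR: "fst ` P \<subseteq> fst ` R"
      let ?w = "u + v" and ?S = "star R u v"
      have f: "fst ` ?S = insert ?w (fst ` R)" using fst_star[OF uv] .
      have wn: "?w \<in> fst ` Q - fst ` R" using w sum_not_generator[OF R uv] by blast
      have fin: "finite (fst ` Q - fst ` R)" using tilingD(1)[OF Q] by simp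
      have "tiling_form Q \<phi> \<phi> = tiling_form ?S \<phi> \<phi> - (\<Sum>v\<in>fst ` Q - fst ` ?S. (?\<mu> v)\<^sup>2)"
      proof (rule mp[OF IH])
        show "fst ` P \<subseteq> fst ` ?S" unfolding f using PR by (rule subset_insertI2)
      qed
      also have "fst ` Q - fst ` ?S = (fst ` Q - fst ` R) - {?w}" unfolding f by blast
      also have "tiling_form ?S \<phi> \<phi> = tiling_form R \<phi> \<phi> - (?\<mu> ?w)\<^sup>2"
        using tiling_form_star[OF R uv] mu_sum[OF P R PR uv] by simp
      finally show "tiling_form Q \<phi> \<phi> = tiling_form R \<phi> \<phi> - (\<Sum>v\<in>fst ` Q - fst ` R. (?\<mu> v)\<^sup>2)"
        using sum.remove[OF fin wn, of "\<lambda>v. (?\<mu> v)\<^sup>2"] by simp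
    qed
  qed
  \<comment> \<open>Old generators may be added to the sum, as \<mu> is 0 on them.\<close>
  moreover have "(\<Sum>v\<in>fst ` Q - fst ` P. (?\<mu> v)\<^sup>2) = (\<Sum>v\<in>fst ` Q. (?\<mu> v)\<^sup>2)"
    by (rule sum.mono_neutral_left) (use tilingD(1)[OF Q] mu_generator[OF P] in auto)
  ultimately show ?thesis by simp
qed

section \<open>The net of subdivisions and its limit\<close>

lemma mem_smooth_subdivisions:
  assumes P: "tiling P"
  shows "\<Sigma>' \<in> smooth_subdivisions N (fan_of P) \<longleftrightarrow>
    (\<exists>Q. tiling Q \<and> fst ` P \<subseteq> fst ` Q \<and> \<Sigma>' = fan_of Q)"
proof
  assume "\<Sigma>' \<in> smooth_subdivisions N (fan_of P)"
  then have s: "smooth_fan N \<Sigma>'" "subdivides \<Sigma>' (fan_of P)" by (auto simp: smooth_subdivisions_def)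
  then have c: "complete_fan \<Sigma>'"
    using complete_fan_fan_of[OF P] by (simp add: subdivides_def complete_fan_def)
  have "fan_of (pairs_of \<Sigma>') = \<Sigma>'" "tiling (pairs_of \<Sigma>')"
    using fan_of_pairs_of[OF s(1) c] tiling_pairs_of[OF s(1) c] .
  then show "\<exists>Q. tiling Q \<and> fst ` P \<subseteq> fst ` Q \<and> \<Sigma>' = fan_of Q"
    using s(2) subdivides_imp_generators[OF P] by metis
next
  assume "\<exists>Q. tiling Q \<and> fst ` P \<subseteq> fst ` Q \<and> \<Sigma>' = fan_of Q"
  then show "\<Sigma>' \<in> smooth_subdivisions N (fan_of P)"
    using smooth_fan_fan_of generators_imp_subdivides[OF P] by (auto simp: smooth_subdivisions_def)
qed

text \<open>The tails form a filter base because two subdivisions have a common refinement, obtained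
  by inserting the generators of one into the other. The infimum of principal filters can then be
  tested on a single tail.\<close>

lemma eventually_subdivision_filter:
  assumes P: "tiling P"
  shows "eventually p (subdivision_filter N (fan_of P)) \<longleftrightarrow>
    (\<exists>Q. tiling Q \<and> fst ` P \<subseteq> fst ` Q \<and> (\<forall>R. tiling R \<longrightarrow> fst ` Q \<subseteq> fst ` R \<longrightarrow> p (fan_of R)))"
proof -
  let ?R = "smooth_subdivisions N (fan_of P)"
  let ?U = "\<lambda>\<Sigma>'. {\<Sigma>''\<in>?R. subdivides \<Sigma>'' \<Sigma>'}"
  have U: "?U (fan_of Q) = {fan_of R | R. tiling R \<and> fst ` Q \<subseteq> fst ` R}"
    if Q: "tiling Q" "fst ` P \<subseteq> fst ` Q" for Q
  proof (intro equalityI subsetI)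
    fix \<Sigma>'' assume "\<Sigma>'' \<in> ?U (fan_of Q)"
    then obtain R where "tiling R" "\<Sigma>'' = fan_of R" "subdivides (fan_of R) (fan_of Q)"
      unfolding mem_Collect_eq mem_smooth_subdivisions[OF P] by metis
    then show "\<Sigma>'' \<in> {fan_of R | R. tiling R \<and> fst ` Q \<subseteq> fst ` R}"
      using subdivides_imp_generators[OF Q(1)] by blast
  next
    fix \<Sigma>'' assume "\<Sigma>'' \<in> {fan_of R | R. tiling R \<and> fst ` Q \<subseteq> fst ` R}"
    then obtain R where R: "tiling R" "fst ` Q \<subseteq> fst ` R" "\<Sigma>'' = fan_of R" by blast
    then have "subdivides \<Sigma>'' (fan_of Q)" using generators_imp_subdivides[OF Q(1)] by blast
    moreover have "fst ` P \<subseteq> fst ` R" using Q(2) R(2) by (rule order_trans)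
    then have "\<Sigma>'' \<in> ?R"
      unfolding mem_smooth_subdivisions[OF P] using R(1,3) by blast
    ultimately show "\<Sigma>'' \<in> ?U (fan_of Q)" by blast
  qed
  have ne: "?R \<noteq> {}" using mem_smooth_subdivisions[OF P] P by blast
  have dir: "\<exists>x\<in>?R. principal (?U x) \<le> inf (principal (?U a)) (principal (?U b))"
    if ab: "a \<in> ?R" "b \<in> ?R" for a b
  proof -
    obtain A where A: "tiling A" "fst ` P \<subseteq> fst ` A" "a = fan_of A"
      using ab(1) unfolding mem_smooth_subdivisions[OF P] by blast
    obtain B where B: "tiling B" "fst ` P \<subseteq> fst ` B" "b = fan_of B"
      using ab(2) unfolding mem_smooth_subdivisions[OF P] by blast
    have "finite (fst ` B)" "fst ` B \<subseteq> primitive_vectors N"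
      using tilingD(1)[OF B(1)] generator_primitive[OF B(1)] by auto
    from insert_vectors[OF A(1) this]
    obtain C where C: "tiling C" "fst ` A \<subseteq> fst ` C" "fst ` B \<subseteq> fst ` C" by blast
    have PC: "fst ` P \<subseteq> fst ` C" using A(2) C(2) by (rule order_trans)
    have "fan_of C \<in> ?R" unfolding mem_smooth_subdivisions[OF P] using C(1) PC by blast
    moreover have "?U (fan_of C) \<subseteq> ?U a \<inter> ?U b"
      unfolding A(3) B(3) U[OF A(1,2)] U[OF B(1,2)] U[OF C(1) PC]
      using C(2,3) by (blast intro: order_trans)
    ultimately show ?thesis by (intro bexI[of _ "fan_of C"]) auto
  qed
  have "eventually p (subdivision_filter N (fan_of P)) \<longleftrightarrow> (\<exists>\<Sigma>'\<in>?R. \<forall>\<Sigma>''\<in>?U \<Sigma>'. p \<Sigma>'')"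
    unfolding subdivision_filter_def using eventually_INF_base[OF ne dir]
    by (simp only: eventually_principal)
  also have "\<dots> \<longleftrightarrow> (\<exists>Q. tiling Q \<and> fst ` P \<subseteq> fst ` Q \<and> (\<forall>\<Sigma>''\<in>?U (fan_of Q). p \<Sigma>''))"
    unfolding Bex_def mem_smooth_subdivisions[OF P] by blast
  also have "\<dots> \<longleftrightarrow> (\<exists>Q. tiling Q \<and> fst ` P \<subseteq> fst ` Q \<and>
      (\<forall>R. tiling R \<longrightarrow> fst ` Q \<subseteq> fst ` R \<longrightarrow> p (fan_of R)))"
  proof (intro arg_cong[of _ _ Ex] ext conj_cong refl)
    fix Q assume Q: "tiling Q" "fst ` P \<subseteq> fst ` Q"
    show "(\<forall>\<Sigma>''\<in>?U (fan_of Q). p \<Sigma>'') \<longleftrightarrow>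
        (\<forall>R. tiling R \<longrightarrow> fst ` Q \<subseteq> fst ` R \<longrightarrow> p (fan_of R))"
      unfolding U[OF Q] by blast
  qed
  finally show ?thesis .
qed

text \<open>A finite set of primitive vectors, once contained in the generators of a subdivision,
  stays so in everything finer. This transfers limits over finite sets, hence unconditional sums, to
  limits of the net.\<close>

lemma filterlim_generators:
  assumes P: "tiling P"
  shows "filterlim (\<lambda>\<Sigma>'. fst ` pairs_of \<Sigma>') (finite_subsets_at_top (primitive_vectors N))
    (subdivision_filter N (fan_of P))"
  unfolding filterlim_iff
proof (intro allI impI)
  fix p assume "eventually p (finite_subsets_at_top (primitive_vectors N))"
  then have "\<exists>X. finite X \<and> X \<subseteq> primitive_vectors N \<and>
      (\<forall>Y. finite Y \<and> X \<subseteq> Y \<and> Y \<subseteq> primitive_vectors N \<longrightarrow> p Y)"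
    by (simp only: eventually_finite_subsets_at_top)
  then obtain X where X: "finite X" "X \<subseteq> primitive_vectors N"
    "\<And>Y. finite Y \<Longrightarrow> X \<subseteq> Y \<Longrightarrow> Y \<subseteq> primitive_vectors N \<Longrightarrow> p Y"
    by (elim exE conjE) simp
  obtain Q where Q: "tiling Q" "fst ` P \<subseteq> fst ` Q" "X \<subseteq> fst ` Q"
    using insert_vectors[OF P X(1,2)] by blast
  have "p (fst ` pairs_of (fan_of R))" if R: "tiling R" "fst ` Q \<subseteq> fst ` R" for R
    unfolding pairs_of_fan_of[OF R(1)]
  proof (rule X(3))
    show "finite (fst ` R)" using tilingD(1)[OF R(1)] by simp
    show "X \<subseteq> fst ` R" using Q(3) R(2) by (rule order_trans)
    show "fst ` R \<subseteq> primitive_vectors N" using generator_primitive[OF R(1)] by blast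
  qed
  then show "eventually (\<lambda>\<Sigma>'. p (fst ` pairs_of \<Sigma>')) (subdivision_filter N (fan_of P))"
    unfolding eventually_subdivision_filter[OF P] using Q(1,2) by blast
qed

lemma subdivision_filter_neq_bot:
  assumes P: "tiling P"
  shows "subdivision_filter N (fan_of P) \<noteq> bot"
  unfolding eventually_False[symmetric] eventually_subdivision_filter[OF P] by auto

text \<open>The coefficients of the divisor are values of \<open>- \<phi>\<close>, and the sign
  cancels in a quadratic form.\<close>

lemma intersection_number_b_divisor:
  assumes P: "tiling P" and Q: "tiling Q" and sub: "fst ` P \<subseteq> fst ` Q"
    and D: "toric_b_divisor N (fan_of P) D" and \<phi>: "associated_function N (fan_of P) D \<phi>"
  shows "intersection_number K N (fan_of Q) (D (fan_of Q)) (D (fan_of Q)) = tiling_form Q \<phi> \<phi>"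
proof -
  have R: "fan_of Q \<in> smooth_subdivisions N (fan_of P)"
    unfolding mem_smooth_subdivisions[OF P] using Q sub by (intro exI[of _ Q] conjI refl)
  have E: "D (fan_of Q) \<in> toric_divisors (fan_of Q)"
    using D[unfolded toric_b_divisor_def, THEN conjunct1] R by (rule bspec)
  have val: "D (fan_of Q) (ray u) = - \<phi> u" if u: "u \<in> fst ` Q" for u
  proof -
    have "ray u \<in> rays (fan_of Q)" unfolding rays_fan_of[OF Q] using u by (rule imageI)
    then have "D (fan_of Q) (ray u) = - \<phi> (ray_generator N (ray u))"
      by (rule \<phi>[unfolded associated_function_def, THEN conjunct2, THEN bspec, OF R, THEN bspec])
    then show ?thesis using tiling_ray_generator[OF Q u] by simp
  qed
  have "intersection_number K N (fan_of Q) (D (fan_of Q)) (D (fan_of Q)) =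
      tiling_form Q (\<lambda>u. D (fan_of Q) (ray u)) (\<lambda>u. D (fan_of Q) (ray u))"
    by (rule intersection_number_eq[OF Q E E])
  also have "\<dots> = tiling_form Q (\<lambda>u. - \<phi> u) (\<lambda>u. - \<phi> u)"
    using val by (intro tiling_form_cong[OF Q]) auto
  also have "\<dots> = tiling_form Q \<phi> \<phi>" by (simp add: tiling_form_def)
  finally show ?thesis .
qed

lemma b_degree_tiling:
  fixes K :: "'k::alg_closed_field itself"
  assumes P: "tiling P" and D: "toric_b_divisor N (fan_of P) D"
    and \<phi>: "associated_function N (fan_of P) D \<phi>"
  shows "(b_integrable K N (fan_of P) D \<longleftrightarrow>
            (\<lambda>v. (of_rat (mu N (fan_of P) \<phi> v))\<^sup>2 :: real) summable_on primitive_vectors N) \<and>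
         (b_integrable K N (fan_of P) D \<longrightarrow>
            b_degree K N (fan_of P) D =
              of_rat (intersection_number K N (fan_of P) (D (fan_of P)) (D (fan_of P)))
              - (\<Sum>\<^sub>\<infinity>v\<in>primitive_vectors N. (of_rat (mu N (fan_of P) \<phi> v))\<^sup>2))"
proof -
  let ?F = "subdivision_filter N (fan_of P)" and ?A = "primitive_vectors N"
  define S :: "fan \<Rightarrow> real" where "S \<Sigma>' = of_rat (intersection_number K N \<Sigma>' (D \<Sigma>') (D \<Sigma>'))" for \<Sigma>'
  define m :: "real^2 \<Rightarrow> real" where "m v = (of_rat (mu N (fan_of P) \<phi> v))\<^sup>2" for v
  define c where "c = S (fan_of P)"
  have S: "S (fan_of Q) = c - sum m (fst ` Q)" if Q: "tiling Q" "fst ` P \<subseteq> fst ` Q" for Q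
  proof -
    have "tiling_form Q \<phi> \<phi> = tiling_form P \<phi> \<phi> - (\<Sum>v\<in>fst ` Q. (mu N (fan_of P) \<phi> v)\<^sup>2)"
      by (rule tiling_form_refinement[OF P Q])
    moreover have "S (fan_of Q) = of_rat (tiling_form Q \<phi> \<phi>)" "c = of_rat (tiling_form P \<phi> \<phi>)"
      unfolding S_def c_def
      using intersection_number_b_divisor[OF P Q D \<phi>, of K]
        intersection_number_b_divisor[OF P P order_refl D \<phi>, of K] by simp_all
    ultimately show ?thesis by (simp add: m_def of_rat_diff of_rat_sum of_rat_power)
  qed
  have ev: "eventually (\<lambda>\<Sigma>'. S \<Sigma>' = c - sum m (fst ` pairs_of \<Sigma>')) ?F"
    unfolding eventually_subdivision_filter[OF P]
    by (intro exI[of _ P] conjI P order_refl allI impI) (simp add: S pairs_of_fan_of)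
  have lim: "(S \<longlongrightarrow> c - s) ?F" if "(m has_sum s) ?A" for s
  proof -
    have "((\<lambda>\<Sigma>'. sum m (fst ` pairs_of \<Sigma>')) \<longlongrightarrow> s) ?F"
      by (rule filterlim_compose[OF that[unfolded has_sum_def] filterlim_generators[OF P]])
    then have "((\<lambda>\<Sigma>'. c - sum m (fst ` pairs_of \<Sigma>')) \<longlongrightarrow> c - s) ?F"
      by (intro tendsto_diff tendsto_const)
    then show ?thesis using tendsto_cong[OF ev] by blast
  qed
  have summ: "m summable_on ?A" if L: "(S \<longlongrightarrow> L) ?F" for L
  proof -
    \<comment> \<open>Any bound below the limit serves. It holds on a tail, and every finite set of
      primitive vectors occurs among the generators of a member of that tail, so the partial sums of
      the squares are bounded.\<close>
    have "eventually (\<lambda>\<Sigma>'. L - 1 < S \<Sigma>') ?F" using order_tendstoD(1)[OF L] by simp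
    then obtain Q where Q: "tiling Q" "fst ` P \<subseteq> fst ` Q"
      "\<And>R. tiling R \<Longrightarrow> fst ` Q \<subseteq> fst ` R \<Longrightarrow> L - 1 < S (fan_of R)"
      unfolding eventually_subdivision_filter[OF P] by (elim exE conjE) simp
    have "sum m X \<le> c - L + 1" if X: "X \<subseteq> ?A" "finite X" for X
    proof -
      obtain R where R: "tiling R" "fst ` Q \<subseteq> fst ` R" "X \<subseteq> fst ` R"
        using insert_vectors[OF Q(1) X(2,1)] by blast
      have "sum m X \<le> sum m (fst ` R)"
        using R(3) tilingD(1)[OF R(1)] by (intro sum_mono2) (auto simp: m_def)
      moreover have "L - 1 < c - sum m (fst ` R)"
        using Q(3)[OF R(1,2)] S[OF R(1) order_trans[OF Q(2) R(2)]] by simp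
      ultimately show ?thesis by simp
    qed
    then show ?thesis
      by (intro nonneg_bdd_above_summable_on bdd_aboveI2[of _ _ "c - L + 1"]) (auto simp: m_def)
  qed
  have int: "b_integrable K N (fan_of P) D \<longleftrightarrow> (\<exists>L. (S \<longlongrightarrow> L) ?F)"
    unfolding b_integrable_def S_def by simp
  have iff: "b_integrable K N (fan_of P) D \<longleftrightarrow> m summable_on ?A"
    unfolding int using summ lim unfolding summable_on_def by blast
  moreover have "b_degree K N (fan_of P) D = c - infsum m ?A" if "b_integrable K N (fan_of P) D"
  proof -
    have "(m has_sum infsum m ?A) ?A" using that iff by (simp add: has_sum_infsum)
    from tendsto_Lim[OF subdivision_filter_neq_bot[OF P] lim[OF this]]
    show ?thesis unfolding b_degree_def S_def .
  qed
  ultimately show ?thesis unfolding m_def c_def S_def by blast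
qed

end

theorem theorem5p6:
  fixes N :: "(real^2) set" and \<Sigma> :: fan
    and D :: "fan \<Rightarrow> divisor" and \<phi> :: "real^2 \<Rightarrow> rat"
  assumes "rank2_lattice N"
    and "smooth_fan N \<Sigma>" and "complete_fan \<Sigma>"
    and "toric_b_divisor N \<Sigma> D"
    and "associated_function N \<Sigma> D \<phi>"
  shows "(b_integrable TYPE('k::alg_closed_field) N \<Sigma> D \<longleftrightarrow>
            (\<lambda>v. (of_rat (mu N \<Sigma> \<phi> v))\<^sup>2 :: real) summable_on primitive_vectors N) \<and>
         (b_integrable TYPE('k) N \<Sigma> D \<longrightarrow>
            b_degree TYPE('k) N \<Sigma> D =
              of_rat (intersection_number TYPE('k) N \<Sigma> (D \<Sigma>) (D \<Sigma>))
              - (\<Sum>\<^sub>\<infinity>v\<in>primitive_vectors N. (of_rat (mu N \<Sigma> \<phi> v))\<^sup>2))"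
proof -
  obtain b1 b2 where "lattice_basis N b1 b2"
    using assms(1) unfolding rank2_lattice_def by blast
  \<comment> \<open>Any basis will do: it normalises and orients \<open>vol\<close>, and no object
    in the statement depends on it.\<close>
  then interpret planar_lattice N b1 b2 by unfold_locales
  have \<Sigma>: "fan_of (pairs_of \<Sigma>) = \<Sigma>" using fan_of_pairs_of[OF assms(2,3)] .
  show ?thesis
    using b_degree_tiling[OF tiling_pairs_of[OF assms(2,3)], of D \<phi> "TYPE('k)"] assms(4,5)
    unfolding \<Sigma> by blast
qed

end
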